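(* Let $L\ge 4$ be an even integer and consider the random-access network with queues on the $L\times L$ toric grid, with arrival rate $\lambda>0$, transmission rate $\mu>0$, back-off rate $\nu>0$ and back-off probability $p\in(0,1]$ at every node. Put $\sigma=\nu/(p\mu)$ and $\rho=2\lambda/\mu$, and assume $\rho<1$. Let $\mathbb E W(\sigma)$ be the long-term average delay of an arbitrary packet and let $T_{\mathcal E\to\mathcal O}(\sigma)=\inf\{t>0:X(t)=\mathcal O\}$ for the activity process started at $X(0)=\mathcal E$. Then, as $\sigma\to\infty$ with $\lambda,\mu$ fixed (by letting $\nu\to\infty$, or $p\downarrow0$, or both), $$\liminf_{\sigma\to\infty}\frac{\mathbb E W(\sigma)}{\mathbb E\,T_{\mathcal E\to\mathcal O}(\sigma)}\;\ge\;\frac14\,\frac{\mu}{\mu-\lambda}\;=\;\frac{1}{4-2\rho}.$$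
   Context: Toric grid: $G=(V,E)$ with $V=\{1,\dots,L\}^2$, $L$ even, two vertices (nodes) being adjacent iff they differ by $1 \pmod L$ in exactly one coordinate. $\mathcal E$ and $\mathcal O$ are the sets of vertices with even, respectively odd, coordinate sum. $\Omega\subseteq\{0,1\}^V$ is the collection of (indicator vectors of) independent sets of $G$. Network dynamics: $\{(X(t),Q(t))\}_{t\ge0}$ is the continuous-time Markov process on $\Omega\times\mathbb N^V$, where $X(t)$ is the activity state (the set of currently transmitting nodes) and $Q_i(t)$ is the number of packets waiting at node $i$, excluding a packet in transmission. With $e_i$ the $i$-th unit vector, the transitions are, for each node $i$: - $(X,Q)\to(X,Q+e_i)$ at rate $\lambda$ (packet arrival, a Poisson process); - if $X_i=0$ and $X_j=0$ for all neighbors $j$ of $i$: $(X,Q)\to(X+e_i,\,Q-e_i\mathbf 1_{\{Q_i>0\}})$ at rate $\nu$ (activation: transmission of a waiting packet starts, or of a dummy packet if $Q_i=0$); - if $X_i=1$: $(X,Q)\to(X-e_i,Q)$ at rate $p\mu$ (transmission completed, followed by a back-off period); - if $X_i=1$: $(X,Q)\to(X,\,Q-e_i\mathbf 1_{\{Q_i>0\}})$ at rate $(1-p)\mu$ (transmission completed, next transmission starts immediately, of a dummy packet if $Q_i=0$). Thus $X(t)$ is by itself a Markov process on $\Omega$. The delay of a (non-dummy) packet is its waiting time plus its service time, i.e. the time from its arrival until the completion of its transmission (packets at a node being transmitted, say, in order of arrival); $\mathbb E W(\sigma)$ is the long-term average of the delays over arriving packets (by symmetry the same for every node). *)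

theory Defs
  imports "HOL-Probability.Probability" "HOL-Number_Theory.Cong"
begin

subsection \<open>The toric grid\<close>

type_synonym node = "nat \<times> nat"

definition nodes :: "nat \<Rightarrow> node set" where
  "nodes L = {1..L} \<times> {1..L}"

definition cyc_adj :: "nat \<Rightarrow> nat \<Rightarrow> nat \<Rightarrow> bool" where
  "cyc_adj L a b \<longleftrightarrow> [a = b + 1] (mod L) \<or> [b = a + 1] (mod L)"

definition adj :: "nat \<Rightarrow> node \<Rightarrow> node \<Rightarrow> bool" where
  "adj L i j \<longleftrightarrow> i \<in> nodes L \<and> j \<in> nodes L \<and>
     (fst i = fst j \<and> cyc_adj L (snd i) (snd j) \<or> snd i = snd j \<and> cyc_adj L (fst i) (fst j))"

definition even_nodes :: "nat \<Rightarrow> node set" where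
  "even_nodes L = {i \<in> nodes L. even (fst i + snd i)}"

definition odd_nodes :: "nat \<Rightarrow> node set" where
  "odd_nodes L = {i \<in> nodes L. odd (fst i + snd i)}"

text \<open>Activity states are represented by the set of active nodes.\<close>

definition indep_sets :: "nat \<Rightarrow> node set set" where
  "indep_sets L = {x. x \<subseteq> nodes L \<and> (\<forall>i\<in>x. \<forall>j\<in>x. \<not> adj L i j)}"

subsection \<open>Transitions of the network\<close>

text \<open>The state is \<open>(X, Q)\<close>; queue vectors are functions that vanish outside the grid.\<close>

type_synonym state = "node set \<times> (node \<Rightarrow> nat)"

definition states :: "nat \<Rightarrow> state set" where
  "states L = {(x, q). x \<in> indep_sets L \<and> (\<forall>i. i \<notin> nodes L \<longrightarrow> q i = 0)}"

text \<open>
  Transitions carry a label. The label is needed because completing a transmission and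
  immediately starting a dummy packet leaves \<open>(X, Q)\<close> unchanged, although the packet that
  was being transmitted (which may be a genuine one) departs: delays are not a function of
  the path of \<open>(X, Q)\<close> alone.
\<close>

datatype event =
    Arrival node
  | Activation node
  | Completion_Backoff node
  | Completion_Continue node

instance event :: countable
  by countable_datatype

definition events :: "nat \<Rightarrow> event set" where
  "events L = Arrival ` nodes L \<union> Activation ` nodes L \<union>
     Completion_Backoff ` nodes L \<union> Completion_Continue ` nodes L"

fun rate :: "nat \<Rightarrow> real \<Rightarrow> real \<Rightarrow> real \<Rightarrow> real \<Rightarrow> state \<Rightarrow> event \<Rightarrow> real" where
  "rate L lam mu nu p (x, q) (Arrival i) = (if i \<in> nodes L then lam else 0)"
| "rate L lam mu nu p (x, q) (Activation i) =
     (if i \<in> nodes L \<and> i \<notin> x \<and> (\<forall>j. adj L i j \<longrightarrow> j \<notin> x) then nu else 0)"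
| "rate L lam mu nu p (x, q) (Completion_Backoff i) =
     (if i \<in> nodes L \<and> i \<in> x then p * mu else 0)"
| "rate L lam mu nu p (x, q) (Completion_Continue i) =
     (if i \<in> nodes L \<and> i \<in> x then (1 - p) * mu else 0)"

text \<open>Truncated subtraction on \<open>nat\<close> yields \<open>Q - e\<^sub>i 1{Q\<^sub>i > 0}\<close>.\<close>

fun step :: "state \<Rightarrow> event \<Rightarrow> state" where
  "step (x, q) (Arrival i) = (x, q(i := q i + 1))"
| "step (x, q) (Activation i) = (insert i x, q(i := q i - 1))"
| "step (x, q) (Completion_Backoff i) = (x - {i}, q)"
| "step (x, q) (Completion_Continue i) = (x, q(i := q i - 1))"

definition total_rate :: "nat \<Rightarrow> real \<Rightarrow> real \<Rightarrow> real \<Rightarrow> real \<Rightarrow> state \<Rightarrow> real" where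
  "total_rate L lam mu nu p s = (\<Sum>e\<in>events L. rate L lam mu nu p s e)"

subsection \<open>The Markov process\<close>

text \<open>
  A sample point \<open>\<omega>\<close> lists, for every \<open>n\<close>, the label of the \<open>n\<close>-th transition (counted from 0)
  and the holding time that precedes it.
\<close>

type_synonym path = "nat \<Rightarrow> event \<times> real"

primrec state_before :: "state \<Rightarrow> path \<Rightarrow> nat \<Rightarrow> state" where
  "state_before s \<omega> 0 = s"
| "state_before s \<omega> (Suc n) = step (state_before s \<omega> n) (fst (\<omega> n))"

definition event_time :: "path \<Rightarrow> nat \<Rightarrow> real" where
  "event_time \<omega> n = (\<Sum>k\<le>n. snd (\<omega> k))"

text \<open>The state at time \<open>t\<close>; the path is right-continuous.\<close>

definition state_at :: "state \<Rightarrow> path \<Rightarrow> real \<Rightarrow> state" where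
  "state_at s \<omega> t = state_before s \<omega> (LEAST n. t < event_time \<omega> n)"

definition event_space :: "(event \<times> real) measure" where
  "event_space = count_space UNIV \<Otimes>\<^sub>M borel"

text \<open>
  In state \<open>s\<close> the process waits for an exponential time with parameter \<open>total_rate s\<close> and,
  independently, the transition \<open>e\<close> is then made with probability \<open>rate s e / total_rate s\<close>.
\<close>

definition jump_law ::
  "nat \<Rightarrow> real \<Rightarrow> real \<Rightarrow> real \<Rightarrow> real \<Rightarrow> state \<Rightarrow> (event \<times> real) measure" where
  "jump_law L lam mu nu p s =
     density (count_space UNIV) (\<lambda>e. ennreal (rate L lam mu nu p s e / total_rate L lam mu nu p s))
     \<Otimes>\<^sub>M density lborel (exponential_density (total_rate L lam mu nu p s))"

definition kernel ::
  "nat \<Rightarrow> real \<Rightarrow> real \<Rightarrow> real \<Rightarrow> real \<Rightarrow> state \<Rightarrow> nat \<Rightarrow> path \<Rightarrow> (event \<times> real) measure" where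
  "kernel L lam mu nu p s n \<omega> = jump_law L lam mu nu p (state_before s \<omega> n)"

text \<open>
  The law of the network process started in state \<open>s\<close>: the measure on paths provided by the
  Ionescu-Tulcea theorem for these kernels (their hypotheses are checked below).
\<close>

definition network ::
  "nat \<Rightarrow> real \<Rightarrow> real \<Rightarrow> real \<Rightarrow> real \<Rightarrow> state \<Rightarrow> path measure" where
  "network L lam mu nu p s =
     projective_family.lim UNIV
       (Ionescu_Tulcea.CI (kernel L lam mu nu p s) (\<lambda>_. event_space)) (\<lambda>_. event_space)"

subsection \<open>Transition time between the two maximal activity states\<close>

definition hitting_time :: "state \<Rightarrow> node set \<Rightarrow> path \<Rightarrow> ennreal" where
  "hitting_time s A \<omega> = Inf {ennreal t | t. t > 0 \<and> fst (state_at s \<omega> t) = A}"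

text \<open>
  \<open>X\<close> evolves independently of the queues, so the choice of empty initial queues is immaterial.
\<close>

definition expected_transition_time ::
  "nat \<Rightarrow> real \<Rightarrow> real \<Rightarrow> real \<Rightarrow> real \<Rightarrow> ennreal" where
  "expected_transition_time L lam mu nu p =
     (let s = (even_nodes L, \<lambda>_. 0)
      in \<integral>\<^sup>+ \<omega>. hitting_time s (odd_nodes L) \<omega> \<partial>network L lam mu nu p s)"

subsection \<open>Delays\<close>

definition arrivals :: "path \<Rightarrow> nat set" where
  "arrivals \<omega> = {n. \<exists>i. fst (\<omega> n) = Arrival i}"

fun event_node :: "event \<Rightarrow> node" where
  "event_node (Arrival i) = i"
| "event_node (Activation i) = i"
| "event_node (Completion_Backoff i) = i"
| "event_node (Completion_Continue i) = i"

text \<open>The transitions at which the transmission of a waiting, hence genuine, packet of node \<open>i\<close> starts.\<close>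

definition starts :: "state \<Rightarrow> path \<Rightarrow> node \<Rightarrow> nat set" where
  "starts s \<omega> i = {n. fst (\<omega> n) \<in> {Activation i, Completion_Continue i} \<and>
     snd (state_before s \<omega> n) i > 0}"

definition completions :: "path \<Rightarrow> node \<Rightarrow> nat set" where
  "completions \<omega> i = {n. fst (\<omega> n) \<in> {Completion_Backoff i, Completion_Continue i}}"

text \<open>
  Transmission in order of arrival: a packet that on arrival at transition \<open>n\<close> finds \<open>k\<close> waiting
  packets at its node is the one taken at the \<open>(k+1)\<close>-st start after \<open>n\<close> (\<open>enumerate\<close> counts
  from 0). It leaves at the first completion after that start.
\<close>

definition start_index :: "state \<Rightarrow> path \<Rightarrow> nat \<Rightarrow> nat" where
  "start_index s \<omega> n =
     (let i = event_node (fst (\<omega> n))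
      in enumerate {m \<in> starts s \<omega> i. n < m} (snd (state_before s \<omega> n) i))"

definition departure_index :: "state \<Rightarrow> path \<Rightarrow> nat \<Rightarrow> nat" where
  "departure_index s \<omega> n =
     (LEAST m. m \<in> completions \<omega> (event_node (fst (\<omega> n))) \<and> start_index s \<omega> n < m)"

text \<open>The delay of the \<open>k\<close>-th packet arriving anywhere in the network (counted from 0).\<close>

definition delay :: "state \<Rightarrow> path \<Rightarrow> nat \<Rightarrow> real" where
  "delay s \<omega> k =
     (let n = enumerate (arrivals \<omega>) k
      in event_time \<omega> (departure_index s \<omega> n) - event_time \<omega> n)"

text \<open>
  The long-term average of the delays over the arriving packets. The use of \<open>liminf\<close> makes it
  defined, with values in \<open>[0, \<infinity>]\<close>, without presupposing convergence; whenever the averages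
  converge almost surely to a constant (possibly \<open>\<infinity>\<close>), \<open>mean_delay\<close> is that constant.
\<close>

definition average_delay :: "state \<Rightarrow> path \<Rightarrow> ennreal" where
  "average_delay s \<omega> = liminf (\<lambda>n. (\<Sum>k<n. ennreal (delay s \<omega> k)) / of_nat n)"

definition mean_delay ::
  "nat \<Rightarrow> real \<Rightarrow> real \<Rightarrow> real \<Rightarrow> real \<Rightarrow> state \<Rightarrow> ennreal" where
  "mean_delay L lam mu nu p s = (\<integral>\<^sup>+ \<omega>. average_delay s \<omega> \<partial>network L lam mu nu p s)"

subsection \<open>The limiting regime\<close>

definition sigma :: "real \<Rightarrow> real \<Rightarrow> real \<Rightarrow> real" where
  "sigma mu nu p = nu / (p * mu)"

text \<open>
  \<open>\<sigma> \<rightarrow> \<infinity>\<close> along admissible pairs \<open>(\<nu>, p)\<close>: a property holds eventually iff it holds for all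
  \<open>\<nu> > 0\<close>, \<open>p \<in> (0, 1]\<close> with \<open>\<sigma>\<close> large enough.
\<close>

definition sigma_to_infinity :: "real \<Rightarrow> (real \<times> real) filter" where
  "sigma_to_infinity mu =
     inf (filtercomap (\<lambda>(nu, p). sigma mu nu p) at_top) (principal ({0<..} \<times> {0<..1}))"

lemma eventually_sigma_to_infinity:
  "eventually P (sigma_to_infinity mu) \<longleftrightarrow>
     (\<exists>c. \<forall>nu p. nu > 0 \<longrightarrow> 0 < p \<longrightarrow> p \<le> 1 \<longrightarrow> sigma mu nu p \<ge> c \<longrightarrow> P (nu, p))"
  unfolding sigma_to_infinity_def eventually_inf_principal eventually_filtercomap
    eventually_at_top_linorder
proof safe
  fix Q c
  assume "\<forall>n\<ge>c. Q n"
    and "\<forall>x. Q (case x of (nu, p) \<Rightarrow> sigma mu nu p) \<longrightarrow> x \<in> {0<..} \<times> {0<..1} \<longrightarrow> P x"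
  then show "\<exists>c. \<forall>nu p. nu > 0 \<longrightarrow> 0 < p \<longrightarrow> p \<le> 1 \<longrightarrow> sigma mu nu p \<ge> c \<longrightarrow> P (nu, p)"
    by (intro exI[of _ c]) auto
next
  fix c
  assume "\<forall>nu p. nu > 0 \<longrightarrow> 0 < p \<longrightarrow> p \<le> 1 \<longrightarrow> sigma mu nu p \<ge> c \<longrightarrow> P (nu, p)"
  then show "\<exists>Q. (\<exists>N. \<forall>n\<ge>N. Q n) \<and>
      (\<forall>x. Q (case x of (nu, p) \<Rightarrow> sigma mu nu p) \<longrightarrow> x \<in> {0<..} \<times> {0<..1} \<longrightarrow> P x)"
    by (intro exI[of _ "\<lambda>y. y \<ge> c"]) auto
qed

subsection \<open>Well-definedness of the law of the process\<close>

lemma finite_nodes: "finite (nodes L)"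
  by (simp add: nodes_def)

lemma finite_events: "finite (events L)"
  by (simp add: events_def finite_nodes)

lemma rate_outside: "e \<notin> events L \<Longrightarrow> rate L lam mu nu p s e = 0"
  by (cases s; cases e) (auto simp: events_def)

lemma rate_nonneg:
  assumes "lam \<ge> 0" "mu \<ge> 0" "nu \<ge> 0" "0 \<le> p" "p \<le> 1"
  shows "rate L lam mu nu p s e \<ge> 0"
  using assms by (cases s; cases e) auto

lemma total_rate_pos:
  assumes "L > 0" "lam > 0" "mu \<ge> 0" "nu \<ge> 0" "0 \<le> p" "p \<le> 1"
  shows "total_rate L lam mu nu p s > 0"
proof -
  have "Arrival (1, 1) \<in> events L"
    using assms(1) by (auto simp: events_def nodes_def)
  moreover have "rate L lam mu nu p s (Arrival (1, 1)) > 0"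
    using assms(1,2) by (cases s) (auto simp: nodes_def)
  ultimately show ?thesis
    unfolding total_rate_def using assms
    by (intro sum_pos2[OF finite_events]) (auto intro!: rate_nonneg)
qed

lemma sets_jump_law [measurable_cong]: "sets (jump_law L lam mu nu p s) = sets event_space"
  unfolding jump_law_def event_space_def by (intro sets_pair_measure_cong) simp_all

lemma prob_space_jump_law:
  assumes "L > 0" "lam > 0" "mu \<ge> 0" "nu \<ge> 0" "0 \<le> p" "p \<le> 1"
  shows "prob_space (jump_law L lam mu nu p s)"
proof -
  let ?r = "rate L lam mu nu p s" and ?t = "total_rate L lam mu nu p s"
  have t: "?t > 0"
    using assms by (rule total_rate_pos)
  have r: "?r e \<ge> 0" for e
    using assms by (intro rate_nonneg) auto
  let ?D = "density (count_space UNIV) (\<lambda>e. ennreal (?r e / ?t))"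
  have "emeasure ?D (space ?D) = (\<integral>\<^sup>+e. ennreal (?r e / ?t) \<partial>count_space UNIV)"
    by (simp add: emeasure_density)
  also have "\<dots> = (\<Sum>e\<in>events L. ennreal (?r e / ?t))"
    by (intro nn_integral_count_space'[OF finite_events]) (auto simp: rate_outside)
  also have "\<dots> = ennreal (\<Sum>e\<in>events L. ?r e / ?t)"
    using r t by (intro sum_ennreal) auto
  also have "(\<Sum>e\<in>events L. ?r e / ?t) = 1"
    using t by (simp add: total_rate_def flip: sum_divide_distrib)
  finally interpret D: prob_space ?D
    by (intro prob_spaceI) simp
  interpret E: prob_space "density lborel (exponential_density ?t)"
    using t by (rule prob_space_exponential_density)
  interpret pair_prob_space ?D "density lborel (exponential_density ?t)" ..
  show ?thesis
    unfolding jump_law_def by (rule prob_space_axioms)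
qed

lemma state_before_cong:
  "(\<And>k. k < n \<Longrightarrow> fst (\<omega> k) = fst (\<omega>' k)) \<Longrightarrow> state_before s \<omega> n = state_before s \<omega>' n"
  by (induction n) auto

lemma state_before_eq_fold:
  "state_before s \<omega> n = fold (\<lambda>e s. step s e) (map (\<lambda>k. fst (\<omega> k)) [0..<n]) s"
  by (induction n) auto

lemma measurable_labels:
  "(\<lambda>\<omega>. map (\<lambda>k. fst (\<omega> k)) [0..<n]) \<in>
     PiM {0..<n} (\<lambda>_. event_space) \<rightarrow>\<^sub>M count_space (UNIV :: event list set)"
proof -
  have "(\<lambda>\<omega>. map (\<lambda>k. fst (\<omega> k)) [0..<m]) \<in>
     PiM {0..<n} (\<lambda>_. event_space) \<rightarrow>\<^sub>M count_space (UNIV :: event list set)" if "m \<le> n" for m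
    using that
  proof (induction m)
    case (Suc m)
    have [measurable]: "(\<lambda>\<omega>. fst (\<omega> m)) \<in>
        PiM {0..<n} (\<lambda>_. event_space) \<rightarrow>\<^sub>M count_space (UNIV :: event set)"
    proof (rule measurable_compose[of "\<lambda>\<omega>. \<omega> m" _ event_space fst])
      show "(\<lambda>\<omega>. \<omega> m) \<in> PiM {0..<n} (\<lambda>_. event_space) \<rightarrow>\<^sub>M event_space"
        using Suc.prems by (intro measurable_component_singleton) auto
      show "fst \<in> event_space \<rightarrow>\<^sub>M count_space UNIV"
        unfolding event_space_def by (rule measurable_fst)
    qed
    have [measurable]: "(\<lambda>\<omega>. map (\<lambda>k. fst (\<omega> k)) [0..<m]) \<in>
        PiM {0..<n} (\<lambda>_. event_space) \<rightarrow>\<^sub>M count_space (UNIV :: event list set)"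
      using Suc by simp
    have "(\<lambda>\<omega>. map (\<lambda>k. fst (\<omega> k)) [0..<m] @ [fst (\<omega> m)]) \<in>
        PiM {0..<n} (\<lambda>_. event_space) \<rightarrow>\<^sub>M count_space (UNIV :: event list set)"
      by measurable
    then show ?case
      by simp
  qed simp
  then show ?thesis
    by simp
qed

lemma Ionescu_Tulcea_kernel:
  assumes "L > 0" "lam > 0" "mu \<ge> 0" "nu \<ge> 0" "0 \<le> p" "p \<le> 1"
  shows "Ionescu_Tulcea (kernel L lam mu nu p s) (\<lambda>_. event_space)"
proof (rule Ionescu_Tulcea.intro)
  fix n
  have J: "jump_law L lam mu nu p s' \<in> space (subprob_algebra event_space)" for s'
    using prob_space_imp_subprob_space[OF prob_space_jump_law[OF assms, of s']]
    by (simp add: space_subprob_algebra sets_jump_law)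
  have "kernel L lam mu nu p s n =
    (\<lambda>es. jump_law L lam mu nu p (fold (\<lambda>e s. step s e) es s)) \<circ>
      (\<lambda>\<omega>. map (\<lambda>k. fst (\<omega> k)) [0..<n])"
    by (simp add: fun_eq_iff kernel_def state_before_eq_fold)
  also have "\<dots> \<in> PiM {0..<n} (\<lambda>_. event_space) \<rightarrow>\<^sub>M subprob_algebra event_space"
    by (rule measurable_comp[OF measurable_labels]) (simp add: J)
  finally show "kernel L lam mu nu p s n \<in>
    PiM {0..<n} (\<lambda>_. event_space) \<rightarrow>\<^sub>M subprob_algebra event_space" .
next
  fix n \<omega>
  show "prob_space (kernel L lam mu nu p s n \<omega>)"
    unfolding kernel_def using assms by (rule prob_space_jump_law)
qed

lemma prob_space_network:
  assumes "L > 0" "lam > 0" "mu \<ge> 0" "nu \<ge> 0" "0 \<le> p" "p \<le> 1"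
  shows "prob_space (network L lam mu nu p s)"
proof -
  interpret Ionescu_Tulcea "kernel L lam mu nu p s" "\<lambda>_. event_space"
    using assms by (rule Ionescu_Tulcea_kernel)
  have "emeasure PF.lim (PF.emb UNIV {} (space (PiM {} (\<lambda>_. event_space)))) =
      emeasure (CI {}) (space (PiM {} (\<lambda>_. event_space)))"
    by (rule lim) auto
  also have "\<dots> = 1"
    using PF.prob_space_P[of "{}"] prob_space.emeasure_space_1[of "CI {}"]
    by (simp add: PF.space_P)
  also have "PF.emb UNIV {} (space (PiM {} (\<lambda>_. event_space))) = space PF.lim"
    by (auto simp: prod_emb_def space_PiM)
  finally show ?thesis
    unfolding network_def by (rule prob_spaceI)
qed

end

theory Submission
  imports Defs "HOL-Library.Discrete_Functions"
begin

text \<open>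
  Let \<open>h\<^sub>A(x)\<close> be the expected time the activity process needs to reach the maximal state \<open>A\<close> from
  \<open>x\<close>, for \<open>A\<close> one of the two maximal states and \<open>B\<close> the other. Off \<open>A\<close> the generator maps \<open>h\<^sub>A\<close> to
  \<open>-1\<close>, and by reversibility with respect to \<open>\<pi>(x)\<close> proportional to \<open>\<sigma>\<^bsup>|x|\<^esup>\<close>, it takes the value \<open>1/\<pi>(A) - 1\<close> at \<open>A\<close>;
  moreover \<open>h\<^sub>A\<close> is maximal at \<open>B\<close>, because the dynamics is attractive. Put \<open>H = h\<^sub>A(B)\<close>, which by
  symmetry is the expected transition time.

  For a node \<open>i \<in> A\<close> with \<open>N\<close> packets, waiting or in transmission, the generator maps \<open>N h\<^sub>A(X)\<close> to at
  least \<open>-N + \<lambda> h\<^sub>A(X)\<close> up to terms that are negligible compared with \<open>H\<close>, since \<open>i\<close> is idle in \<open>B\<close> and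
  \<open>h\<^sub>A\<close> vanishes at \<open>A\<close>. Time averages of a generator applied to a bounded function vanish almost
  surely, so the average queue length is at least about \<open>\<lambda> H \<pi>(B) \<approx> \<lambda> H / 2\<close>. As packets are served in
  order of arrival, the average delay is then at least about \<open>H / 2\<close>, and \<open>1/2 > \<mu> / (4 (\<mu> - \<lambda>))\<close>
  because \<open>2\<lambda> < \<mu>\<close>.
\<close>

subsection \<open>A strong law for orthogonal sequences\<close>

text \<open>Stability of the queues is not established, so there is no stationary law of
  \<open>(X, Q)\<close> to average against, and an unbounded function such as the number of packets
  times the hitting time cannot be used directly. The packet count is therefore capped at
  \<open>K\<close>. The cap costs a factor \<open>1 + lam * H / K\<close>, harmless because the
  bound on the delay holds for every \<open>K\<close>, so that \<open>K\<close> may be chosen after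
  \<open>H\<close>.

  Only one-sided estimates enter: the transition time stands in the denominator and is bounded from
  above by \<open>H\<close>, and Little's law is replaced by a count of waiting times alone.

  Two kinds of error are neglected: constants, small against \<open>H\<close>, and
  \<open>mu * H\<close> times the fraction of time spent outside the two maximal states, which is of
  order \<open>1 / sigma\<close>. Since \<open>nu\<close> and \<open>p\<close> vary together, both
  must be controlled by \<open>sigma\<close> alone; this is why a lower bound on \<open>H\<close> is
  needed that is uniform in \<open>p\<close>. The gap between \<open>1/2\<close> and the target
  constant absorbs all of them.\<close>

lemma tendsto_average_of_squares:
  fixes d :: "nat \<Rightarrow> real"
  assumes "(\<lambda>k. (\<Sum>j<k\<^sup>2. d j) / real (k\<^sup>2)) \<longlonglongrightarrow> 0"
    and "(\<lambda>k. (\<Sum>j\<in>{k\<^sup>2..<(Suc k)\<^sup>2}. \<bar>d j\<bar>) / real (k\<^sup>2)) \<longlonglongrightarrow> 0"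
  shows "(\<lambda>n. (\<Sum>j<n. d j) / real n) \<longlonglongrightarrow> 0"
proof -
  define u where "u k = \<bar>(\<Sum>j<k\<^sup>2. d j) / real (k\<^sup>2)\<bar> + (\<Sum>j\<in>{k\<^sup>2..<(Suc k)\<^sup>2}. \<bar>d j\<bar>) / real (k\<^sup>2)" for k
  have u: "u \<longlonglongrightarrow> 0"
    unfolding u_def using tendsto_add[OF tendsto_rabs[OF assms(1)] assms(2)] by simp
  have sq: "filterlim floor_sqrt at_top sequentially"
    unfolding filterlim_at_top
  proof
    fix Z
    show "\<forall>\<^sub>F n in sequentially. Z \<le> floor_sqrt n"
      by (rule eventually_sequentiallyI[of "Z\<^sup>2"]) (auto simp: le_floor_sqrt_iff)
  qed
  have "(\<lambda>n. u (floor_sqrt n)) \<longlonglongrightarrow> 0"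
    using filterlim_compose[OF u sq] .
  then show ?thesis
  proof (rule Lim_null_comparison[rotated], intro eventually_sequentiallyI[of 1])
    fix n :: nat assume n: "n \<ge> 1"
    define k where "k = floor_sqrt n"
    have k: "k\<^sup>2 \<le> n" "n < (Suc k)\<^sup>2" "k \<ge> 1"
      using n Suc_floor_sqrt_power2_gt[of n] by (auto simp: k_def le_floor_sqrt_iff)
    have "(\<Sum>j<n. d j) = (\<Sum>j<k\<^sup>2. d j) + (\<Sum>j\<in>{k\<^sup>2..<n}. d j)"
      using k sum.atLeastLessThan_concat[of 0 "k\<^sup>2" n d] by (simp add: atLeast0LessThan)
    moreover have "\<bar>\<Sum>j\<in>{k\<^sup>2..<n}. d j\<bar> \<le> (\<Sum>j\<in>{k\<^sup>2..<(Suc k)\<^sup>2}. \<bar>d j\<bar>)"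
      using k by (intro order.trans[OF sum_abs] sum_mono2) auto
    ultimately have "\<bar>\<Sum>j<n. d j\<bar> \<le> \<bar>\<Sum>j<k\<^sup>2. d j\<bar> + (\<Sum>j\<in>{k\<^sup>2..<(Suc k)\<^sup>2}. \<bar>d j\<bar>)"
      by linarith
    then have "\<bar>\<Sum>j<n. d j\<bar> / real n \<le> (\<bar>\<Sum>j<k\<^sup>2. d j\<bar> + (\<Sum>j\<in>{k\<^sup>2..<(Suc k)\<^sup>2}. \<bar>d j\<bar>)) / real (k\<^sup>2)"
      using k n by (intro frac_le) (auto simp flip: of_nat_power intro!: add_nonneg_nonneg sum_nonneg)
    then show "norm ((\<Sum>j<n. d j) / real n) \<le> u (floor_sqrt n)"
      by (simp add: u_def k_def add_divide_distrib)
  qed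
qed

context prob_space
begin

lemma AE_summable_if_summable_expectation:
  fixes U :: "nat \<Rightarrow> 'a \<Rightarrow> real"
  assumes "\<And>k. integrable M (U k)" "\<And>k x. U k x \<ge> 0"
    and "\<And>k. expectation (U k) \<le> c k" "summable c"
  shows "AE x in M. summable (\<lambda>k. U k x)"
proof -
  have [measurable]: "U k \<in> borel_measurable M" for k
    using assms(1) by auto
  have c: "c k \<ge> 0" for k
    using assms(2,3) by (meson Bochner_Integration.integral_nonneg order.trans)
  have "(\<integral>\<^sup>+x. (\<Sum>k. ennreal (U k x)) \<partial>M) = (\<Sum>k. \<integral>\<^sup>+x. ennreal (U k x) \<partial>M)"
    by (rule nn_integral_suminf) auto
  also have "\<dots> = (\<Sum>k. ennreal (expectation (U k)))"
    using assms by (subst nn_integral_eq_integral) auto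
  also have "\<dots> \<le> (\<Sum>k. ennreal (c k))"
    using assms by (intro suminf_le ennreal_leI) auto
  also have "\<dots> = ennreal (\<Sum>k. c k)"
    using c assms(4) by (intro suminf_ennreal2) auto
  finally have "(\<integral>\<^sup>+x. (\<Sum>k. ennreal (U k x)) \<partial>M) \<noteq> \<infinity>"
    by (auto simp: top_unique)
  then have "AE x in M. (\<Sum>k. ennreal (U k x)) \<noteq> \<infinity>"
    by (intro nn_integral_noteq_infinite) auto
  then show ?thesis
    by eventually_elim (use assms(2) in \<open>auto intro!: summable_suminf_not_top\<close>)
qed

text \<open>Orthogonality bounds the second moment of the n-th partial sum by \<open>n * C\<close>,
  so along squares \<open>n = k^2\<close> the averages have second moments at most
  \<open>C / k^2\<close>, which is summable. By Cauchy-Schwarz the block of length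
  \<open>2 * k + 1\<close> up to the next square contributes at most
  \<open>(2 * k + 1)^2 * C / k^4\<close>, again summable. This avoids any maximal
  inequality.\<close>

lemma orthogonal_strong_law:
  fixes D :: "nat \<Rightarrow> 'a \<Rightarrow> real"
  assumes [measurable]: "\<And>k. D k \<in> borel_measurable M"
    and int: "\<And>k. integrable M (\<lambda>x. (D k x)\<^sup>2)"
    and le: "\<And>k. expectation (\<lambda>x. (D k x)\<^sup>2) \<le> C"
    and orth: "\<And>j k. j < k \<Longrightarrow> expectation (\<lambda>x. D j x * D k x) = 0"
  shows "AE x in M. (\<lambda>n. (\<Sum>k<n. D k x) / real n) \<longlonglongrightarrow> 0"
proof -
  have int2: "integrable M (\<lambda>x. D j x * D k x)" for j k
  proof (rule Bochner_Integration.integrable_bound[OF Bochner_Integration.integrable_add[OF int[of j] int[of k]]])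
    have "norm (D j x * D k x) \<le> norm ((D j x)\<^sup>2 + (D k x)\<^sup>2)" for x
    proof -
      have "0 \<le> (\<bar>D j x\<bar> - \<bar>D k x\<bar>)\<^sup>2" by simp
      then have "2 * (\<bar>D j x\<bar> * \<bar>D k x\<bar>) \<le> (D j x)\<^sup>2 + (D k x)\<^sup>2"
        by (simp add: power2_diff)
      moreover have "0 \<le> \<bar>D j x\<bar> * \<bar>D k x\<bar>" by simp
      ultimately show ?thesis
        unfolding real_norm_def abs_mult by linarith
    qed
    then show "AE x in M. norm (D j x * D k x) \<le> norm ((D j x)\<^sup>2 + (D k x)\<^sup>2)"
      by simp
  qed simp
  have C: "C \<ge> 0"
    using le[of 0] by (meson Bochner_Integration.integral_nonneg order.trans zero_le_power2)
  have S: "integrable M (\<lambda>x. (\<Sum>k<n. D k x)\<^sup>2) \<and> expectation (\<lambda>x. (\<Sum>k<n. D k x)\<^sup>2) \<le> real n * C" for n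
  proof (induction n)
    case (Suc n)
    have eq: "(\<lambda>x. (\<Sum>k<Suc n. D k x)\<^sup>2) =
        (\<lambda>x. (\<Sum>k<n. D k x)\<^sup>2 + ((D n x)\<^sup>2 + 2 * (\<Sum>j<n. D j x * D n x)))"
      by (simp add: fun_eq_iff power2_sum algebra_simps flip: sum_distrib_right)
    have "expectation (\<lambda>x. \<Sum>j<n. D j x * D n x) = 0"
      using int2 orth by (subst Bochner_Integration.integral_sum) auto
    with Suc int2 int show ?case
      unfolding eq using le[of n] by (simp add: algebra_simps)
  qed simp
  define B where "B k = {k\<^sup>2..<(Suc k)\<^sup>2}" for k :: nat
  have cardB: "real (card (B k)) = 2 * real k + 1" for k
    by (simp add: B_def power2_eq_square)
  have Bsq: "(\<Sum>j\<in>B k. \<bar>D j x\<bar>)\<^sup>2 \<le> (2 * real k + 1) * (\<Sum>j\<in>B k. (D j x)\<^sup>2)" for k x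
    using Cauchy_Schwarz_ineq_sum[of "\<lambda>_. 1" "\<lambda>j. \<bar>D j x\<bar>" "B k"] by (simp add: cardB)
  have Bint: "integrable M (\<lambda>x. (\<Sum>j\<in>B k. \<bar>D j x\<bar>)\<^sup>2)" for k
    by (rule Bochner_Integration.integrable_bound[of _ "\<lambda>x. (2 * real k + 1) * (\<Sum>j\<in>B k. (D j x)\<^sup>2)"])
       (use int Bsq in \<open>auto intro!: AE_I2 order.trans[OF Bsq]\<close>)
  have Bexp: "expectation (\<lambda>x. (\<Sum>j\<in>B k. \<bar>D j x\<bar>)\<^sup>2) \<le> (2 * real k + 1)\<^sup>2 * C" for k
  proof -
    have "expectation (\<lambda>x. (\<Sum>j\<in>B k. \<bar>D j x\<bar>)\<^sup>2) \<le>
        expectation (\<lambda>x. (2 * real k + 1) * (\<Sum>j\<in>B k. (D j x)\<^sup>2))"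
      using Bsq Bint int by (intro integral_mono) auto
    also have "\<dots> = (2 * real k + 1) * (\<Sum>j\<in>B k. expectation (\<lambda>x. (D j x)\<^sup>2))"
      using int by simp
    also have "\<dots> \<le> (2 * real k + 1) * (real (card (B k)) * C)"
      using le by (intro mult_left_mono sum_bounded_above) auto
    finally show ?thesis
      by (simp add: cardB power2_eq_square algebra_simps)
  qed
  define U where "U k x = ((\<Sum>j<k\<^sup>2. D j x) / real (k\<^sup>2))\<^sup>2 + ((\<Sum>j\<in>B k. \<bar>D j x\<bar>) / real (k\<^sup>2))\<^sup>2" for k x
  have "AE x in M. summable (\<lambda>k. U k x)"
  proof (rule AE_summable_if_summable_expectation)
    show "integrable M (U k)" for k
      unfolding U_def power_divide using S Bint by auto
    \<comment> \<open>The constant is \<open>1 + 9\<close>: the partial sum gives \<open>1\<close>,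
      the block gives \<open>9\<close> through \<open>2 * k + 1 \<le> 3 * k\<close>. At
      \<open>k = 0\<close> division by zero makes both sides vanish.\<close>
    show "expectation (U k) \<le> 10 * C * inverse (real k ^ 2)" for k
    proof (cases "k = 0")
      case False
      then have k: "real k \<ge> 1" by simp
      have "expectation (U k) \<le> real (k\<^sup>2) * C / (real (k\<^sup>2))\<^sup>2 + (2 * real k + 1)\<^sup>2 * C / (real (k\<^sup>2))\<^sup>2"
        unfolding U_def power_divide using S[of "k\<^sup>2"] Bint Bexp by (auto simp del: of_nat_power intro!: add_mono divide_right_mono)
      also have "(2 * real k + 1)\<^sup>2 * C / (real (k\<^sup>2))\<^sup>2 \<le> (9 * real k ^ 2) * C / (real (k\<^sup>2))\<^sup>2"
        using k C by (intro divide_right_mono mult_right_mono) (auto simp flip: power_mult_distrib intro!: order.trans[OF power_mono[of "2 * real k + 1" "3 * real k" 2]])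
      also have "real (k\<^sup>2) * C / (real (k\<^sup>2))\<^sup>2 + (9 * real k ^ 2) * C / (real (k\<^sup>2))\<^sup>2 = 10 * C * inverse (real k ^ 2)"
        using k by (simp add: field_simps power2_eq_square)
      finally show ?thesis by simp
    qed (simp add: U_def[abs_def])
    show "summable (\<lambda>k. 10 * C * inverse (real k ^ 2))"
      using inverse_power_summable[of 2, where 'a = real] by (intro summable_mult) auto
  qed (simp add: U_def)
  then show ?thesis
  proof eventually_elim
    case (elim x)
    then have U: "(\<lambda>k. U k x) \<longlonglongrightarrow> 0"
      by (rule summable_LIMSEQ_zero)
    have sq: "v \<longlonglongrightarrow> 0" if "\<And>k. (v k)\<^sup>2 \<le> U k x" for v :: "nat \<Rightarrow> real"
    proof -
      have "(\<lambda>k. (v k)\<^sup>2) \<longlonglongrightarrow> 0"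
        by (rule Lim_null_comparison[OF _ U]) (simp add: that)
      then show ?thesis by simp
    qed
    show ?case
      by (rule tendsto_average_of_squares; rule sq) (auto simp: U_def B_def)
  qed
qed

end

subsection \<open>Ergodic averages of the network process\<close>

context Ionescu_Tulcea
begin

lemma distr_lim_atLeast0LessThan:
  "distr PF.lim (PiM {0..<n} M) (\<lambda>\<omega>. restrict \<omega> {0..<n}) = C 0 n (\<lambda>_. undefined)"
proof -
  have "CI {0..<n} = C 0 n (\<lambda>_. undefined)"
  proof (rule measure_eqI)
    fix A assume "A \<in> sets (CI {0..<n})"
    then have A: "A \<in> sets (PiM {0..<n} M)"
      by (simp add: CI_def)
    then have "prod_emb {0..<n} M {0..<n} A = A"
      using sets.sets_into_space[OF A] by (auto simp: prod_emb_def space_PiM)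
    then show "emeasure (CI {0..<n}) A = emeasure (C 0 n (\<lambda>_. undefined)) A"
      using emeasure_CI[OF subset_refl A] by simp
  qed (simp add: CI_def sets_C)
  then show ?thesis
    by (simp add: distr_lim)
qed

lemma nn_integral_lim:
  assumes f: "f \<in> borel_measurable (PiM {0..<n} M)"
  shows "(\<integral>\<^sup>+\<omega>. f (restrict \<omega> {0..<n}) \<partial>PF.lim) = (\<integral>\<^sup>+\<omega>. f \<omega> \<partial>C 0 n (\<lambda>_. undefined))"
proof -
  have "(\<lambda>\<omega>. restrict \<omega> {0..<n}) \<in> PF.lim \<rightarrow>\<^sub>M PiM {0..<n} M"
    by (subst measurable_cong_sets[OF PF.sets_lim refl]) (rule measurable_restrict_subset, simp)
  then show ?thesis
    using f by (simp add: nn_integral_distr flip: distr_lim_atLeast0LessThan)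
qed

text \<open>Conditioning on the first \<open>n\<close> coordinates, written as an iterated integral.
  All later conditional expectations under the path law are instances of it.\<close>

lemma nn_integral_lim_Suc:
  assumes f: "f \<in> borel_measurable (PiM {0..<Suc n} M)"
  shows "(\<integral>\<^sup>+\<omega>. f (restrict \<omega> {0..<Suc n}) \<partial>PF.lim) =
    (\<integral>\<^sup>+\<omega>. (\<integral>\<^sup>+x. f ((restrict \<omega> {0..<n})(n := x)) \<partial>P n (restrict \<omega> {0..<n})) \<partial>PF.lim)"
proof -
  let ?u = "\<lambda>_. undefined"
  have u: "?u \<in> space (PiM {0..<0} M)"
    by simp
  have meas: "(\<lambda>\<omega>. \<integral>\<^sup>+x. f x \<partial>eP n \<omega>) \<in> borel_measurable (PiM {0..<n} M)"
    using measurable_compose[OF measurable_eP nn_integral_measurable_subprob_algebra[OF f]] by simp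
  have eP: "eP n \<in> measurable (C 0 n ?u) (subprob_algebra (PiM {0..<Suc n} M))"
    using measurable_eP[of n] by (subst measurable_cong_sets[OF _ refl]) (auto simp: sets_C[OF u])
  have "(\<integral>\<^sup>+\<omega>. f (restrict \<omega> {0..<Suc n}) \<partial>PF.lim) = (\<integral>\<^sup>+\<omega>. f \<omega> \<partial>C 0 (Suc n) ?u)"
    by (rule nn_integral_lim[OF f])
  also have "\<dots> = (\<integral>\<^sup>+\<omega>. \<integral>\<^sup>+x. f x \<partial>eP n \<omega> \<partial>C 0 n ?u)"
    using nn_integral_bind[OF f eP] by simp
  also have "\<dots> = (\<integral>\<^sup>+\<omega>. (\<integral>\<^sup>+x. f x \<partial>eP n (restrict \<omega> {0..<n})) \<partial>PF.lim)"
    by (rule nn_integral_lim[OF meas, symmetric])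
  also have "\<dots> = (\<integral>\<^sup>+\<omega>. (\<integral>\<^sup>+x. f ((restrict \<omega> {0..<n})(n := x)) \<partial>P n (restrict \<omega> {0..<n})) \<partial>PF.lim)"
  proof (rule nn_integral_cong)
    fix \<omega> assume "\<omega> \<in> space PF.lim"
    then have "\<omega> \<in> space (PiM UNIV M)"
      by (simp add: PF.space_lim)
    then have "restrict \<omega> {0..<n} \<in> space (PiM {0..<n} M)"
      by (auto simp: space_PiM)
    then show "(\<integral>\<^sup>+x. f x \<partial>eP n (restrict \<omega> {0..<n})) =
        (\<integral>\<^sup>+x. f ((restrict \<omega> {0..<n})(n := x)) \<partial>P n (restrict \<omega> {0..<n}))"
      using f by (rule nn_integral_eP)
  qed
  finally show ?thesis .
qed

end

section \<open>One-step conditioning and martingale differences of the jump chain\<close>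

locale network_process =
  fixes L :: nat and lam mu nu p :: real and s :: state
  assumes L_pos: "L > 0" and lam_pos: "lam > 0" and mu_pos: "mu > 0" and nu_pos: "nu > 0"
    and p_pos: "p > 0" and p_le_1: "p \<le> 1"
begin

abbreviation law :: "path measure" where
  "law \<equiv> network L lam mu nu p s"

abbreviation rt :: "state \<Rightarrow> event \<Rightarrow> real" where
  "rt \<equiv> rate L lam mu nu p"

abbreviation tot :: "state \<Rightarrow> real" where
  "tot \<equiv> total_rate L lam mu nu p"

abbreviation jump :: "state \<Rightarrow> (event \<times> real) measure" where
  "jump \<equiv> jump_law L lam mu nu p"

abbreviation st :: "path \<Rightarrow> nat \<Rightarrow> state" where
  "st \<equiv> state_before s"

lemma tot_pos [simp]: "tot x > 0"
  using L_pos lam_pos mu_pos nu_pos p_pos p_le_1 by (intro total_rate_pos) auto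

lemma rt_nonneg [simp]: "rt x e \<ge> 0"
  using lam_pos mu_pos nu_pos p_pos p_le_1 by (intro rate_nonneg) auto

sublocale IT: Ionescu_Tulcea "kernel L lam mu nu p s" "\<lambda>_. event_space"
  using L_pos lam_pos mu_pos nu_pos p_pos p_le_1 by (intro Ionescu_Tulcea_kernel) auto

sublocale N: prob_space law
  using L_pos lam_pos mu_pos nu_pos p_pos p_le_1 by (intro prob_space_network) auto

lemma law_eq: "law = IT.PF.lim"
  by (simp add: network_def)

lemma sets_law: "sets law = sets (PiM UNIV (\<lambda>_. event_space))"
  by (simp add: law_eq)

lemma measurable_law_iff: "f \<in> law \<rightarrow>\<^sub>M A \<longleftrightarrow> f \<in> PiM UNIV (\<lambda>_. event_space) \<rightarrow>\<^sub>M A"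
  by (subst measurable_cong_sets[OF sets_law refl]) simp

text \<open>\<open>local\<close> says that \<open>f\<close> ignores the coordinates beyond
  \<open>n\<close>. Since the kernel sees the past only through its labels, restrictions of the path
  can be replaced by an update of the full path at \<open>n\<close>.\<close>

lemma nn_integral_network_Suc:
  assumes "f \<in> borel_measurable (PiM {0..<Suc n} (\<lambda>_. event_space))"
    and local: "\<And>\<omega>. f (restrict \<omega> {0..<Suc n}) = f \<omega>"
  shows "(\<integral>\<^sup>+\<omega>. f \<omega> \<partial>law) = (\<integral>\<^sup>+\<omega>. (\<integral>\<^sup>+x. f (fun_upd \<omega> n x) \<partial>jump (st \<omega> n)) \<partial>law)"
proof -
  have "(restrict \<omega> {0..<n})(n := x) = restrict (fun_upd \<omega> n x) {0..<Suc n}" for \<omega> and x :: "event \<times> real"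
    by (auto simp: fun_eq_iff restrict_def)
  then have "f ((restrict \<omega> {0..<n})(n := x)) = f (fun_upd \<omega> n x)" for \<omega> x
    using local by metis
  moreover have "kernel L lam mu nu p s n (restrict \<omega> {0..<n}) = jump (st \<omega> n)" for \<omega>
    unfolding kernel_def by (subst state_before_cong[of n _ \<omega>]) auto
  ultimately show ?thesis
    using IT.nn_integral_lim_Suc[OF assms(1)] by (simp add: law_eq local)
qed

text \<open>The type of states is uncountable, as it contains all queue functions. Measurability is
  routed through the finite list of labels, which lives in a countable type and determines the
  state; every function of the state is then measurable.\<close>

lemma measurable_labels_superset:
  assumes "{0..<n} \<subseteq> I"
  shows "(\<lambda>\<omega>. map (\<lambda>k. fst (\<omega> k)) [0..<n]) \<in>
    PiM I (\<lambda>_. event_space) \<rightarrow>\<^sub>M count_space (UNIV :: event list set)"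
proof -
  have "(\<lambda>\<omega>. map (\<lambda>k. fst (restrict \<omega> {0..<n} k)) [0..<n]) \<in>
    PiM I (\<lambda>_. event_space) \<rightarrow>\<^sub>M count_space (UNIV :: event list set)"
    by (rule measurable_compose[OF measurable_restrict_subset[OF assms] measurable_labels])
  also have "(\<lambda>\<omega>. map (\<lambda>k. fst (restrict \<omega> {0..<n} k)) [0..<n]) =
      (\<lambda>\<omega>::path. map (\<lambda>k. fst (\<omega> k)) [0..<n])"
    by (auto simp: fun_eq_iff)
  finally show ?thesis .
qed

lemma measurable_state_label:
  assumes "{0..n} \<subseteq> I"
  shows "(\<lambda>\<omega>. g (st \<omega> n) (fst (\<omega> n))) \<in> PiM I (\<lambda>_. event_space) \<rightarrow>\<^sub>M count_space UNIV"
proof -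
  have "(\<lambda>\<omega>. (\<lambda>es. g (fold (\<lambda>e s. step s e) (butlast es) s) (last es)) (map (\<lambda>k. fst (\<omega> k)) [0..<Suc n])) \<in>
     PiM I (\<lambda>_. event_space) \<rightarrow>\<^sub>M count_space UNIV"
    using assms by (intro measurable_compose[OF measurable_labels_superset]) auto
  then show ?thesis
    by (simp add: state_before_eq_fold butlast_append)
qed

lemma measurable_state:
  assumes "{0..<n} \<subseteq> I"
  shows "(\<lambda>\<omega>. g (st \<omega> n)) \<in> PiM I (\<lambda>_. event_space) \<rightarrow>\<^sub>M count_space UNIV"
proof -
  have "(\<lambda>\<omega>. (\<lambda>es. g (fold (\<lambda>e s. step s e) es s)) (map (\<lambda>k. fst (\<omega> k)) [0..<n])) \<in>
     PiM I (\<lambda>_. event_space) \<rightarrow>\<^sub>M count_space UNIV"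
    using assms by (intro measurable_compose[OF measurable_labels_superset]) auto
  then show ?thesis
    by (simp add: state_before_eq_fold)
qed

lemma borel_measurable_state_label [measurable (raw)]:
  fixes g :: "state \<Rightarrow> event \<Rightarrow> 'b :: topological_space"
  assumes "{0..n} \<subseteq> I"
  shows "(\<lambda>\<omega>. g (st \<omega> n) (fst (\<omega> n))) \<in> borel_measurable (PiM I (\<lambda>_. event_space))"
  using measurable_compose[OF measurable_state_label[OF assms, of g], of id borel] by simp

lemma borel_measurable_state [measurable (raw)]:
  fixes g :: "state \<Rightarrow> 'b :: topological_space"
  assumes "{0..<n} \<subseteq> I"
  shows "(\<lambda>\<omega>. g (st \<omega> n)) \<in> borel_measurable (PiM I (\<lambda>_. event_space))"
  using measurable_compose[OF measurable_state[OF assms, of g], of id borel] by simp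

lemma borel_measurable_holding [measurable (raw)]:
  assumes "n \<in> I"
  shows "(\<lambda>\<omega>. snd (\<omega> n)) \<in> borel_measurable (PiM I (\<lambda>_. event_space))"
proof (rule measurable_compose[of "\<lambda>\<omega>. \<omega> n" _ event_space snd])
  show "snd \<in> event_space \<rightarrow>\<^sub>M borel"
    unfolding event_space_def by (rule measurable_snd)
qed (use assms in \<open>rule measurable_component_singleton\<close>)

text \<open>Conditioning on the past shows that the positive and the negative part of
  \<open>f\<close> have equal integrals. If these are finite they cancel; otherwise \<open>f\<close>
  is not integrable and its expectation is \<open>0\<close> by convention.\<close>

lemma expectation_eq_0_step:
  fixes f :: "path \<Rightarrow> real"
  assumes f: "f \<in> borel_measurable (PiM {0..<Suc n} (\<lambda>_. event_space))"
    and local: "\<And>\<omega>. f (restrict \<omega> {0..<Suc n}) = f \<omega>"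
    and int: "\<And>\<omega>. integrable (jump (st \<omega> n)) (\<lambda>x. f (fun_upd \<omega> n x))"
    and 0: "\<And>\<omega>. (\<integral>x. f (fun_upd \<omega> n x) \<partial>jump (st \<omega> n)) = 0"
  shows "N.expectation f = 0"
proof -
  have "(\<integral>\<^sup>+x. ennreal (f (fun_upd \<omega> n x)) \<partial>jump (st \<omega> n)) =
      (\<integral>\<^sup>+x. ennreal (- f (fun_upd \<omega> n x)) \<partial>jump (st \<omega> n))" for \<omega>
    using 0[of \<omega>] int[of \<omega>, unfolded real_integrable_def]
    by (metis (no_types, lifting) ennreal_enn2real infinity_ennreal_def less_top
        real_lebesgue_integral_def[OF int] eq_iff_diff_eq_0)
  then have "(\<integral>\<^sup>+\<omega>. ennreal (f \<omega>) \<partial>law) = (\<integral>\<^sup>+\<omega>. ennreal (- f \<omega>) \<partial>law)"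
    using f local by (subst (1 2) nn_integral_network_Suc[of _ n]) auto
  moreover have "f \<in> borel_measurable law"
  proof -
    have "(\<lambda>\<omega>. f (restrict \<omega> {0..<Suc n})) \<in> borel_measurable (PiM UNIV (\<lambda>_. event_space))"
      by (rule measurable_compose[OF measurable_restrict_subset f]) simp
    then show ?thesis
      by (simp add: local measurable_law_iff)
  qed
  ultimately show ?thesis
    by (cases "integrable law f") (simp_all add: real_lebesgue_integral_def not_integrable_integral_eq)
qed

text \<open>The probability of a violation at transition \<open>n\<close> is obtained by integrating
  the jump law over the past, hence is \<open>0\<close>. As \<open>P\<close> depends on an
  uncountable state, its measurability is checked separately for each of the countably many label
  lists.\<close>

lemma AE_step:
  assumes "\<And>x. AE y in jump x. P x (fst y) (snd y)"
    and [measurable]: "\<And>x e. Measurable.pred borel (P x e)"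
  shows "AE \<omega> in law. \<forall>n. P (st \<omega> n) (fst (\<omega> n)) (snd (\<omega> n))"
proof (subst AE_all_countable, rule allI)
  fix n
  let ?g = "\<lambda>\<omega>::path. map (\<lambda>k. fst (\<omega> k)) [0..<Suc n]"
  define Q where "Q \<omega> \<longleftrightarrow> P (st \<omega> n) (fst (\<omega> n)) (snd (\<omega> n))" for \<omega> :: path
  have meas: "Measurable.pred (PiM I (\<lambda>_. event_space)) Q" if "{0..<Suc n} \<subseteq> I" for I
  proof -
    note [measurable] = borel_measurable_holding[of n I]
    have n: "n \<in> I" using that by auto
    have "(\<lambda>\<omega>. (\<lambda>es \<omega>. P (fold (\<lambda>e s. step s e) (butlast es) s) (last es) (snd (\<omega> n))) (?g \<omega>) \<omega>)
        \<in> PiM I (\<lambda>_. event_space) \<rightarrow>\<^sub>M count_space UNIV"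
      by (rule measurable_compose_countable'[OF _ measurable_labels_superset[OF that]])
        (use n in measurable)
    then show ?thesis
      by (simp add: Q_def[abs_def] state_before_eq_fold butlast_append)
  qed
  have Q_local: "Q (restrict \<omega> {0..<Suc n}) \<longleftrightarrow> Q \<omega>" for \<omega>
    unfolding Q_def by (subst state_before_cong[of n _ \<omega>]) auto
  have "(\<integral>\<^sup>+\<omega>. indicator {\<omega>. \<not> Q \<omega>} \<omega> \<partial>law) =
      (\<integral>\<^sup>+\<omega>. (\<integral>\<^sup>+y. indicator {\<omega>. \<not> Q \<omega>} (fun_upd \<omega> n y) \<partial>jump (st \<omega> n)) \<partial>law)"
  proof (rule nn_integral_network_Suc)
    show "indicator {\<omega>. \<not> Q \<omega>} \<in> borel_measurable (Pi\<^sub>M {0..<Suc n} (\<lambda>_. event_space))"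
      using meas[OF subset_refl] by measurable
  qed (auto simp: Q_local split: split_indicator)
  also have "\<dots> = (\<integral>\<^sup>+\<omega>. 0 \<partial>law)"
  proof (rule nn_integral_cong, rule nn_integral_zero')
    fix \<omega>
    have "Q (fun_upd \<omega> n y) \<longleftrightarrow> P (st \<omega> n) (fst y) (snd y)" for y
      unfolding Q_def by (subst state_before_cong[of n _ \<omega>]) auto
    with assms(1)[of "st \<omega> n"]
    show "AE y in jump (st \<omega> n). (indicator {\<omega>. \<not> Q \<omega>} (fun_upd \<omega> n y) :: ennreal) = 0"
      by (auto split: split_indicator)
  qed
  finally have "(\<integral>\<^sup>+\<omega>. indicator {\<omega>. \<not> Q \<omega>} \<omega> \<partial>law) = 0"
    by simp
  moreover have "Measurable.pred law Q"
    using meas[of UNIV] by (simp add: measurable_law_iff)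
  ultimately have "AE \<omega> in law. (indicator {\<omega>. \<not> Q \<omega>} \<omega> :: ennreal) = 0"
    by (subst (asm) nn_integral_0_iff_AE) auto
  then show "AE \<omega> in law. P (st \<omega> n) (fst (\<omega> n)) (snd (\<omega> n))"
    by eventually_elim (auto simp: Q_def split: split_indicator_asm)
qed

text \<open>The intensity at which a sum of \<open>F\<close> over the transitions grows. For the
  increments of a function of the state it is the generator applied to that function.\<close>

definition compensator :: "(state \<Rightarrow> event \<Rightarrow> real) \<Rightarrow> state \<Rightarrow> real" where
  "compensator F x = (\<Sum>e\<in>events L. rt x e * F x e)"

lemma abs_compensator_le:
  assumes "\<And>x e. \<bar>F x e\<bar> \<le> C"
  shows "\<bar>compensator F x\<bar> \<le> C * tot x"
proof -
  have "\<bar>compensator F x\<bar> \<le> (\<Sum>e\<in>events L. rt x e * C)"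
    unfolding compensator_def
    by (rule order.trans[OF sum_abs]) (auto intro!: sum_mono mult_left_mono simp: abs_mult assms)
  then show ?thesis
    by (simp add: total_rate_def sum_distrib_left mult.commute)
qed

text \<open>Both factors of the product law are recovered as push-forwards under the projections.
  The label is then a finite discrete variable, and the exponential density is the Erlang density of
  shape \<open>0\<close>, whose moments are known.\<close>

lemma jump_moments:
  assumes F: "\<And>e. \<bar>F e\<bar> \<le> C"
  shows "integrable (jump x) (\<lambda>y. F (fst y))"
    and "(\<integral>y. F (fst y) \<partial>jump x) = (\<Sum>e\<in>events L. rt x e * F e) / tot x"
    and "integrable (jump x) (\<lambda>y. snd y)" "(\<integral>y. snd y \<partial>jump x) = 1 / tot x"
    and "integrable (jump x) (\<lambda>y. (snd y)\<^sup>2)" "(\<integral>y. (snd y)\<^sup>2 \<partial>jump x) = 2 / (tot x)\<^sup>2"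
    and "AE y in jump x. rt x (fst y) > 0 \<and> snd y > 0"
proof -
  define A where "A = density (count_space UNIV) (\<lambda>e. ennreal (rt x e / tot x))"
  define B where "B = density lborel (exponential_density (tot x))"
  have jump: "jump x = A \<Otimes>\<^sub>M B"
    by (simp add: jump_law_def A_def B_def)
  interpret J: prob_space "jump x"
    using L_pos lam_pos mu_pos nu_pos p_pos p_le_1 by (intro prob_space_jump_law) auto
  interpret B: prob_space B
    unfolding B_def by (rule prob_space_exponential_density) simp
  have "emeasure A (space A) = emeasure (A \<Otimes>\<^sub>M B) (space A \<times> space B)"
    by (subst B.emeasure_pair_measure_Times) (auto simp: B.emeasure_space_1)
  also have "\<dots> = 1"
    using J.emeasure_space_1 by (simp add: jump space_pair_measure)
  finally interpret A: prob_space A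
    by (rule prob_spaceI)
  have A: "distr (jump x) A fst = A"
    unfolding jump by (rule B.distr_pair_fst)
  have B: "distr (jump x) B snd = B"
  proof (rule measure_eqI)
    fix X assume X: "X \<in> sets (distr (jump x) B snd)"
    then have "snd -` X \<inter> space (A \<Otimes>\<^sub>M B) = space A \<times> X"
      using sets.sets_into_space[of X B] by (auto simp: space_pair_measure)
    with X show "emeasure (distr (jump x) B snd) X = emeasure B X"
      by (simp add: jump emeasure_distr B.emeasure_pair_measure_Times A.emeasure_space_1)
  qed simp
  have fst [measurable]: "fst \<in> jump x \<rightarrow>\<^sub>M A" and snd [measurable]: "snd \<in> jump x \<rightarrow>\<^sub>M B"
    by (simp_all add: jump)
  have F_A: "F \<in> borel_measurable A"
    by (simp add: A_def)
  have intA: "integrable A F"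
    by (rule A.integrable_const_bound[of _ C]) (use F F_A in auto)
  then have "integrable (distr (jump x) A fst) F"
    by (simp add: A)
  then show "integrable (jump x) (\<lambda>y. F (fst y))"
    by (rule integrable_distr[OF fst])
  have "(\<integral>y. F (fst y) \<partial>jump x) = (\<integral>e. F e \<partial>A)"
    by (subst integral_distr[OF fst F_A, symmetric]) (simp add: A)
  also have "\<dots> = (\<integral>e. rt x e / tot x * F e \<partial>count_space UNIV)"
    unfolding A_def using tot_pos[of x] by (subst integral_density) (auto intro!: AE_I2 divide_nonneg_pos)
  also have "\<dots> = (\<Sum>e\<in>events L. rt x e / tot x * F e)"
  proof (subst lebesgue_integral_count_space_finite_support)
    have sub: "{a \<in> UNIV. rt x a / tot x * F a \<noteq> 0} \<subseteq> events L"
      using rate_outside[of _ L lam mu nu p x] by auto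
    then show "finite {a \<in> UNIV. rt x a / tot x * F a \<noteq> 0}"
      using finite_events finite_subset by blast
    show "(\<Sum>a | a \<in> UNIV \<and> rt x a / tot x * F a \<noteq> 0. rt x a / tot x * F a) =
        (\<Sum>e\<in>events L. rt x e / tot x * F e)"
      using sub by (intro sum.mono_neutral_left finite_events) auto
  qed
  finally show "(\<integral>y. F (fst y) \<partial>jump x) = (\<Sum>e\<in>events L. rt x e * F e) / tot x"
    by (simp add: sum_divide_distrib)
  have "distr (jump x) lborel snd = distr (jump x) B snd"
    by (rule distr_cong) (auto simp: B_def)
  then have "distr (jump x) lborel snd = density lborel (exponential_density (tot x))"
    using B by (simp add: B_def)
  then have D: "distributed (jump x) lborel snd (exponential_density (tot x))"
    using snd unfolding distributed_def
    by (auto simp: B_def measurable_cong_sets[of "jump x" "jump x" B lborel])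
  show "integrable (jump x) (\<lambda>y. snd y)" "(\<integral>y. snd y \<partial>jump x) = 1 / tot x"
    "integrable (jump x) (\<lambda>y. (snd y)\<^sup>2)" "(\<integral>y. (snd y)\<^sup>2 \<partial>jump x) = 2 / (tot x)\<^sup>2"
    using J.erlang_ith_moment_integrable[OF tot_pos D, of 1] J.erlang_ith_moment[OF tot_pos D, of 1]
      J.erlang_ith_moment_integrable[OF tot_pos D, of 2] J.erlang_ith_moment[OF tot_pos D, of 2]
    by (simp_all add: numeral_2_eq_2)
  have "AE e in A. rt x e > 0"
    unfolding A_def using tot_pos[of x]
    by (subst AE_density) (auto simp: AE_count_space zero_less_divide_iff simp del: tot_pos)
  then have 1: "AE y in jump x. rt x (fst y) > 0"
    by (intro AE_distrD[OF fst]) (subst A)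
  have "AE t in B. t > 0"
    unfolding B_def using AE_lborel_singleton[of "0::real"]
    by (subst AE_density) (auto simp: exponential_density_def)
  then have 2: "AE y in jump x. snd y > 0"
    by (intro AE_distrD[OF snd]) (subst B)
  from 1 2 show "AE y in jump x. rt x (fst y) > 0 \<and> snd y > 0"
    by simp
qed

text \<open>The compensator is weighted by the actual holding time rather than by its mean
  \<open>1 / tot\<close>. The conditional mean is still \<open>0\<close>, and the subtracted terms
  add up to a time integral along the path.\<close>

definition martingale_diff :: "(state \<Rightarrow> event \<Rightarrow> real) \<Rightarrow> nat \<Rightarrow> path \<Rightarrow> real" where
  "martingale_diff F n \<omega> = F (st \<omega> n) (fst (\<omega> n)) - snd (\<omega> n) * compensator F (st \<omega> n)"

lemma measurable_martingale_diff:
  assumes "{0..n} \<subseteq> I"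
  shows "martingale_diff F n \<in> borel_measurable (PiM I (\<lambda>_. event_space))"
proof -
  have "n \<in> I" "{0..<n} \<subseteq> I" using assms by auto
  then show ?thesis
    unfolding martingale_diff_def[abs_def] using assms
    by (intro borel_measurable_diff borel_measurable_times borel_measurable_state_label
        borel_measurable_state borel_measurable_holding)
qed

lemma martingale_diff_cong:
  assumes "\<And>k. k \<le> n \<Longrightarrow> \<omega> k = \<omega>' k"
  shows "martingale_diff F n \<omega> = martingale_diff F n \<omega>'"
  using assms state_before_cong[of n \<omega> \<omega>' s] by (simp add: martingale_diff_def)

lemma strong_law:
  assumes C: "\<And>x e. \<bar>F x e\<bar> \<le> C"
  shows "AE \<omega> in law. (\<lambda>n. (\<Sum>k<n. martingale_diff F k \<omega>) / real n) \<longlonglongrightarrow> 0"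
proof (rule N.orthogonal_strong_law)
  have C0: "C \<ge> 0" using C[of s "Arrival (1,1)"] by linarith
  show meas: "martingale_diff F n \<in> borel_measurable law" for n
    using measurable_martingale_diff[of n UNIV F] by (simp add: measurable_law_iff)
  have upd: "martingale_diff F n (fun_upd \<omega> n y) = F (st \<omega> n) (fst y) - snd y * compensator F (st \<omega> n)"
    for n \<omega> y
    unfolding martingale_diff_def by (subst (1 2) state_before_cong[of n _ \<omega>]) auto
  \<comment> \<open>\<open>(u - v)^2 \<le> 2 * u^2 + 2 * v^2\<close> gives \<open>2 * C^2\<close>
    for the jump and \<open>2 * C^2 * tot^2\<close> times the second moment \<open>2 / tot^2\<close>
    of the holding time, in total \<open>6 * C^2\<close>.\<close>
  have sq: "(\<integral>\<^sup>+\<omega>. ennreal ((martingale_diff F n \<omega>)\<^sup>2) \<partial>law) \<le> ennreal (6 * C\<^sup>2)" for n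
  proof -
    have "(\<integral>\<^sup>+\<omega>. ennreal ((martingale_diff F n \<omega>)\<^sup>2) \<partial>law) =
      (\<integral>\<^sup>+\<omega>. (\<integral>\<^sup>+y. ennreal ((martingale_diff F n (fun_upd \<omega> n y))\<^sup>2) \<partial>jump (st \<omega> n)) \<partial>law)"
    proof (rule nn_integral_network_Suc)
      show "(\<lambda>\<omega>. ennreal ((martingale_diff F n \<omega>)\<^sup>2)) \<in> borel_measurable (Pi\<^sub>M {0..<Suc n} (\<lambda>_. event_space))"
        by (intro measurable_compose[OF borel_measurable_power measurable_ennreal] measurable_martingale_diff) auto
      show "ennreal ((martingale_diff F n (restrict \<omega> {0..<Suc n}))\<^sup>2) = ennreal ((martingale_diff F n \<omega>)\<^sup>2)" for \<omega>
        by (subst martingale_diff_cong[of n _ \<omega>]) auto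
    qed
    also have "\<dots> \<le> (\<integral>\<^sup>+\<omega>. ennreal (6 * C\<^sup>2) \<partial>law)"
    proof (rule nn_integral_mono)
      fix \<omega>
      let ?x = "st \<omega> n"
      have G: "(compensator F ?x)\<^sup>2 \<le> C\<^sup>2 * (tot ?x)\<^sup>2"
        using power_mono[OF abs_compensator_le[of F C ?x, OF C], of 2] by (simp add: power_mult_distrib)
      have b: "(F ?x (fst y) - snd y * compensator F ?x)\<^sup>2 \<le> 2 * C\<^sup>2 + 2 * (C\<^sup>2 * (tot ?x)\<^sup>2) * (snd y)\<^sup>2" for y
      proof -
        have "(F ?x (fst y) - snd y * compensator F ?x)\<^sup>2 \<le>
            2 * (F ?x (fst y))\<^sup>2 + 2 * (snd y * compensator F ?x)\<^sup>2"
          using zero_le_power2[of "F ?x (fst y) + snd y * compensator F ?x"]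
          by (simp add: power2_sum power2_diff)
        moreover have "(F ?x (fst y))\<^sup>2 \<le> C\<^sup>2"
          using power_mono[OF C[of ?x "fst y"], of 2] by simp
        moreover have "(snd y * compensator F ?x)\<^sup>2 \<le> (C\<^sup>2 * (tot ?x)\<^sup>2) * (snd y)\<^sup>2"
          using mult_right_mono[OF G, of "(snd y)\<^sup>2"] by (simp add: power_mult_distrib mult_ac)
        ultimately show ?thesis by linarith
      qed
      interpret J: prob_space "jump ?x"
        using L_pos lam_pos mu_pos nu_pos p_pos p_le_1 by (intro prob_space_jump_law) auto
      note mom = jump_moments[of "F ?x" C ?x, OF C]
      have "(\<integral>\<^sup>+y. ennreal ((martingale_diff F n (fun_upd \<omega> n y))\<^sup>2) \<partial>jump ?x) \<le>
          (\<integral>\<^sup>+y. ennreal (2 * C\<^sup>2 + 2 * (C\<^sup>2 * (tot ?x)\<^sup>2) * (snd y)\<^sup>2) \<partial>jump ?x)"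
        unfolding upd using b by (intro nn_integral_mono ennreal_leI)
      also have "\<dots> = ennreal (\<integral>y. 2 * C\<^sup>2 + 2 * (C\<^sup>2 * (tot ?x)\<^sup>2) * (snd y)\<^sup>2 \<partial>jump ?x)"
        using mom(5) by (intro nn_integral_eq_integral) auto
      also have "(\<integral>y. 2 * C\<^sup>2 + 2 * (C\<^sup>2 * (tot ?x)\<^sup>2) * (snd y)\<^sup>2 \<partial>jump ?x) = 2 * C\<^sup>2 + 2 * (C\<^sup>2 * (tot ?x)\<^sup>2) * (2 / (tot ?x)\<^sup>2)"
        using mom(5,6) by (simp add: J.prob_space)
      also have "\<dots> = 6 * C\<^sup>2"
        using tot_pos[of ?x, THEN less_imp_neq] by (simp add: field_simps)
      finally show "(\<integral>\<^sup>+y. ennreal ((martingale_diff F n (fun_upd \<omega> n y))\<^sup>2) \<partial>jump ?x) \<le> ennreal (6 * C\<^sup>2)" .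
    qed
    also have "\<dots> = ennreal (6 * C\<^sup>2)"
      by (simp add: N.emeasure_space_1)
    finally show ?thesis .
  qed
  show int: "integrable law (\<lambda>\<omega>. (martingale_diff F n \<omega>)\<^sup>2)" for n
    using sq[of n] meas[of n] by (intro integrableI_bounded) (auto simp: less_top[symmetric] top_unique)
  show "N.expectation (\<lambda>\<omega>. (martingale_diff F n \<omega>)\<^sup>2) \<le> 6 * C\<^sup>2" for n
    using sq[of n] int[of n] by (simp add: nn_integral_eq_integral)
  \<comment> \<open>Given the coordinates before \<open>k\<close>, the earlier difference is a
    constant factor and the later one has mean \<open>0\<close>.\<close>
  show "N.expectation (\<lambda>\<omega>. martingale_diff F j \<omega> * martingale_diff F k \<omega>) = 0" if jk: "j < k" for j k
  proof (rule expectation_eq_0_step[of _ k])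
    show "(\<lambda>\<omega>. martingale_diff F j \<omega> * martingale_diff F k \<omega>) \<in> borel_measurable (Pi\<^sub>M {0..<Suc k} (\<lambda>_. event_space))"
      using jk by (intro borel_measurable_times measurable_martingale_diff) auto
    show "martingale_diff F j (restrict \<omega> {0..<Suc k}) * martingale_diff F k (restrict \<omega> {0..<Suc k}) =
       martingale_diff F j \<omega> * martingale_diff F k \<omega>" for \<omega>
      using jk by (subst (1 2) martingale_diff_cong[of _ _ \<omega>]) auto
    fix \<omega>
    have j: "martingale_diff F j (fun_upd \<omega> k y) = martingale_diff F j \<omega>" for y
      using jk by (intro martingale_diff_cong) auto
    note mom = jump_moments[of "F (st \<omega> k)" C "st \<omega> k", OF C]
    show "integrable (jump (st \<omega> k)) (\<lambda>y. martingale_diff F j (fun_upd \<omega> k y) * martingale_diff F k (fun_upd \<omega> k y))"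
      unfolding j upd using mom(1,3) by auto
    show "(\<integral>y. martingale_diff F j (fun_upd \<omega> k y) * martingale_diff F k (fun_upd \<omega> k y) \<partial>jump (st \<omega> k)) = 0"
      unfolding j upd using mom(1-4) by (simp add: compensator_def)
  qed
qed

lemma AE_rate_pos: "AE \<omega> in law. \<forall>n. rt (st \<omega> n) (fst (\<omega> n)) > 0 \<and> snd (\<omega> n) > 0"
  by (rule AE_step[where P = "\<lambda>x e t. rt x e > 0 \<and> t > 0"]) (use jump_moments(7)[of "\<lambda>_. 0" 0] in auto)


section \<open>From averages over jumps to averages over time\<close>

abbreviation elapsed :: "path \<Rightarrow> nat \<Rightarrow> real" where
  "elapsed \<omega> n \<equiv> (\<Sum>k<n. snd (\<omega> k))"

abbreviation time_avg :: "path \<Rightarrow> (state \<Rightarrow> real) \<Rightarrow> nat \<Rightarrow> real" where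
  "time_avg \<omega> g n \<equiv> (\<Sum>k<n. snd (\<omega> k) * g (st \<omega> k)) / elapsed \<omega> n"

abbreviation gen :: "(state \<Rightarrow> real) \<Rightarrow> state \<Rightarrow> real" where
  "gen f \<equiv> compensator (\<lambda>x e. f (step x e) - f x)"

text \<open>The strong law for \<open>F = 1\<close> compares the number \<open>n\<close> of jumps
  with the time integral of the total rate. That rate is at most \<open>R\<close> in every state, so
  eventually \<open>elapsed * R\<close> is at least \<open>n / 2\<close>. In particular the process
  does not explode.\<close>

lemma AE_elapsed_linear: "\<exists>c>0. AE \<omega> in law. \<forall>\<^sub>F n in sequentially. elapsed \<omega> n \<ge> c * real n"
proof -
  define R where "R = (lam + mu + nu) * real (card (events L)) + 1"
  have R: "R > 0"
    using lam_pos mu_pos nu_pos by (simp add: R_def add_nonneg_pos)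
  have "p * mu \<le> mu" "(1 - p) * mu \<le> mu"
    using mu_pos p_pos p_le_1 by (auto intro!: mult_left_le_one_le)
  then have "p * mu \<le> lam + mu + nu" "(1 - p) * mu \<le> lam + mu + nu"
    using lam_pos nu_pos by linarith+
  then have "rt x e \<le> lam + mu + nu" for x e
    using lam_pos mu_pos nu_pos by (cases x; cases e) auto
  then have tot: "tot x \<le> R" for x
    unfolding total_rate_def R_def using sum_bounded_above[of "events L" "rt x" "lam + mu + nu"]
    by (simp add: mult.commute add_increasing2)
  have "AE \<omega> in law. (\<lambda>n. (\<Sum>k<n. martingale_diff (\<lambda>_ _. 1) k \<omega>) / real n) \<longlonglongrightarrow> 0"
    by (rule strong_law[of _ 1]) simp
  then have "AE \<omega> in law. \<forall>\<^sub>F n in sequentially. elapsed \<omega> n \<ge> 1 / (2 * R) * real n"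
    using AE_rate_pos
  proof eventually_elim
    case (elim \<omega>)
    from elim(1) have "\<forall>\<^sub>F n in sequentially. (\<Sum>k<n. martingale_diff (\<lambda>_ _. 1) k \<omega>) / real n < 1 / 2"
      by (rule order_tendstoD) simp
    then show ?case
      using eventually_gt_at_top[of 0]
    proof eventually_elim
      case (elim n)
      have "(\<Sum>k<n. martingale_diff (\<lambda>_ _. 1) k \<omega>) = real n - (\<Sum>k<n. snd (\<omega> k) * tot (st \<omega> k))"
        by (simp add: martingale_diff_def compensator_def total_rate_def sum_subtractf)
      moreover have "(\<Sum>k<n. snd (\<omega> k) * tot (st \<omega> k)) \<le> (\<Sum>k<n. snd (\<omega> k) * R)"
        using \<open>\<forall>n. rt (st \<omega> n) (fst (\<omega> n)) > 0 \<and> snd (\<omega> n) > 0\<close> tot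
        by (intro sum_mono mult_left_mono) (auto intro: less_imp_le)
      moreover have "(\<Sum>k<n. snd (\<omega> k) * R) = elapsed \<omega> n * R"
        by (simp add: sum_distrib_right)
      moreover have "(\<Sum>k<n. martingale_diff (\<lambda>_ _. 1) k \<omega>) < real n / 2"
        using elim by (simp add: pos_divide_less_eq)
      ultimately have "real n - elapsed \<omega> n * R \<le> real n / 2"
        by linarith
      then show ?case
        using R by (simp add: field_simps)
    qed
  qed
  then show ?thesis
    using R by (intro exI[of _ "1 / (2 * R)"]) auto
qed

lemma AE_elapsed_at_top: "AE \<omega> in law. filterlim (elapsed \<omega>) at_top sequentially"
proof -
  obtain c where c: "c > 0" and "AE \<omega> in law. \<forall>\<^sub>F n in sequentially. elapsed \<omega> n \<ge> c * real n"
    using AE_elapsed_linear by blast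
  from this(2) show ?thesis
  proof eventually_elim
    case (elim \<omega>)
    have "filterlim (\<lambda>n. c * real n) at_top sequentially"
      using c by (simp add: filterlim_tendsto_pos_mult_at_top[OF tendsto_const] filterlim_real_sequentially)
    then show ?case
      using elim by (rule filterlim_at_top_mono)
  qed
qed

text \<open>The difference of the two averages is the martingale sum divided by the elapsed time; by
  the linear growth of time it is at most a constant multiple of the average over jumps.\<close>

lemma AE_compensated:
  assumes C: "\<And>x e. \<bar>F x e\<bar> \<le> C"
  shows "AE \<omega> in law. (\<lambda>n. (\<Sum>k<n. F (st \<omega> k) (fst (\<omega> k))) / elapsed \<omega> n
     - time_avg \<omega> (compensator F) n) \<longlonglongrightarrow> 0"
proof -
  obtain c where c: "c > 0" and "AE \<omega> in law. \<forall>\<^sub>F n in sequentially. elapsed \<omega> n \<ge> c * real n"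
    using AE_elapsed_linear by blast
  from this(2) strong_law[of F C, OF C] show ?thesis
  proof eventually_elim
    case (elim \<omega>)
    have "(\<lambda>n. \<bar>(\<Sum>k<n. martingale_diff F k \<omega>) / real n\<bar> / c) \<longlonglongrightarrow> 0"
      using tendsto_divide[OF tendsto_rabs[OF elim(2)] tendsto_const[of c]] c by simp
    then show ?case
    proof (rule Lim_null_comparison[rotated])
      show "\<forall>\<^sub>F n in sequentially. norm ((\<Sum>k<n. F (st \<omega> k) (fst (\<omega> k))) / elapsed \<omega> n
          - time_avg \<omega> (compensator F) n) \<le> \<bar>(\<Sum>k<n. martingale_diff F k \<omega>) / real n\<bar> / c"
        using elim(1) eventually_gt_at_top[of 0]
      proof eventually_elim
        case (elim n)
        have "(\<Sum>k<n. F (st \<omega> k) (fst (\<omega> k))) / elapsed \<omega> n - time_avg \<omega> (compensator F) n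
            = (\<Sum>k<n. martingale_diff F k \<omega>) / elapsed \<omega> n"
          by (simp add: martingale_diff_def sum_subtractf diff_divide_distrib)
        moreover have "\<bar>\<Sum>k<n. martingale_diff F k \<omega>\<bar> / elapsed \<omega> n \<le> \<bar>\<Sum>k<n. martingale_diff F k \<omega>\<bar> / (c * real n)"
          using elim c by (intro divide_left_mono mult_pos_pos) (auto intro: less_le_trans[of 0 "c * real n"])
        moreover have "elapsed \<omega> n > 0"
          using elim c by (auto intro: less_le_trans[of 0 "c * real n"])
        ultimately show ?case
          by (simp add: mult.commute)
      qed
    qed
  qed
qed

text \<open>The increments of \<open>f\<close> telescope to a bounded quantity while time tends to
  infinity, so only the generator average is left of \<open>AE_compensated\<close>. This takes the
  place of an ergodic theorem for the network.\<close>

lemma AE_time_avg_gen: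
  assumes C: "\<And>x. \<bar>f x\<bar> \<le> C"
  shows "AE \<omega> in law. time_avg \<omega> (gen f) \<longlonglongrightarrow> 0"
proof -
  have "\<bar>f (step x e) - f x\<bar> \<le> 2 * C" for x e
    using C[of x] C[of "step x e"] by linarith
  from AE_compensated[of "\<lambda>x e. f (step x e) - f x", OF this] AE_elapsed_at_top show ?thesis
  proof eventually_elim
    case (elim \<omega>)
    have tele: "(\<Sum>k<n. f (step (st \<omega> k) (fst (\<omega> k))) - f (st \<omega> k)) = f (st \<omega> n) - f s" for n
      by (induction n) auto
    have "(\<lambda>n. 2 * C / elapsed \<omega> n) \<longlonglongrightarrow> 0"
      by (rule real_tendsto_divide_at_top[OF tendsto_const elim(2)])
    then have "(\<lambda>n. (f (st \<omega> n) - f s) / elapsed \<omega> n) \<longlonglongrightarrow> 0"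
    proof (rule Lim_null_comparison[rotated])
      show "\<forall>\<^sub>F n in sequentially. norm ((f (st \<omega> n) - f s) / elapsed \<omega> n) \<le> 2 * C / elapsed \<omega> n"
        using filterlim_at_top_dense[THEN iffD1, OF elim(2), rule_format, of 0]
      proof eventually_elim
        case (elim n)
        have "\<bar>f (st \<omega> n) - f s\<bar> \<le> 2 * C"
          using C[of "st \<omega> n"] C[of s] by linarith
        with elim show ?case
          by (simp add: divide_right_mono)
      qed
    qed
    from tendsto_diff[OF this elim(1)] show ?case
      by (simp add: tele)
  qed
qed

end

subsection \<open>The torus and its independent sets\<close>

text \<open>Coordinates run from \<open>1\<close> to \<open>L\<close>, hence reduction before adding
  \<open>1\<close>: the value \<open>L\<close> is sent to \<open>1\<close>.\<close>

definition shift_right :: "nat \<Rightarrow> node \<Rightarrow> node" where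
  "shift_right L i = (fst i mod L + 1, snd i)"

definition shift_up :: "nat \<Rightarrow> node \<Rightarrow> node" where
  "shift_up L i = (fst i, snd i mod L + 1)"

text \<open>Total version of an activation: a blocked attempt changes nothing. Attempts then occur
  at the same rate in every configuration, which permits uniformisation and the comparison of two
  configurations under common attempts.\<close>

definition activate :: "nat \<Rightarrow> node \<Rightarrow> node set \<Rightarrow> node set" where
  "activate L i x = (if \<forall>j\<in>x. \<not> adj L i j then insert i x else x)"

lemma adj_sym: "adj L i j \<longleftrightarrow> adj L j i"
  unfolding adj_def cyc_adj_def by metis

locale even_torus =
  fixes L :: nat
  assumes L_ge_4: "L \<ge> 4" and L_even: "even L"
begin

abbreviation "V \<equiv> nodes L"
abbreviation "Ev \<equiv> even_nodes L"
abbreviation "Od \<equiv> odd_nodes L"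
abbreviation "\<Omega> \<equiv> indep_sets L"

text \<open>Because \<open>L\<close> is even, reduction modulo \<open>L\<close> preserves parity;
  the wrap-around edges thus also join the two parity classes, and the torus is bipartite.\<close>

lemma cong_parity: "[a = b] (mod L) \<Longrightarrow> even a \<longleftrightarrow> even b"
  using L_even by (meson cong_dvd_iff cong_dvd_modulus_nat)

lemma adj_parity: "adj L i j \<Longrightarrow> even (fst i + snd i) \<noteq> even (fst j + snd j)"
  unfolding adj_def cyc_adj_def by (auto dest!: cong_parity)

lemma adj_irrefl: "\<not> adj L i i"
  using adj_parity[of i i] by auto

lemma adj_nodes: "adj L i j \<Longrightarrow> i \<in> V \<and> j \<in> V"
  by (simp add: adj_def)

lemma mod_shift_cong: "[a mod L + 1 = a + 1] (mod L)"
  by (simp add: cong_def mod_simps)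

lemma shift_nodes: "i \<in> V \<Longrightarrow> shift_right L i \<in> V" "i \<in> V \<Longrightarrow> shift_up L i \<in> V"
  using L_ge_4 mod_less_divisor[of L] by (auto simp: shift_right_def shift_up_def nodes_def Suc_le_eq)

lemma adj_shift: "i \<in> V \<Longrightarrow> adj L i (shift_right L i)" "i \<in> V \<Longrightarrow> adj L i (shift_up L i)"
  using mod_shift_cong shift_nodes[of i]
  unfolding adj_def cyc_adj_def shift_right_def shift_up_def fst_conv snd_conv by blast+

lemma shift_right_neq_shift_up: "i \<in> V \<Longrightarrow> shift_right L i \<noteq> shift_up L i"
proof
  assume "i \<in> V" "shift_right L i = shift_up L i"
  then have "fst i mod L + 1 = fst i"
    by (simp add: shift_right_def shift_up_def prod_eq_iff)
  then have "even (fst i) \<longleftrightarrow> even (fst i + 1)"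
    using mod_shift_cong[of "fst i"] cong_parity[of "fst i" "fst i + 1"] by simp
  then show False
    by simp
qed

lemma mod_inj: "\<lbrakk>a mod L = b mod L; Suc 0 \<le> a; a \<le> L; Suc 0 \<le> b; b \<le> L\<rbrakk> \<Longrightarrow> a = b"
  by (cases "a = L"; cases "b = L") auto

lemma inj_on_shift: "inj_on (shift_right L) V" "inj_on (shift_up L) V"
  by (auto intro!: inj_onI prod_eqI dest: mod_inj
      simp: shift_right_def shift_up_def nodes_def)

lemma shift_image: "shift_right L ` V = V" "shift_up L ` V = V"
  by (rule endo_inj_surj[OF finite_nodes _ inj_on_shift(1)], use shift_nodes in blast)
    (rule endo_inj_surj[OF finite_nodes _ inj_on_shift(2)], use shift_nodes in blast)

lemma E_O: "Ev \<union> Od = V" "Ev \<inter> Od = {}" "Ev \<subseteq> V" "Od \<subseteq> V"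
  by (auto simp: even_nodes_def odd_nodes_def)

lemma even_odd_nodes: "i \<in> Ev \<Longrightarrow> i \<in> V" "i \<in> Od \<Longrightarrow> i \<in> V"
  by (simp_all add: even_nodes_def odd_nodes_def)

lemma adj_E_O: "adj L i j \<Longrightarrow> i \<in> Ev \<longleftrightarrow> j \<in> Od"
  using adj_parity[of i j] adj_nodes[of i j] by (auto simp: even_nodes_def odd_nodes_def)

lemma finite_E_O [simp]: "finite Ev" "finite Od" "finite V"
  using E_O(3,4) finite_nodes[of L] by (blast intro: finite_subset)+

lemma E_indep: "Ev \<in> \<Omega>" and O_indep: "Od \<in> \<Omega>"
  using E_O adj_E_O unfolding indep_sets_def by blast+

lemma finite_indep_sets [simp]: "finite \<Omega>"
  by (rule finite_subset[of _ "Pow V"]) (auto simp: indep_sets_def)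

lemma indep_finite: "x \<in> \<Omega> \<Longrightarrow> finite x"
  by (auto simp: indep_sets_def intro: finite_subset[of _ V])

lemma shift_E_O:
  assumes "i \<in> V"
  shows "shift_right L i \<in> Od \<longleftrightarrow> i \<in> Ev" "shift_up L i \<in> Od \<longleftrightarrow> i \<in> Ev"
    and "shift_right L i \<in> Ev \<longleftrightarrow> i \<in> Od" "shift_up L i \<in> Ev \<longleftrightarrow> i \<in> Od"
proof -
  show 1: "shift_right L i \<in> Od \<longleftrightarrow> i \<in> Ev" and 2: "shift_up L i \<in> Od \<longleftrightarrow> i \<in> Ev"
    using adj_E_O[OF adj_shift(1)[OF assms]] adj_E_O[OF adj_shift(2)[OF assms]] by auto
  show "shift_right L i \<in> Ev \<longleftrightarrow> i \<in> Od" "shift_up L i \<in> Ev \<longleftrightarrow> i \<in> Od"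
    using 1 2 shift_nodes[OF assms] assms E_O(1,2) by blast+
qed

lemma shift_right_E: "shift_right L ` Ev = Od" and shift_right_O: "shift_right L ` Od = Ev"
proof -
  have img: "B \<subseteq> shift_right L ` A"
    if "B \<subseteq> V" "\<And>i. i \<in> V \<Longrightarrow> shift_right L i \<in> B \<Longrightarrow> i \<in> A" for A B
  proof
    fix j assume j: "j \<in> B"
    then have "j \<in> shift_right L ` V"
      unfolding shift_image(1) by (rule subsetD[OF that(1)])
    then obtain i where "i \<in> V" "j = shift_right L i"
      by (rule imageE)
    with j that(2)[of i] show "j \<in> shift_right L ` A"
      by simp
  qed
  show "shift_right L ` Ev = Od"
  proof
    show "shift_right L ` Ev \<subseteq> Od"
      by (rule image_subsetI) (metis shift_E_O(1) even_odd_nodes(1))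
    show "Od \<subseteq> shift_right L ` Ev"
      by (rule img[OF E_O(4)]) (simp only: shift_E_O(1))
  qed
  show "shift_right L ` Od = Ev"
  proof
    show "shift_right L ` Od \<subseteq> Ev"
      by (rule image_subsetI) (metis shift_E_O(3) even_odd_nodes(2))
    show "Ev \<subseteq> shift_right L ` Od"
      by (rule img[OF E_O(3)]) (simp only: shift_E_O(3))
  qed
qed

lemma card_E_O: "card Ev = card Od" "2 * card Od = L\<^sup>2" "card V = L\<^sup>2"
proof -
  show *: "card Ev = card Od"
    using card_image[of "shift_right L" Ev] inj_on_shift E_O shift_right_E
    by (metis inj_on_subset)
  show "card V = L\<^sup>2"
    by (simp add: nodes_def power2_eq_square)
  moreover have "card V = card Ev + card Od"
    using E_O by (metis card_Un_disjoint finite_E_O(1,2))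
  ultimately show "2 * card Od = L\<^sup>2"
    using * by simp
qed

text \<open>A bijection moving every node to a neighbour sends an independent set to a disjoint set
  of the same size. Two copies therefore fit into the grid, and if they fill it, membership
  alternates along the bijection.\<close>

lemma indep_disjoint_image:
  assumes "x \<in> \<Omega>" "\<And>i. i \<in> V \<Longrightarrow> adj L i (f i)" "inj_on f V" "f ` V = V"
  shows "card x + card x \<le> L\<^sup>2"
    and "card x + card x = L\<^sup>2 \<Longrightarrow> i \<in> V \<Longrightarrow> f i \<in> x \<longleftrightarrow> i \<notin> x"
proof -
  have x: "x \<subseteq> V" using assms by (auto simp: indep_sets_def)
  have "card (f ` x) = card x"
    using assms(3) x by (meson card_image inj_on_subset)
  moreover have dis: "x \<inter> f ` x = {}"
    using assms(1,2) x unfolding indep_sets_def by blast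
  ultimately have card: "card (x \<union> f ` x) = card x + card x"
    using assms(1) by (subst card_Un_disjoint) (auto dest: indep_finite)
  have sub: "x \<union> f ` x \<subseteq> V"
    using x assms(4) by auto
  then show "card x + card x \<le> L\<^sup>2"
    using card card_mono[OF _ sub] card_E_O by simp
  assume "card x + card x = L\<^sup>2" and i: "i \<in> V"
  then have "x \<union> f ` x = V"
    using sub card card_E_O by (intro card_subset_eq) auto
  moreover have "f i \<in> f ` x \<longleftrightarrow> i \<in> x"
    using assms(3) x i by (meson inj_on_image_mem_iff)
  ultimately show "f i \<in> x \<longleftrightarrow> i \<notin> x"
    using dis i assms(4) by blast
qed

lemma indep_card_le: "x \<in> \<Omega> \<Longrightarrow> card x \<le> card Od"
  using indep_disjoint_image(1)[of x "shift_right L"] adj_shift(1) inj_on_shift(1) shift_image(1) card_E_O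
  by simp

text \<open>At maximal size membership alternates under both shifts, so it is determined by the
  membership of \<open>(1, 1)\<close> and the parity of the coordinate sum.\<close>

lemma indep_card_max:
  assumes x: "x \<in> \<Omega>" and "card x = card Od"
  shows "x = Ev \<or> x = Od"
proof -
  have card: "card x + card x = L\<^sup>2"
    using assms card_E_O by simp
  have r: "shift_right L i \<in> x \<longleftrightarrow> i \<notin> x" and u: "shift_up L i \<in> x \<longleftrightarrow> i \<notin> x" if "i \<in> V" for i
    using indep_disjoint_image(2)[OF x _ _ _ card that] adj_shift inj_on_shift shift_image by auto
  have 1: "(Suc a, 1) \<in> x \<longleftrightarrow> ((1, 1) \<in> x \<longleftrightarrow> even a)" if "a < L" for a
    using that
  proof (induction a)
    case (Suc a)
    then show ?case
      using r[of "(Suc a, 1)"] by (simp add: shift_right_def nodes_def)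
  qed simp
  have 2: "(Suc a, Suc b) \<in> x \<longleftrightarrow> ((1, 1) \<in> x \<longleftrightarrow> even (a + b))" if "a < L" "b < L" for a b
    using that
  proof (induction b)
    case 0 then show ?case using 1[of a] by simp
  next
    case (Suc b)
    then show ?case
      using u[of "(Suc a, Suc b)"] by (simp add: shift_up_def nodes_def)
  qed
  have 3: "i \<in> x \<longleftrightarrow> ((1, 1) \<in> x \<longleftrightarrow> even (fst i + snd i))" if "i \<in> V" for i
  proof -
    have "i = (Suc (fst i - 1), Suc (snd i - 1))" "fst i - 1 < L" "snd i - 1 < L"
      using that by (auto simp: nodes_def)
    then obtain a b where "i = (Suc a, Suc b)" "a < L" "b < L"
      by blast
    then show ?thesis
      using 2[of a b] by simp
  qed
  have "x \<subseteq> V"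
    using x by (auto simp: indep_sets_def)
  show ?thesis
  proof (cases "(1, 1) \<in> x")
    case True
    then have "x = Ev"
      using 3 \<open>x \<subseteq> V\<close> unfolding even_nodes_def by blast
    then show ?thesis ..
  next
    case False
    then have "x = Od"
      using 3 \<open>x \<subseteq> V\<close> unfolding odd_nodes_def by blast
    then show ?thesis ..
  qed
qed

lemma activate_indep:
  assumes "x \<in> \<Omega>" "i \<in> V"
  shows "activate L i x \<in> \<Omega>"
proof (cases "\<forall>j\<in>x. \<not> adj L i j")
  case True
  then have "\<forall>j\<in>x. \<not> adj L j i"
    by (simp add: adj_sym[of L _ i])
  with True show ?thesis
    using assms adj_irrefl by (simp add: activate_def indep_sets_def)
qed (use assms in \<open>auto simp: activate_def\<close>)

lemma deactivate_indep: "x \<in> \<Omega> \<Longrightarrow> x - {i} \<in> \<Omega>"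
  by (auto simp: indep_sets_def)

lemma activate_maximal:
  assumes "A = Ev \<or> A = Od" "i \<in> V"
  shows "activate L i A = A"
proof (cases "i \<in> A")
  case False
  then have "shift_right L i \<in> A"
    using assms shift_E_O[of i] E_O(1) by blast
  then show ?thesis
    using adj_shift(1)[of i] assms by (auto simp: activate_def)
qed (auto simp: activate_def)

text \<open>A node outside \<open>A\<close> has two distinct active neighbours in \<open>A\<close>,
  to its right and above it. Removing \<open>j\<close> leaves at least one of them, so only
  \<open>j\<close> itself can become active.\<close>

lemma activate_maximal_minus:
  assumes "A = Ev \<or> A = Od" "i \<in> V" "j \<in> A" "i \<noteq> j"
  shows "activate L i (A - {j}) = A - {j}"
proof (cases "i \<in> A")
  case False
  then have "shift_right L i \<in> A" "shift_up L i \<in> A"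
    using assms shift_E_O[of i] E_O(1) by blast+
  moreover have "shift_right L i \<noteq> j \<or> shift_up L i \<noteq> j"
    using shift_right_neq_shift_up assms by metis
  ultimately show ?thesis
    using adj_shift[of i] assms by (auto simp: activate_def)
qed (use assms in \<open>auto simp: activate_def\<close>)

section \<open>Translation symmetry of the torus\<close>

lemma cyc_adj_shift:
  "cyc_adj L (a mod L + 1) (b mod L + 1) \<longleftrightarrow> cyc_adj L a b"
proof -
  have *: "[a mod L + 1 = (b mod L + 1) + 1] (mod L) \<longleftrightarrow> [a = b + 1] (mod L)" for a b
  proof -
    have "[a mod L + 1 = (b mod L + 1) + 1] (mod L) \<longleftrightarrow> [a + 1 = (b + 1) + 1] (mod L)"
      by (simp add: cong_def mod_simps)
    then show ?thesis
      by (metis cong_add_rcancel_nat)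
  qed
  show ?thesis
    unfolding cyc_adj_def * ..
qed

lemma adj_shift_shift:
  assumes "i \<in> V" "j \<in> V"
  shows "adj L (shift_right L i) (shift_right L j) \<longleftrightarrow> adj L i j"
proof -
  have "fst i mod L + 1 = fst j mod L + 1 \<longleftrightarrow> fst i = fst j"
    using mod_inj[of "fst i" "fst j"] assms by (auto simp: nodes_def)
  then show ?thesis
    using shift_nodes(1)[OF assms(1)] shift_nodes(1)[OF assms(2)] assms
    unfolding adj_def shift_right_def fst_conv snd_conv cyc_adj_shift by metis
qed

lemma shift_activate:
  assumes "x \<in> \<Omega>" "i \<in> V"
  shows "shift_right L ` activate L i x = activate L (shift_right L i) (shift_right L ` x)"
proof -
  have "j \<in> V" if "j \<in> x" for j
    using assms(1) that unfolding indep_sets_def by blast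
  then have "adj L (shift_right L i) (shift_right L j) \<longleftrightarrow> adj L i j" if "j \<in> x" for j
    using that by (intro adj_shift_shift assms(2))
  then have "(\<forall>j\<in>shift_right L ` x. \<not> adj L (shift_right L i) j) \<longleftrightarrow> (\<forall>j\<in>x. \<not> adj L i j)"
    unfolding Set.ball_simps(9) by (intro ball_cong refl) (simp only:)
  then show ?thesis
    by (simp only: activate_def if_distrib[of "image _"] image_insert)
qed

lemma shift_deactivate:
  assumes "x \<in> \<Omega>" "i \<in> V"
  shows "shift_right L ` (x - {i}) = shift_right L ` x - {shift_right L i}"
proof -
  have "x \<subseteq> V"
    using assms(1) unfolding indep_sets_def by blast
  then show ?thesis
    using inj_on_image_set_diff[OF inj_on_shift(1), of x "{i}"] assms(2) by (simp add: Diff_subset[THEN subset_trans])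
qed

end

subsection \<open>Expected hitting times of the activity process\<close>

text \<open>The activity process without its queues: \<open>a\<close> is the deactivation rate
  \<open>p * mu\<close> and \<open>b\<close> the activation rate \<open>nu\<close>, so
  \<open>b / a\<close> is \<open>sigma\<close>. Hitting times are treated here as solutions of
  linear equations; the link with paths is made later.\<close>

locale hard_core = even_torus +
  fixes a b :: real
  assumes a_pos: "a > 0" and b_pos: "b > 0"
begin

text \<open>All nodes attempt both moves; impossible attempts fix \<open>x\<close> and contribute
  \<open>0\<close>.\<close>

definition hgen :: "(node set \<Rightarrow> real) \<Rightarrow> node set \<Rightarrow> real" where
  "hgen g x = (\<Sum>i\<in>V. a * (g (x - {i}) - g x) + b * (g (activate L i x) - g x))"

definition weight :: "node set \<Rightarrow> real" where
  "weight x = (b / a) ^ card x"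

definition Z :: real where
  "Z = (\<Sum>x\<in>\<Omega>. weight x)"

lemma weight_pos: "weight x > 0"
  using a_pos b_pos by (simp add: weight_def)

text \<open>Detailed balance, node by node: \<open>insert i\<close> matches the configurations in
  which \<open>i\<close> is free to start with those in which it is active, and
  \<open>weight (insert i x) * a = weight x * b\<close> cancels the two flows of each pair.\<close>

lemma stationary_weight: "(\<Sum>x\<in>\<Omega>. weight x * hgen g x) = 0"
proof -
  have zero: "(\<Sum>x\<in>\<Omega>. weight x * (a * (g (x - {i}) - g x) + b * (g (activate L i x) - g x))) = 0"
    if i: "i \<in> V" for i
  proof -
    define P where "P = {x \<in> \<Omega>. i \<in> x}"
    define F where "F = {x \<in> \<Omega>. i \<notin> x \<and> (\<forall>j\<in>x. \<not> adj L i j)}"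
    have fin: "finite P" "finite F"
      by (simp_all add: P_def F_def)
    have bij: "bij_betw (insert i) F P"
    proof (rule bij_betw_byWitness[where f' = "\<lambda>x. x - {i}"])
      show "insert i ` F \<subseteq> P"
      proof (rule image_subsetI)
        fix x assume x: "x \<in> F"
        then have "activate L i x = insert i x"
          by (simp add: F_def activate_def)
        then show "insert i x \<in> P"
          using x activate_indep[of x i] i by (simp add: F_def P_def)
      qed
      show "(\<lambda>x. x - {i}) ` P \<subseteq> F"
        by (rule image_subsetI) (auto simp: F_def P_def indep_sets_def)
    qed (auto simp: F_def P_def)
    have "(\<Sum>x\<in>\<Omega>. weight x * (a * (g (x - {i}) - g x))) = (\<Sum>x\<in>P. weight x * (a * (g (x - {i}) - g x)))"
      by (rule sum.mono_neutral_right) (auto simp: P_def)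
    also have "\<dots> = (\<Sum>x\<in>F. weight (insert i x) * (a * (g (insert i x - {i}) - g (insert i x))))"
      by (rule sum.reindex_bij_betw[OF bij, symmetric])
    also have "\<dots> = (\<Sum>x\<in>F. - (weight x * (b * (g (activate L i x) - g x))))"
    proof (rule sum.cong[OF refl])
      fix x assume x: "x \<in> F"
      then have "finite x"
        by (auto simp: F_def intro: indep_finite)
      then have "weight (insert i x) * a = weight x * b"
        using x a_pos by (simp add: F_def weight_def)
      then have w: "weight (insert i x) * (a * c) = weight x * (b * c)" for c
        by (metis mult.assoc)
      have "insert i x - {i} = x" "activate L i x = insert i x"
        using x by (auto simp: F_def activate_def)
      then show "weight (insert i x) * (a * (g (insert i x - {i}) - g (insert i x))) =
          - (weight x * (b * (g (activate L i x) - g x)))"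
        unfolding w by (simp add: algebra_simps)
    qed
    also have "\<dots> = - (\<Sum>x\<in>F. weight x * (b * (g (activate L i x) - g x)))"
      by (rule sum_negf)
    also have "(\<Sum>x\<in>F. weight x * (b * (g (activate L i x) - g x))) =
        (\<Sum>x\<in>\<Omega>. weight x * (b * (g (activate L i x) - g x)))"
      by (rule sum.mono_neutral_left) (auto simp: F_def activate_def insert_absorb)
    finally show ?thesis
      by (simp add: distrib_left sum.distrib)
  qed
  have "(\<Sum>x\<in>\<Omega>. weight x * hgen g x) =
      (\<Sum>i\<in>V. \<Sum>x\<in>\<Omega>. weight x * (a * (g (x - {i}) - g x) + b * (g (activate L i x) - g x)))"
    unfolding hgen_def sum_distrib_left by (rule sum.swap)
  then show ?thesis
    by (simp add: zero)
qed

section \<open>Expected hitting times as monotone limits\<close>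

definition unif :: real where
  "unif = (a + b) * real (card V)"

lemma card_V_pos: "card V > 0"
  using card_E_O(3) L_ge_4 by simp

lemma unif_pos: "unif > 0"
  using a_pos b_pos card_V_pos by (simp add: unif_def)

text \<open>Uniformisation: all configurations are given the same total rate, so that the generator
  becomes a difference of a nonnegative averaging operator and the identity.\<close>

primrec hit_iter :: "node set \<Rightarrow> nat \<Rightarrow> node set \<Rightarrow> real" where
  "hit_iter A 0 x = 0"
| "hit_iter A (Suc n) x = (if x = A then 0
     else (1 + (\<Sum>i\<in>V. a * hit_iter A n (x - {i}) + b * hit_iter A n (activate L i x))) / unif)"

text \<open>\<open>hit_iter A n\<close> is the expected hitting time when at most \<open>n\<close>
  ticks of the uniformised clock, of mean length \<open>1 / unif\<close>, are counted. The value
  \<open>0\<close> off the independent sets lets bounds be stated for arbitrary sets.\<close>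

definition hit :: "node set \<Rightarrow> node set \<Rightarrow> real" where
  "hit A x = (if x \<in> \<Omega> then SUP n. hit_iter A n x else 0)"

lemma hit_iter_nonneg: "hit_iter A n x \<ge> 0"
  using a_pos b_pos unif_pos
  by (induction n arbitrary: x) (auto intro!: divide_nonneg_pos add_nonneg_nonneg sum_nonneg mult_nonneg_nonneg)

lemma hit_iter_mono: "hit_iter A n x \<le> hit_iter A (Suc n) x"
proof (induction n arbitrary: x)
  case 0
  then show ?case using hit_iter_nonneg[of A 1 x] by simp
next
  case (Suc n)
  then show ?case
    using a_pos b_pos unif_pos
    unfolding hit_iter.simps(2)[of A "Suc n"] hit_iter.simps(2)[of A n]
    by (auto intro!: divide_right_mono add_left_mono sum_mono add_mono mult_left_mono simp del: hit_iter.simps)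
qed

text \<open>A Lyapunov function \<open>f (rank x)\<close> dominates all iterates, with
  \<open>rank\<close> the size of the symmetric difference with \<open>A\<close>. The increments of
  \<open>f\<close> decay geometrically in the rank, so that the single move towards \<open>A\<close>
  that always exists outweighs all the moves away from it.\<close>

lemma hit_iter_bounded:
  assumes A: "A \<in> \<Omega>"
  shows "\<exists>C. \<forall>n. \<forall>x\<in>\<Omega>. hit_iter A n x \<le> C"
proof -
  define m where "m = 2 * card V"
  define r where "r = min a b"
  \<comment> \<open>The moves away cost at most \<open>unif * C * q^k\<close>, which for this
    \<open>q\<close> is half of the gain \<open>r * C * q^(k-1)\<close> of the good move. The
    remaining half is at least \<open>r / 2 * C * q^m\<close>, and \<open>C\<close> normalises this
    to \<open>1\<close>.\<close>
  define q where "q = r / (2 * unif)"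
  define C where "C = 2 / (r * q ^ m)"
  define f where "f k = C * (\<Sum>j<k. q ^ j)" for k
  define rank where "rank x = card (x - A) + card (A - x)" for x
  have r: "r > 0" "r \<le> a" "r \<le> b"
    using a_pos b_pos by (auto simp: r_def)
  have q: "q > 0" "q \<le> 1" "q * unif = r / 2"
  proof -
    show "q > 0" "q * unif = r / 2"
      using r unif_pos by (auto simp: q_def)
    have "unif \<ge> a + b"
      using mult_left_mono[of 1 "real (card V)" "a + b"] card_V_pos a_pos b_pos
      by (simp add: unif_def)
    then show "q \<le> 1"
      using r a_pos b_pos unif_pos by (simp add: q_def divide_simps)
  qed
  have C: "C > 0" using r q by (simp add: C_def)
  have f_mono: "f k \<le> f l" if "k \<le> l" for k l
    unfolding f_def using C q that by (intro mult_left_mono sum_mono2) auto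
  have f_step: "f l \<le> f k + C * q ^ k" if "l \<le> Suc k" for k l
    using f_mono[OF that] by (simp add: f_def distrib_left)
  have finA: "finite A" using A by (rule indep_finite)
  have rank_le: "rank x \<le> m" if "x \<in> \<Omega>" for x
  proof -
    have "x - A \<subseteq> V" "A - x \<subseteq> V"
      using that A by (auto simp: indep_sets_def)
    then have "card (x - A) \<le> card V" "card (A - x) \<le> card V"
      by (auto intro: card_mono)
    then show ?thesis
      by (simp add: rank_def m_def)
  qed
  have rank_D: "rank (x - {i}) \<le> Suc (rank x)" if "x \<in> \<Omega>" for x i
  proof -
    have "card (x - {i} - A) \<le> card (x - A)"
      using indep_finite[OF that] by (intro card_mono) auto
    moreover have "card (A - (x - {i})) \<le> card (insert i (A - x))"
      using finA by (intro card_mono) auto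
    moreover have "card (insert i (A - x)) \<le> Suc (card (A - x))"
      by (rule card_insert_le_m1) auto
    ultimately show ?thesis by (simp add: rank_def)
  qed
  have rank_A: "rank (activate L i x) \<le> Suc (rank x)" if "x \<in> \<Omega>" for x i
  proof -
    have "card (insert i x - A) \<le> card (insert i (x - A))"
      using indep_finite[OF that] by (intro card_mono) auto
    moreover have "card (A - insert i x) \<le> card (A - x)"
      using finA by (intro card_mono) auto
    moreover have "card (insert i (x - A)) \<le> Suc (card (x - A))"
      by (rule card_insert_le_m1) auto
    ultimately show ?thesis by (auto simp: rank_def activate_def)
  qed
  have super: "1 + (\<Sum>i\<in>V. a * f (rank (x - {i})) + b * f (rank (activate L i x))) \<le> unif * f (rank x)"
    if x: "x \<in> \<Omega>" "x \<noteq> A" for x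
  proof -
    define k where "k = rank x"
    define t where "t i = a * f (rank (x - {i})) + b * f (rank (activate L i x))" for i
    have up: "t i \<le> (a + b) * f k + (a + b) * (C * q ^ k)" for i
    proof -
      have "a * f (rank (x - {i})) \<le> a * (f k + C * q ^ k)"
        using a_pos rank_D[OF x(1)] by (intro mult_left_mono f_step) (auto simp: k_def)
      moreover have "b * f (rank (activate L i x)) \<le> b * (f k + C * q ^ k)"
        using b_pos rank_A[OF x(1)] by (intro mult_left_mono f_step) (auto simp: k_def)
      ultimately show ?thesis by (simp add: t_def algebra_simps)
    qed
    \<comment> \<open>The good move: deactivate a node outside \<open>A\<close> if there is one;
      otherwise \<open>x\<close> is a proper subset of the independent set \<open>A\<close>, and a
      missing node of \<open>A\<close> can be activated.\<close>
    have "\<exists>i\<in>V. k \<ge> 1 \<and> t i \<le> (a + b) * f k + (a + b) * (C * q ^ k) - r * (C * q ^ (k - 1))"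
    proof (cases "x \<subseteq> A")
      case False
      then obtain i where i: "i \<in> x" "i \<notin> A" by blast
      have "x - {i} - A = (x - A) - {i}" "A - (x - {i}) = A - x"
        using i by auto
      then have "rank (x - {i}) + 1 = k"
        using i indep_finite[OF x(1)] card_Suc_Diff1[of "x - A" i] by (simp add: rank_def k_def)
      then have k: "k \<ge> 1" "rank (x - {i}) = k - 1" by auto
      then have "f k = f (rank (x - {i})) + C * q ^ (k - 1)"
        by (cases k) (auto simp: f_def distrib_left)
      then have "a * f (rank (x - {i})) = a * f k - a * (C * q ^ (k - 1))"
        by (simp add: algebra_simps)
      moreover have "a * (C * q ^ (k - 1)) \<ge> r * (C * q ^ (k - 1))"
        using r C q by (intro mult_right_mono) auto
      moreover have "b * f (rank (activate L i x)) \<le> b * (f k + C * q ^ k)"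
        using b_pos rank_A[OF x(1)] by (intro mult_left_mono f_step) (auto simp: k_def)
      moreover have "0 \<le> a * (C * q ^ k)"
        using a_pos C q by simp
      ultimately have "t i \<le> (a + b) * f k + (a + b) * (C * q ^ k) - r * (C * q ^ (k - 1))"
        by (simp add: t_def algebra_simps)
      moreover have "i \<in> V" using i x by (auto simp: indep_sets_def)
      ultimately show ?thesis using k by blast
    next
      case True
      then obtain i where i: "i \<in> A" "i \<notin> x" using x by blast
      have "\<forall>j\<in>x. \<not> adj L i j"
        using True A i unfolding indep_sets_def by blast
      then have act: "activate L i x = insert i x"
        by (simp add: activate_def)
      have "insert i x - A = x - A" "A - insert i x = (A - x) - {i}"
        using i by auto
      then have "rank (activate L i x) + 1 = k"
        using i finA card_Suc_Diff1[of "A - x" i] by (simp add: rank_def k_def act)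
      then have k: "k \<ge> 1" "rank (activate L i x) = k - 1" by auto
      then have "f k = f (rank (activate L i x)) + C * q ^ (k - 1)"
        by (cases k) (auto simp: f_def distrib_left)
      then have "b * f (rank (activate L i x)) = b * f k - b * (C * q ^ (k - 1))"
        by (simp add: algebra_simps)
      moreover have "b * (C * q ^ (k - 1)) \<ge> r * (C * q ^ (k - 1))"
        using r C q by (intro mult_right_mono) auto
      moreover have "a * f (rank (x - {i})) \<le> a * (f k + C * q ^ k)"
        using a_pos rank_D[OF x(1)] by (intro mult_left_mono f_step) (auto simp: k_def)
      moreover have "0 \<le> b * (C * q ^ k)"
        using b_pos C q by simp
      ultimately have "t i \<le> (a + b) * f k + (a + b) * (C * q ^ k) - r * (C * q ^ (k - 1))"
        by (simp add: t_def algebra_simps)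
      moreover have "i \<in> V" using i A by (auto simp: indep_sets_def)
      ultimately show ?thesis using k by blast
    qed
    then obtain i where i: "i \<in> V" "k \<ge> 1"
      and ti: "t i \<le> (a + b) * f k + (a + b) * (C * q ^ k) - r * (C * q ^ (k - 1))"
      by blast
    have "(\<Sum>i\<in>V. t i) = t i + (\<Sum>j\<in>V - {i}. t j)"
      using i by (intro sum.remove) auto
    also have "\<dots> \<le> ((a + b) * f k + (a + b) * (C * q ^ k) - r * (C * q ^ (k - 1))) +
        (\<Sum>j\<in>V - {i}. (a + b) * f k + (a + b) * (C * q ^ k))"
      by (intro add_mono ti sum_mono up)
    also have "\<dots> = (\<Sum>j\<in>V. (a + b) * f k + (a + b) * (C * q ^ k)) - r * (C * q ^ (k - 1))"
      using sum.remove[OF finite_E_O(3) i(1), of "\<lambda>_. (a + b) * f k + (a + b) * (C * q ^ k)"] by linarith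
    also have "\<dots> = unif * f k + unif * q ^ k * C - r * (C * q ^ (k - 1))"
      by (simp add: unif_def algebra_simps)
    also have "unif * q ^ k = r / 2 * q ^ (k - 1)"
      using q(3) i(2) by (cases k) (auto simp: mult_ac)
    finally have "(\<Sum>i\<in>V. t i) \<le> unif * f k - r / 2 * (C * q ^ (k - 1))"
      by (simp add: algebra_simps)
    moreover have "q ^ m \<le> q ^ (k - 1)"
      using q rank_le[OF x(1)] by (intro power_decreasing) (auto simp: k_def)
    then have "r / 2 * (C * q ^ (k - 1)) \<ge> r / 2 * (C * q ^ m)"
      using r C by (intro mult_left_mono) auto
    moreover have "r / 2 * (C * q ^ m) = 1"
      using r q by (simp add: C_def)
    ultimately show ?thesis
      unfolding t_def k_def by linarith
  qed
  have "hit_iter A n x \<le> f (rank x)" if "x \<in> \<Omega>" for n x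
    using that
  proof (induction n arbitrary: x)
    case 0
    then show ?case using C q by (auto simp: f_def intro!: mult_nonneg_nonneg sum_nonneg)
  next
    case (Suc n)
    show ?case
    proof (cases "x = A")
      case True
      then show ?thesis using C q by (auto simp: f_def intro!: mult_nonneg_nonneg sum_nonneg)
    next
      case False
      have "1 + (\<Sum>i\<in>V. a * hit_iter A n (x - {i}) + b * hit_iter A n (activate L i x)) \<le>
          1 + (\<Sum>i\<in>V. a * f (rank (x - {i})) + b * f (rank (activate L i x)))"
        using a_pos b_pos Suc deactivate_indep activate_indep
        by (intro add_left_mono sum_mono add_mono mult_left_mono) auto
      also have "\<dots> \<le> unif * f (rank x)"
        using super[OF Suc.prems False] .
      finally show ?thesis
        using False unif_pos by (simp add: divide_le_eq mult.commute)
    qed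
  qed
  then have "hit_iter A n x \<le> f m" if "x \<in> \<Omega>" for n x
    using f_mono[OF rank_le[OF that]] that order.trans by blast
  then show ?thesis by blast
qed

lemma hit_iter_tendsto:
  assumes "A \<in> \<Omega>" "x \<in> \<Omega>"
  shows "(\<lambda>n. hit_iter A n x) \<longlonglongrightarrow> hit A x"
proof -
  obtain C where "\<forall>n. \<forall>x\<in>\<Omega>. hit_iter A n x \<le> C"
    using hit_iter_bounded[OF assms(1)] by blast
  then have "(\<lambda>n. hit_iter A n x) \<longlonglongrightarrow> (SUP n. hit_iter A n x)"
    using assms(2) by (intro LIMSEQ_incseq_SUP incseq_SucI hit_iter_mono bdd_aboveI2[of _ _ C]) blast
  then show ?thesis
    using assms(2) by (simp add: hit_def)
qed

lemma hit_nonneg: "A \<in> \<Omega> \<Longrightarrow> hit A x \<ge> 0"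
  using LIMSEQ_le_const[OF hit_iter_tendsto[of A x], of 0] hit_iter_nonneg
  by (cases "x \<in> \<Omega>") (auto simp: hit_def)

lemma hit_self: "A \<in> \<Omega> \<Longrightarrow> hit A A = 0"
proof -
  assume "A \<in> \<Omega>"
  have "hit_iter A n A = 0" for n by (cases n) auto
  with \<open>A \<in> \<Omega>\<close> show "hit A A = 0"
    by (simp add: hit_def)
qed

lemma hgen_eq: "hgen g x = (\<Sum>i\<in>V. a * g (x - {i}) + b * g (activate L i x)) - unif * g x"
proof -
  have "(\<Sum>i\<in>V. a * g (x - {i}) + b * g (activate L i x)) =
      (\<Sum>i\<in>V. (a * (g (x - {i}) - g x) + b * (g (activate L i x) - g x)) + (a + b) * g x)"
    by (rule sum.cong) (auto simp: algebra_simps)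
  also have "\<dots> = hgen g x + unif * g x"
    unfolding sum.distrib[of _ "\<lambda>_. (a + b) * g x"] by (simp add: hgen_def unif_def)
  finally show ?thesis by simp
qed

lemma hgen_hit:
  assumes A: "A \<in> \<Omega>" and x: "x \<in> \<Omega>" "x \<noteq> A"
  shows "hgen (hit A) x = -1"
proof -
  have "(\<lambda>n. hit_iter A (Suc n) x) \<longlonglongrightarrow> hit A x"
    using hit_iter_tendsto[OF A x(1)] by (rule LIMSEQ_Suc)
  moreover have "(\<lambda>n. hit_iter A (Suc n) x) \<longlonglongrightarrow>
      (1 + (\<Sum>i\<in>V. a * hit A (x - {i}) + b * hit A (activate L i x))) / unif"
    using x unif_pos A
    by (auto intro!: tendsto_intros hit_iter_tendsto deactivate_indep activate_indep)
  ultimately have "hit A x = (1 + (\<Sum>i\<in>V. a * hit A (x - {i}) + b * hit A (activate L i x))) / unif"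
    by (rule LIMSEQ_unique)
  then show ?thesis
    using unif_pos unfolding hgen_eq by (simp add: field_simps)
qed

text \<open>Kac's formula in generator form: the stationary sum of \<open>hgen (hit A)\<close>
  vanishes, and every state other than \<open>A\<close> contributes minus its weight.\<close>

lemma hgen_hit_self:
  assumes A: "A \<in> \<Omega>"
  shows "hgen (hit A) A = Z / weight A - 1"
proof -
  have "0 = weight A * hgen (hit A) A + (\<Sum>x\<in>\<Omega> - {A}. weight x * hgen (hit A) x)"
    using stationary_weight[of "hit A"] A by (simp add: sum.remove)
  also have "(\<Sum>x\<in>\<Omega> - {A}. weight x * hgen (hit A) x) = (\<Sum>x\<in>\<Omega> - {A}. - weight x)"
    using hgen_hit[OF A] by (intro sum.cong) auto
  also have "\<dots> = - (Z - weight A)"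
    using A by (simp add: Z_def sum_negf sum_diff1)
  finally show ?thesis
    using weight_pos[of A] by (simp add: field_simps)
qed

text \<open>At \<open>A\<close> the generator is a sum of nonnegative terms, as
  \<open>hit A A = 0\<close>, so each of them is bounded by the whole. This limits what is lost when
  a packet is completed in state \<open>A\<close>.\<close>

lemma hit_neighbour_le:
  assumes A: "A \<in> \<Omega>" and i: "i \<in> V"
  shows "a * hit A (A - {i}) \<le> Z / weight A - 1"
proof -
  have "a * hit A (A - {i}) \<le> a * hit A (A - {i}) + b * hit A (activate L i A)"
    using b_pos hit_nonneg[OF A] by simp
  also have "\<dots> \<le> (\<Sum>i\<in>V. a * hit A (A - {i}) + b * hit A (activate L i A))"
    using a_pos b_pos hit_nonneg[OF A] i
    by (intro member_le_sum[of i V "\<lambda>i. a * hit A (A - {i}) + b * hit A (activate L i A)"]) auto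
  also have "\<dots> = hgen (hit A) A"
    by (simp add: hgen_eq hit_self[OF A])
  finally show ?thesis
    by (simp add: hgen_hit_self[OF A])
qed

section \<open>Attractiveness and symmetry of the hitting times\<close>

definition opposite :: "node set \<Rightarrow> node set \<Rightarrow> bool" where
  "opposite A B \<longleftrightarrow> A = Ev \<and> B = Od \<or> A = Od \<and> B = Ev"

lemma opposite_facts:
  assumes "opposite A B"
  shows "A \<in> \<Omega>" "B \<in> \<Omega>" "A \<inter> B = {}" "A \<union> B = V" "A = Ev \<or> A = Od" "card A = card Od"
    and "adj L i j \<Longrightarrow> i \<in> A \<Longrightarrow> j \<in> B" "adj L i j \<Longrightarrow> i \<in> B \<Longrightarrow> j \<in> A"
proof -
  have AB: "A = Ev \<and> B = Od \<or> A = Od \<and> B = Ev"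
    using assms by (simp add: opposite_def)
  then show "A \<in> \<Omega>" "B \<in> \<Omega>" "A = Ev \<or> A = Od" "card A = card Od"
    using E_indep O_indep card_E_O(1) by auto
  show "A \<inter> B = {}" "A \<union> B = V"
    using AB E_O(1,2) by (metis Int_commute, metis Un_commute)
  have "i \<in> Ev \<longleftrightarrow> j \<in> Od" "j \<in> Ev \<longleftrightarrow> i \<in> Od" if "adj L i j" for i j
    using adj_E_O[OF that] adj_E_O[OF adj_sym[THEN iffD1, OF that]] by auto
  then show "adj L i j \<Longrightarrow> i \<in> A \<Longrightarrow> j \<in> B" "adj L i j \<Longrightarrow> i \<in> B \<Longrightarrow> j \<in> A"
    using AB by metis+
qed

definition prec :: "node set \<Rightarrow> node set \<Rightarrow> node set \<Rightarrow> node set \<Rightarrow> bool" where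
  "prec A B x y \<longleftrightarrow> y \<inter> B \<subseteq> x \<inter> B \<and> x \<inter> A \<subseteq> y \<inter> A"

text \<open>The neighbours of a node of \<open>A\<close> lie in \<open>B\<close>, where the order is
  reversed: a node of \<open>A\<close> that is free in \<open>x\<close> is free in \<open>y\<close>,
  and a node of \<open>B\<close> that is free in \<open>y\<close> is free in \<open>x\<close>.
  Bipartiteness thus turns exclusion into monotonicity.\<close>

lemma prec_activate:
  assumes AB: "opposite A B" and xy: "prec A B x y" and i: "i \<in> V"
  shows "prec A B (activate L i x) (activate L i y)"
proof (cases "i \<in> B")
  case True
  then have iA: "i \<notin> A"
    using opposite_facts(3)[OF AB] by blast
  have "\<forall>j\<in>x. \<not> adj L i j" if "\<forall>j\<in>y. \<not> adj L i j"
    using opposite_facts(8)[OF AB _ True] that xy unfolding prec_def by blast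
  then show ?thesis
    using xy True iA unfolding prec_def activate_def by (simp split: if_splits) blast
next
  case False
  then have iA: "i \<in> A"
    using opposite_facts(4)[OF AB] i by blast
  have "\<forall>j\<in>y. \<not> adj L i j" if "\<forall>j\<in>x. \<not> adj L i j"
    using opposite_facts(7)[OF AB _ iA] that xy unfolding prec_def by blast
  then show ?thesis
    using xy False iA unfolding prec_def activate_def by (simp split: if_splits) blast
qed

lemma prec_deactivate: "prec A B x y \<Longrightarrow> prec A B (x - {i}) (y - {i})"
  unfolding prec_def by blast

lemma prec_maximal:
  assumes AB: "opposite A B" and "prec A B A y" "y \<in> \<Omega>"
  shows "y = A"
proof -
  have sub: "A \<subseteq> y"
    using assms(2) unfolding prec_def by blast
  have "card A = card y"
    using card_mono[OF indep_finite[OF assms(3)] sub] indep_card_le[OF assms(3)]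
      opposite_facts(6)[OF AB] by simp
  then show ?thesis
    using sub card_subset_eq indep_finite[OF assms(3)] by metis
qed

text \<open>Attractiveness of the dynamics for the order by which \<open>B\<close> is the least and \<open>A\<close> the greatest
  configuration.\<close>

lemma hit_iter_antimono:
  assumes AB: "opposite A B" and "x \<in> \<Omega>" "y \<in> \<Omega>" "prec A B x y"
  shows "hit_iter A n y \<le> hit_iter A n x"
  using assms(2-)
proof (induction n arbitrary: x y)
  case (Suc n)
  show ?case
  proof (cases "y = A")
    case True
    then show ?thesis
      using hit_iter_nonneg[of A "Suc n" x] by simp
  next
    case False
    then have "x \<noteq> A"
      using prec_maximal[OF AB] Suc.prems by blast
    have "(\<Sum>i\<in>V. a * hit_iter A n (y - {i}) + b * hit_iter A n (activate L i y)) \<le>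
        (\<Sum>i\<in>V. a * hit_iter A n (x - {i}) + b * hit_iter A n (activate L i x))"
      using a_pos b_pos Suc.prems
      by (intro sum_mono add_mono mult_left_mono Suc.IH deactivate_indep activate_indep
          prec_deactivate prec_activate[OF AB]) auto
    then show ?thesis
      using False \<open>x \<noteq> A\<close> unif_pos by (simp add: divide_right_mono)
  qed
qed simp

lemma hit_le:
  assumes AB: "opposite A B"
  shows "hit A x \<le> hit A B"
proof (cases "x \<in> \<Omega>")
  case True
  have "prec A B B x"
    using opposite_facts(3)[OF AB] unfolding prec_def by blast
  then have "hit_iter A n x \<le> hit_iter A n B" for n
    using hit_iter_antimono[OF AB opposite_facts(2)[OF AB] True] by blast
  then show ?thesis
    using opposite_facts(1,2)[OF AB] True
    by (intro LIMSEQ_le[OF hit_iter_tendsto hit_iter_tendsto]) auto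
qed (use hit_nonneg[OF opposite_facts(1)[OF AB]] in \<open>simp add: hit_def\<close>)

lemma sum_shift: "(\<Sum>i\<in>V. f (shift_right L i)) = (\<Sum>i\<in>V. f i)"
  by (rule sum.reindex_bij_betw) (simp add: bij_betw_def inj_on_shift shift_image)

text \<open>The translation by one step in the first coordinate exchanges the two classes and
  commutes with the dynamics.\<close>

lemma hit_iter_shift: "x \<in> \<Omega> \<Longrightarrow> hit_iter Ev n (shift_right L ` x) = hit_iter Od n x"
proof (induction n arbitrary: x)
  case (Suc n)
  have x: "x \<subseteq> V"
    using Suc.prems unfolding indep_sets_def by blast
  have "shift_right L ` x = Ev \<longleftrightarrow> x = Od"
    using inj_on_image_eq_iff[OF inj_on_shift(1) x E_O(4)] by (simp add: shift_right_O)
  moreover have "(\<Sum>i\<in>V. a * hit_iter Ev n (shift_right L ` x - {i}) + b * hit_iter Ev n (activate L i (shift_right L ` x)))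
      = (\<Sum>i\<in>V. a * hit_iter Od n (x - {i}) + b * hit_iter Od n (activate L i x))"
  proof (subst sum_shift[symmetric], rule sum.cong[OF refl])
    fix i assume i: "i \<in> V"
    show "a * hit_iter Ev n (shift_right L ` x - {shift_right L i}) +
        b * hit_iter Ev n (activate L (shift_right L i) (shift_right L ` x)) =
        a * hit_iter Od n (x - {i}) + b * hit_iter Od n (activate L i x)"
      by (simp only: Suc.IH[OF deactivate_indep[OF Suc.prems]] Suc.IH[OF activate_indep[OF Suc.prems i]]
          shift_deactivate[OF Suc.prems i, symmetric] shift_activate[OF Suc.prems i, symmetric])
  qed
  ultimately show ?case
    by simp
qed simp

lemma hit_Ev_Od: "hit Ev Od = hit Od Ev"
proof (rule LIMSEQ_unique)
  show "(\<lambda>n. hit_iter Ev n Od) \<longlonglongrightarrow> hit Ev Od"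
    by (intro hit_iter_tendsto E_indep O_indep)
  have "hit_iter Ev n Od = hit_iter Od n Ev" for n
    using hit_iter_shift[OF E_indep, of n] by (simp add: shift_right_E)
  then show "(\<lambda>n. hit_iter Ev n Od) \<longlonglongrightarrow> hit Od Ev"
    using hit_iter_tendsto[OF O_indep E_indep] by simp
qed

definition max_hit :: real where
  "max_hit = hit Od Ev"

text \<open>Reciprocal of the stationary probability of a maximal state, the same for both of
  them.\<close>

definition inv_prob :: real where
  "inv_prob = Z / weight Od"

lemma hit_opposite: "opposite A B \<Longrightarrow> hit A B = max_hit"
  by (auto simp: opposite_def max_hit_def hit_Ev_Od)

lemma weight_opposite: "opposite A B \<Longrightarrow> weight A = weight Od"
  using opposite_facts(6) by (simp add: weight_def)

lemma Z_split: "Z = 2 * weight Od + (\<Sum>x\<in>\<Omega> - {Ev, Od}. weight x)"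
proof -
  have "Ev \<noteq> Od"
    using E_O(1,2) card_V_pos by auto
  then have "(\<Sum>x\<in>{Ev, Od}. weight x) = 2 * weight Od"
    using weight_opposite[of Ev Od] by (simp add: opposite_def)
  then show ?thesis
    unfolding Z_def using sum.subset_diff[of "{Ev, Od}" \<Omega> weight] E_indep O_indep by simp
qed

lemma inv_prob_ge: "inv_prob \<ge> 2"
  using weight_pos[of Od] Z_split sum_nonneg[of "\<Omega> - {Ev, Od}" weight] weight_pos
  by (simp add: inv_prob_def divide_simps less_imp_le)

text \<open>A configuration other than the two maximal ones has at least one node fewer, so its
  weight is smaller by a factor \<open>a / b\<close> at least.\<close>

lemma inv_prob_le:
  assumes "a \<le> b"
  shows "inv_prob \<le> 2 + real (card \<Omega>) * (a / b)"
proof -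
  have s: "b / a \<ge> 1"
    using assms a_pos by simp
  have "weight x \<le> weight Od * (a / b)" if "x \<in> \<Omega> - {Ev, Od}" for x
  proof -
    have "card x < card Od"
      using that indep_card_le[of x] indep_card_max[of x] by (auto simp: less_le)
    then have "(b / a) ^ card x \<le> (b / a) ^ (card Od - 1)"
      using s by (intro power_increasing) auto
    also have "\<dots> = (b / a) ^ card Od * (a / b)"
      using \<open>card x < card Od\<close> a_pos b_pos by (cases "card Od") auto
    finally show ?thesis
      by (simp add: weight_def)
  qed
  then have "(\<Sum>x\<in>\<Omega> - {Ev, Od}. weight x) \<le> real (card (\<Omega> - {Ev, Od})) * (weight Od * (a / b))"
    by (rule sum_bounded_above)
  also have "\<dots> \<le> real (card \<Omega>) * (weight Od * (a / b))"
    using weight_pos[of Od] a_pos b_pos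
    by (intro mult_right_mono of_nat_mono card_mono) (auto intro!: mult_nonneg_nonneg less_imp_le)
  finally have "Z \<le> weight Od * (2 + real (card \<Omega>) * (a / b))"
    using Z_split by (simp add: algebra_simps)
  then show ?thesis
    using weight_pos[of Od] by (simp add: inv_prob_def divide_le_eq mult.commute)
qed

text \<open>The other maximal state has as much stationary mass as \<open>Od\<close>, so excursions
  from \<open>Od\<close> last on average at least as long as the stay there,
  \<open>1 / (a * card Od)\<close>. Yet after a first deactivation the process returns at rate
  \<open>b\<close>, while competing moves have rate of order \<open>a\<close>; the rare excursions
  that do not return at once must be long to make up for this.\<close>

lemma max_hit_ge: "b / (a * real (card Od)) - 1 \<le> a * real (card V) * max_hit"
proof -
  have OE: "opposite Od Ev"
    by (simp add: opposite_def)
  let ?h = "hit Od"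
  have fixed: "activate L i Od = Od" if "i \<in> V" for i
    using that by (simp add: activate_maximal)
  have "inv_prob - 1 = (\<Sum>i\<in>V. a * ?h (Od - {i}) + b * ?h (activate L i Od))"
    using hgen_hit_self[OF O_indep] by (simp add: hgen_eq hit_self[OF O_indep] inv_prob_def)
  also have "\<dots> = (\<Sum>i\<in>V. a * ?h (Od - {i}))"
    using fixed by (intro sum.cong) (auto simp: hit_self[OF O_indep])
  also have "\<dots> = (\<Sum>i\<in>Od. a * ?h (Od - {i}))"
    using E_O(4) by (intro sum.mono_neutral_right) (auto simp: hit_self[OF O_indep])
  finally have sum: "(\<Sum>i\<in>Od. a * ?h (Od - {i})) \<ge> 1"
    using inv_prob_ge by simp
  have card_pos: "card Od > 0"
    using card_V_pos card_E_O(2,3) by linarith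
  \<comment> \<open>Pigeonhole: the sum over \<open>Od\<close> is at least \<open>1\<close>, so some
    term reaches the average.\<close>
  have "\<exists>j\<in>Od. 1 / real (card Od) \<le> a * ?h (Od - {j})"
  proof (rule ccontr)
    assume "\<not> ?thesis"
    then have "(\<Sum>i\<in>Od. a * ?h (Od - {i})) < (\<Sum>i\<in>Od. 1 / real (card Od))"
      using card_pos by (intro sum_strict_mono) (auto simp: not_le)
    with sum card_pos show False
      by (simp split: if_splits)
  qed
  then obtain j where j: "j \<in> Od" "1 / real (card Od) \<le> a * ?h (Od - {j})"
    by blast
  have jV: "j \<in> V"
    using j E_O(4) by blast
  let ?x = "Od - {j}"
  have "?x \<in> \<Omega>" "?x \<noteq> Od"
    using deactivate_indep[OF O_indep] j by auto
  then have "-1 = hgen ?h ?x"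
    using hgen_hit[OF O_indep] by simp
  also have "\<dots> = (\<Sum>i\<in>V. a * (?h (?x - {i}) - ?h ?x)) + (\<Sum>i\<in>V. b * (?h (activate L i ?x) - ?h ?x))"
    by (simp add: hgen_def sum.distrib)
  \<comment> \<open>With only \<open>j\<close> removed, no other activation is possible, so the rate
    \<open>b\<close> enters through the return to \<open>Od\<close> alone.\<close>
  also have "(\<Sum>i\<in>V. b * (?h (activate L i ?x) - ?h ?x)) = (\<Sum>i\<in>{j}. b * (?h (activate L i ?x) - ?h ?x))"
    using jV j activate_maximal_minus[of Od _ j] by (intro sum.mono_neutral_right) auto
  also have "activate L j ?x = Od"
  proof -
    have "\<forall>k\<in>?x. \<not> adj L j k"
      using j O_indep unfolding indep_sets_def by blast
    then show ?thesis
      using j by (auto simp: activate_def)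
  qed
  then have "(\<Sum>i\<in>{j}. b * (?h (activate L i ?x) - ?h ?x)) = - b * ?h ?x"
    by (simp add: hit_self[OF O_indep])
  also have "(\<Sum>i\<in>V. a * (?h (?x - {i}) - ?h ?x)) \<le> real (card V) * (a * max_hit)"
  proof (rule sum_bounded_above)
    fix i
    have "?h (?x - {i}) - ?h ?x \<le> max_hit"
      using hit_le[OF OE, of "?x - {i}"] hit_nonneg[OF O_indep, of ?x] by (simp add: max_hit_def)
    then show "a * (?h (?x - {i}) - ?h ?x) \<le> a * max_hit"
      using a_pos by simp
  qed
  finally have "b * ?h ?x - 1 \<le> a * real (card V) * max_hit"
    by (simp add: algebra_simps)
  moreover have "b / (a * real (card Od)) \<le> b * ?h ?x"
  proof -
    have "b / (a * real (card Od)) = b * (1 / real (card Od)) / a"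
      by simp
    also have "\<dots> \<le> b * (a * ?h ?x) / a"
      using j(2) a_pos b_pos by (intro divide_right_mono mult_left_mono) auto
    finally show ?thesis
      using a_pos by simp
  qed
  ultimately show ?thesis by linarith
qed

end

subsection \<open>Time averages of the queue lengths\<close>

locale grid_network = network_process L lam mu nu p s + even_torus L
  for L :: nat and lam mu nu p :: real and s :: state +
  assumes s_states: "s \<in> states L"
begin

sublocale hard_core L "p * mu" nu
  using p_pos mu_pos nu_pos by unfold_locales auto

lemma sum_events:
  "(\<Sum>e\<in>events L. f e) =
    (\<Sum>i\<in>V. f (Arrival i) + f (Activation i) + f (Completion_Backoff i) + f (Completion_Continue i))"
proof -
  have "(\<Sum>e\<in>events L. f e) = (\<Sum>e\<in>Arrival ` V. f e) + (\<Sum>e\<in>Activation ` V. f e) +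
      (\<Sum>e\<in>Completion_Backoff ` V. f e) + (\<Sum>e\<in>Completion_Continue ` V. f e)"
    unfolding events_def by (subst sum.union_disjoint; (subst sum.union_disjoint)?; auto)+
  then show ?thesis
    by (simp add: sum.reindex inj_on_def sum.distrib)
qed

lemma gen_fst:
  assumes x: "x \<in> \<Omega>"
  shows "gen (\<lambda>y. g (fst y)) (x, q) = hgen g x"
  unfolding compensator_def sum_events hgen_def
proof (rule sum.cong[OF refl])
  fix i assume i: "i \<in> V"
  have "(\<forall>j. adj L i j \<longrightarrow> j \<notin> x) \<longleftrightarrow> (\<forall>j\<in>x. \<not> adj L i j)"
    by blast
  then show "rt (x, q) (Arrival i) * (g (fst (step (x, q) (Arrival i))) - g (fst (x, q))) +
      rt (x, q) (Activation i) * (g (fst (step (x, q) (Activation i))) - g (fst (x, q))) +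
      rt (x, q) (Completion_Backoff i) * (g (fst (step (x, q) (Completion_Backoff i))) - g (fst (x, q))) +
      rt (x, q) (Completion_Continue i) * (g (fst (step (x, q) (Completion_Continue i))) - g (fst (x, q))) =
      p * mu * (g (x - {i}) - g x) + nu * (g (activate L i x) - g x)"
    using i by (simp add: activate_def insert_absorb)
qed

lemma AE_invariant:
  "AE \<omega> in law. \<forall>n. fst (st \<omega> n) \<in> \<Omega> \<and> rt (st \<omega> n) (fst (\<omega> n)) > 0 \<and> snd (\<omega> n) > 0"
  using AE_rate_pos
proof eventually_elim
  case (elim \<omega>)
  have "fst (st \<omega> n) \<in> \<Omega>" for n
  proof (induction n)
    case 0
    then show ?case using s_states by (auto simp: states_def)
  next
    case (Suc n)
    obtain x q where xq: "st \<omega> n = (x, q)" by fastforce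
    have "rt (x, q) (fst (\<omega> n)) > 0"
      using elim[rule_format, of n] xq by simp
    then show ?case
    proof (cases "fst (\<omega> n)")
      case (Activation i)
      then have "i \<in> V" "activate L i x = insert i x"
        using \<open>rt (x, q) (fst (\<omega> n)) > 0\<close> unfolding activate_def by (auto split: if_splits)
      then show ?thesis
        using activate_indep[of x i] Suc by (simp add: xq Activation)
    qed (use Suc deactivate_indep in \<open>auto simp: xq\<close>)
  qed
  with elim show ?case by blast
qed

lemma time_avg_cong:
  assumes "\<And>n. fst (st \<omega> n) \<in> \<Omega>" "\<And>x q. x \<in> \<Omega> \<Longrightarrow> f (x, q) = g (x, q)"
  shows "time_avg \<omega> f n = time_avg \<omega> g n"
proof -
  have "f (st \<omega> k) = g (st \<omega> k)" for k
    using assms(1)[of k] assms(2)[of "fst (st \<omega> k)" "snd (st \<omega> k)"] by simp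
  then show ?thesis by simp
qed

lemma time_avg_mono:
  assumes "\<And>n. fst (st \<omega> n) \<in> \<Omega>" "\<And>n. snd (\<omega> n) > 0"
    and "\<And>x q. x \<in> \<Omega> \<Longrightarrow> f (x, q) \<le> g (x, q)"
  shows "time_avg \<omega> f n \<le> time_avg \<omega> g n"
proof -
  have "f (st \<omega> k) \<le> g (st \<omega> k)" for k
    using assms(1)[of k] assms(3)[of "fst (st \<omega> k)" "snd (st \<omega> k)"] by simp
  then show ?thesis
    using assms(2) by (intro divide_right_mono sum_mono mult_left_mono sum_nonneg) (auto intro: less_imp_le)
qed

lemma time_avg_const:
  assumes "\<And>n. snd (\<omega> n) > 0" "n > 0"
  shows "time_avg \<omega> (\<lambda>_. c) n = c"
proof -
  have "elapsed \<omega> n > 0"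
    using assms by (intro sum_pos) auto
  then show ?thesis
    by (simp flip: sum_distrib_right)
qed

lemma time_avg_linear:
  "time_avg \<omega> (\<lambda>y. c * f y - g y) n = c * time_avg \<omega> f n - time_avg \<omega> g n"
  by (simp add: right_diff_distrib sum_subtractf diff_divide_distrib sum_distrib_left mult.left_commute)

lemma time_avg_affine:
  assumes "\<And>n. snd (\<omega> n) > 0" "n > 0"
  shows "time_avg \<omega> (\<lambda>y. c1 * f y + c2 * g y + c3 * h y + c4) n =
    c1 * time_avg \<omega> f n + c2 * time_avg \<omega> g n + c3 * time_avg \<omega> h n + c4"
proof -
  have "elapsed \<omega> n > 0"
    using assms by (intro sum_pos) auto
  then show ?thesis
    by (simp add: distrib_left sum.distrib add_divide_distrib sum_distrib_left mult.left_commute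
        flip: sum_distrib_right)
qed

lemma hit_bounds:
  assumes "opposite A B"
  shows "0 \<le> hit A x" "hit A x \<le> max_hit" "hit A A = 0" "hit A B = max_hit"
  using hit_nonneg hit_le[OF assms] hit_self hit_opposite[OF assms] opposite_facts(1)[OF assms] by auto

lemma hgen_hit_opposite:
  assumes "opposite A B" "x \<in> \<Omega>"
  shows "hgen (hit A) x = inv_prob * of_bool (x = A) - 1"
  using hgen_hit[OF opposite_facts(1)[OF assms(1)] assms(2)] hgen_hit_self[OF opposite_facts(1)[OF assms(1)]]
  by (simp add: weight_opposite[OF assms(1)] inv_prob_def)

text \<open>\<open>hit A\<close> solves the Poisson equation for the indicator of \<open>A\<close>:
  its generator is \<open>inv_prob\<close> times the indicator, minus \<open>1\<close>. Vanishing of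
  the generator average is therefore the frequency of \<open>A\<close>.\<close>

lemma AE_time_avg_maximal:
  assumes AB: "opposite A B"
  shows "AE \<omega> in law. time_avg \<omega> (\<lambda>y. of_bool (fst y = A)) \<longlonglongrightarrow> 1 / inv_prob"
proof -
  have "\<bar>hit A (fst y)\<bar> \<le> max_hit" for y :: state
    using hit_bounds[OF AB] by simp
  from AE_time_avg_gen[of "\<lambda>y. hit A (fst y)", OF this] AE_invariant show ?thesis
  proof eventually_elim
    case (elim \<omega>)
    have eq: "time_avg \<omega> (\<lambda>y. of_bool (fst y = A)) n =
        (time_avg \<omega> (gen (\<lambda>y. hit A (fst y))) n + 1) / inv_prob" if "n > 0" for n
    proof -
      have "time_avg \<omega> (gen (\<lambda>y. hit A (fst y))) n = time_avg \<omega> (\<lambda>y. inv_prob * of_bool (fst y = A) - 1) n"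
        using elim(2) by (intro time_avg_cong) (auto simp: gen_fst hgen_hit_opposite[OF AB])
      also have "\<dots> = inv_prob * time_avg \<omega> (\<lambda>y. of_bool (fst y = A)) n - time_avg \<omega> (\<lambda>_. 1) n"
        by (rule time_avg_linear)
      also have "time_avg \<omega> (\<lambda>_. 1) n = 1"
        using elim(2) that by (intro time_avg_const) auto
      finally show ?thesis
        using inv_prob_ge by (simp add: field_simps)
    qed
    have "(\<lambda>n. (time_avg \<omega> (gen (\<lambda>y. hit A (fst y))) n + 1) / inv_prob) \<longlonglongrightarrow> (0 + 1) / inv_prob"
      using elim(1) inv_prob_ge by (intro tendsto_intros) auto
    then have "(\<lambda>n. time_avg \<omega> (\<lambda>y. of_bool (fst y = A)) n) \<longlonglongrightarrow> (0 + 1) / inv_prob"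
      by (rule Lim_transform_eventually) (use eq in \<open>auto intro!: eventually_sequentiallyI[of 1]\<close>)
    then show ?case by simp
  qed
qed

text \<open>The packet in transmission, dummy or not, is counted too: an activation then moves a
  packet without losing it, or adds a dummy. The cap \<open>K\<close> makes the function
  bounded.\<close>

definition packets :: "node \<Rightarrow> nat \<Rightarrow> state \<Rightarrow> real" where
  "packets i K y = real (min (snd y i + of_bool (i \<in> fst y)) K)"

text \<open>Product rule: \<open>packets\<close> times the generator of \<open>hit A\<close>, plus
  the change of \<open>packets\<close> weighted by \<open>hit A\<close> after the event. The first
  part is at least \<open>- packets\<close>. Arrivals gain \<open>lam * max_hit\<close> in
  \<open>B\<close>, activations never lose, and a completion loses at most one packet: none in
  \<open>B\<close>, where \<open>i\<close> is idle, at most \<open>inv_prob - 1\<close> in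
  \<open>A\<close>, and at most \<open>mu * max_hit\<close> elsewhere.\<close>

lemma gen_packets_hit:
  assumes AB: "opposite A B" and i: "i \<in> A" and K: "K > 0" and x: "x \<in> \<Omega>"
  shows "packets i K (x, q) * (1 + lam * max_hit / real K) + gen (\<lambda>y. packets i K y * hit A (fst y)) (x, q)
    \<ge> lam * max_hit * of_bool (x = B)
      - mu * max_hit * (1 - of_bool (x = A) - of_bool (x = B)) - (inv_prob - 1)"
proof -
  let ?h = "hit A" and ?H = max_hit
  define \<phi> where "\<phi> = packets i K (x, q)"
  define d where "d e = packets i K (step (x, q) e) - \<phi>" for e
  define w where "w e = rt (x, q) e * (d e * ?h (fst (step (x, q) e)))" for e
  have iV: "i \<in> V"
    using i opposite_facts(4)[OF AB] by blast
  have \<phi>0: "\<phi> \<ge> 0" "\<phi> \<le> real K"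
    by (simp_all add: \<phi>_def packets_def)
  have h: "0 \<le> ?h y" "?h y \<le> ?H" for y
    using hit_bounds[OF AB] by auto
  have H0: "?H \<ge> 0"
    using h order.trans by blast
  have "gen (\<lambda>y. packets i K y * ?h (fst y)) (x, q) =
      (\<Sum>e\<in>events L. \<phi> * (rt (x, q) e * (?h (fst (step (x, q) e)) - ?h x)) + w e)"
    unfolding compensator_def by (rule sum.cong) (auto simp: w_def d_def \<phi>_def algebra_simps)
  also have "\<dots> = \<phi> * gen (\<lambda>y. ?h (fst y)) (x, q) + (\<Sum>e\<in>events L. w e)"
    by (simp add: sum.distrib sum_distrib_left compensator_def)
  also have "gen (\<lambda>y. ?h (fst y)) (x, q) = inv_prob * of_bool (x = A) - 1"
    by (simp add: gen_fst[OF x] hgen_hit_opposite[OF AB x])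
  also have "(\<Sum>e\<in>events L. w e) =
      (\<Sum>j\<in>V. w (Arrival j) + w (Activation j) + w (Completion_Backoff j) + w (Completion_Continue j))"
    by (rule sum_events)
  also have "\<dots> = (\<Sum>j\<in>{i}. w (Arrival j) + w (Activation j) + w (Completion_Backoff j) + w (Completion_Continue j))"
    using iV by (intro sum.mono_neutral_right) (auto simp: w_def d_def \<phi>_def packets_def)
  finally have gen: "gen (\<lambda>y. packets i K y * ?h (fst y)) (x, q) =
      \<phi> * (inv_prob * of_bool (x = A) - 1) +
      (w (Arrival i) + w (Activation i) + w (Completion_Backoff i) + w (Completion_Continue i))"
    by simp
  have "\<phi> * (inv_prob * of_bool (x = A) - 1) \<ge> - \<phi>"
    using \<phi>0 inv_prob_ge by (auto simp: algebra_simps)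
  moreover have "w (Arrival i) \<ge> lam * ?H * of_bool (x = B) * (1 - \<phi> / real K)"
  proof -
    \<comment> \<open>The increment is \<open>1\<close> below the cap and \<open>0\<close> at it. A
      lower bound linear in \<open>\<phi>\<close> is chosen so that the correction can be moved to
      the left-hand side, where it becomes the factor \<open>1 + lam * max_hit / K\<close>.\<close>
    have "d (Arrival i) \<ge> 1 - \<phi> / real K"
    proof (cases "q i + of_bool (i \<in> x) < K")
      case True
      then have "d (Arrival i) = 1"
        by (auto simp: d_def \<phi>_def packets_def)
      then show ?thesis using \<phi>0 by simp
    next
      case False
      then have "\<phi> = real K" "d (Arrival i) = 0"
        by (auto simp: d_def \<phi>_def packets_def)
      then show ?thesis using K by simp
    qed
    moreover have "?h x \<ge> ?H * of_bool (x = B)"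
      using h hit_bounds(4)[OF AB] by auto
    moreover have "1 - \<phi> / real K \<ge> 0"
      using \<phi>0 K by simp
    ultimately have "(1 - \<phi> / real K) * (?H * of_bool (x = B)) \<le> d (Arrival i) * ?h x"
      using H0 h by (intro mult_mono) auto
    then have "lam * ((1 - \<phi> / real K) * (?H * of_bool (x = B))) \<le> lam * (d (Arrival i) * ?h x)"
      using lam_pos by simp
    then show ?thesis
      using iV by (simp add: w_def mult_ac)
  qed
  moreover have "lam * ?H * of_bool (x = B) * (1 - \<phi> / real K) \<ge>
      lam * ?H * of_bool (x = B) - \<phi> * (lam * ?H / real K)"
    using \<phi>0 H0 lam_pos K by (auto simp: algebra_simps intro!: divide_nonneg_pos)
  moreover have "w (Activation i) \<ge> 0"
  proof (cases "i \<in> x")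
    case False
    then have "d (Activation i) \<ge> 0"
      by (auto simp: d_def \<phi>_def packets_def)
    then show ?thesis
      using h by (simp add: w_def del: rate.simps)
  qed (simp add: w_def)
  moreover have "w (Completion_Backoff i) + w (Completion_Continue i) \<ge>
      - mu * ?H * (1 - of_bool (x = A) - of_bool (x = B)) - (inv_prob - 1)"
  proof (cases "i \<in> x")
    case False
    then have "x \<noteq> A" using i by blast
    moreover have "0 \<le> mu * ?H" using mu_pos H0 by simp
    ultimately show ?thesis
      using False inv_prob_ge by (simp add: w_def)
  next
    case True
    then have xB: "x \<noteq> B"
      using i opposite_facts(3)[OF AB] by blast
    have d: "d (Completion_Backoff i) \<ge> -1" "d (Completion_Continue i) \<ge> -1"
      using True by (auto simp: d_def \<phi>_def packets_def)
    have "p * mu * (d (Completion_Backoff i) * ?h (x - {i})) \<ge> p * mu * (-1 * ?h (x - {i}))"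
      using d h p_pos mu_pos by (intro mult_left_mono mult_right_mono) auto
    moreover have "(1 - p) * mu * (d (Completion_Continue i) * ?h x) \<ge> (1 - p) * mu * (-1 * ?h x)"
      using d h p_le_1 mu_pos by (intro mult_left_mono mult_right_mono) auto
    ultimately have w: "w (Completion_Backoff i) + w (Completion_Continue i) \<ge>
        - (p * mu * ?h (x - {i})) - (1 - p) * mu * ?h x"
      using True iV by (simp add: w_def)
    show ?thesis
    proof (cases "x = A")
      case True
      \<comment> \<open>A completion that continues costs nothing here since
        \<open>hit A A = 0\<close>; a back-off costs an amount that does not grow with
        \<open>max_hit\<close>.\<close>
      have "p * mu * ?h (x - {i}) \<le> inv_prob - 1"
        using hit_neighbour_le[OF opposite_facts(1)[OF AB] iV]
        by (simp add: True inv_prob_def weight_opposite[OF AB])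
      then show ?thesis
        using w xB True hit_bounds(3)[OF AB] by simp
    next
      case False
      have "p * mu * ?h (x - {i}) + (1 - p) * mu * ?h x \<le> p * mu * ?H + (1 - p) * mu * ?H"
        using h p_pos p_le_1 mu_pos by (intro add_mono mult_left_mono) auto
      also have "\<dots> = mu * ?H"
        by (simp add: algebra_simps)
      finally show ?thesis
        using w xB False inv_prob_ge by simp
    qed
  qed
  ultimately show ?thesis
    unfolding gen \<phi>_def[symmetric] by (simp add: algebra_simps)
qed

text \<open>The drift inequality is averaged over time, where the generator disappears and both
  maximal states have frequency \<open>1 / inv_prob\<close>. The subtracted \<open>1\<close> is the
  transmission included in \<open>packets\<close>; \<open>\<delta>\<close> is slack for the
  limit.\<close>

lemma AE_time_avg_queue:
  assumes AB: "opposite A B" and i: "i \<in> A" and K: "K > 0" and \<delta>: "\<delta> > 0"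
  shows "AE \<omega> in law. \<forall>\<^sub>F n in sequentially. time_avg \<omega> (\<lambda>y. real (min (snd y i) K)) n \<ge>
    (lam * max_hit / inv_prob - mu * max_hit * (1 - 2 / inv_prob) - (inv_prob - 1)) /
      (1 + lam * max_hit / real K) - 1 - \<delta>"
proof -
  let ?H = max_hit
  define D where "D = 1 + lam * ?H / real K"
  have H: "?H \<ge> 0"
    using hit_bounds[OF AB] order.trans by blast
  have D: "D > 0"
    using H lam_pos K by (simp add: D_def add_pos_nonneg)
  let ?f = "\<lambda>y. packets i K y * hit A (fst y)"
  have bound: "\<bar>?f y\<bar> \<le> real K * ?H" for y
    using hit_bounds(1,2)[OF AB, of "fst y"] by (auto simp: packets_def abs_mult intro!: mult_mono)
  have BA: "opposite B A"
    using AB by (auto simp: opposite_def)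
  show ?thesis
    using AE_time_avg_gen[of ?f, OF bound] AE_invariant AE_time_avg_maximal[OF AB] AE_time_avg_maximal[OF BA]
  proof eventually_elim
    case (elim \<omega>)
    let ?a = "time_avg \<omega> (\<lambda>y. of_bool (fst y = A))"
    let ?b = "time_avg \<omega> (\<lambda>y. of_bool (fst y = B))"
    let ?g = "time_avg \<omega> (gen ?f)"
    define low where "low n = (lam * ?H * ?b n - mu * ?H * (1 - ?a n - ?b n) - (inv_prob - 1) - ?g n) / D - 1" for n
    have lim: "(\<lambda>n. (lam * ?H * v n - mu * ?H * (1 - u n - v n) - (inv_prob - 1) - g n) / D - 1) \<longlonglongrightarrow>
        (lam * ?H * y - mu * ?H * (1 - x - y) - (inv_prob - 1) - z) / D - 1"
      if "u \<longlonglongrightarrow> x" "v \<longlonglongrightarrow> y" "g \<longlonglongrightarrow> z" for u v g :: "nat \<Rightarrow> real" and x y z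
      using D by (intro tendsto_intros that) simp
    have "low \<longlonglongrightarrow> (lam * ?H * (1 / inv_prob) - mu * ?H * (1 - 1 / inv_prob - 1 / inv_prob) - (inv_prob - 1) - 0) / D - 1"
      unfolding low_def by (rule lim[OF elim(3,4,1)])
    then have "\<forall>\<^sub>F n in sequentially. low n > (lam * ?H * (1 / inv_prob)
        - mu * ?H * (1 - 1 / inv_prob - 1 / inv_prob) - (inv_prob - 1) - 0) / D - 1 - \<delta>"
      by (rule order_tendstoD) (use \<delta> in simp)
    then show ?case
      using eventually_gt_at_top[of 0]
    proof eventually_elim
      case (elim n)
      note inv = \<open>\<forall>n. fst (st \<omega> n) \<in> \<Omega> \<and> rt (st \<omega> n) (fst (\<omega> n)) > 0 \<and> snd (\<omega> n) > 0\<close>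
      have const: "time_avg \<omega> (\<lambda>_. c) n = c" for c
        using inv elim by (intro time_avg_const) auto
      \<comment> \<open>Written as an affine combination, the bound can be pulled inside the time
        average, where it holds pointwise.\<close>
      define c1 c2 c3 c4 where "c1 = (lam + mu) * ?H / D" and "c2 = mu * ?H / D"
        and "c3 = - 1 / D" and "c4 = - (mu * ?H + (inv_prob - 1)) / D - 1"
      have affine: "(lam * ?H * v - mu * ?H * (1 - u - v) - (inv_prob - 1) - g) / D - 1 =
          c1 * v + c2 * u + c3 * g + c4" for u v g
        by (simp add: c1_def c2_def c3_def c4_def diff_divide_distrib add_divide_distrib algebra_simps)
      have "low n = time_avg \<omega> (\<lambda>y. c1 * of_bool (fst y = B) + c2 * of_bool (fst y = A) + c3 * gen ?f y + c4) n"
        unfolding low_def affine using inv elim by (intro time_avg_affine[symmetric]) auto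
      also have "\<dots> \<le> time_avg \<omega> (\<lambda>y. real (min (snd y i) K)) n"
      proof (rule time_avg_mono)
        fix x q assume x: "x \<in> \<Omega>"
        have "packets i K (x, q) - 1 \<le> real (min (snd (x, q) i) K)"
          by (simp add: packets_def min_def)
        moreover have "(lam * ?H * of_bool (x = B) - mu * ?H * (1 - of_bool (x = A) - of_bool (x = B))
            - (inv_prob - 1) - gen ?f (x, q)) / D \<le> packets i K (x, q)"
          using gen_packets_hit[OF AB i K x, of q] D by (simp only: D_def[symmetric] divide_le_eq if_True)
        ultimately show "c1 * of_bool (fst (x, q) = B) + c2 * of_bool (fst (x, q) = A) + c3 * gen ?f (x, q) + c4
            \<le> real (min (snd (x, q) i) K)"
          unfolding affine[symmetric] fst_conv by linarith
      qed (use inv in auto)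
      finally show ?case
        using elim by (simp add: D_def)
    qed
  qed
qed

text \<open>The series adds the holding times before the first visit to \<open>Od\<close>, and the
  instant of that visit is admissible in the infimum, being positive since the start is in the other
  maximal state. Without a visit the series is infinite because time diverges.\<close>

lemma AE_hitting_time_le:
  assumes s: "fst s = Ev"
  shows "AE \<omega> in law. hitting_time s Od \<omega> \<le>
    (\<Sum>n. ennreal (snd (\<omega> n)) * of_bool (\<forall>k\<le>n. fst (st \<omega> k) \<noteq> Od))"
  using AE_invariant AE_elapsed_at_top
proof eventually_elim
  case (elim \<omega>)
  have pos: "snd (\<omega> n) > 0" for n
    using elim by blast
  show ?case
  proof (cases "\<exists>n. fst (st \<omega> n) = Od")
    case True
    define n where "n = (LEAST n. fst (st \<omega> n) = Od)"
    have n: "fst (st \<omega> n) = Od"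
      unfolding n_def using True by (rule LeastI_ex)
    have least: "fst (st \<omega> k) \<noteq> Od" if "k < n" for k
      using not_less_Least[of k "\<lambda>n. fst (st \<omega> n) = Od"] that by (simp add: n_def)
    have "Ev \<noteq> Od"
      using E_O(1,2) card_V_pos by auto
    then have "n > 0"
      using n s by (cases n) auto
    then have t: "elapsed \<omega> n > 0"
      using pos by (intro sum_pos) auto
    have time: "event_time \<omega> m = elapsed \<omega> (Suc m)" for m
      by (simp add: event_time_def lessThan_Suc_atMost)
    have "(LEAST m. elapsed \<omega> n < event_time \<omega> m) = n"
    proof (rule Least_equality)
      show "elapsed \<omega> n < event_time \<omega> n"
        using pos[of n] by (simp add: time)
      fix m assume m: "elapsed \<omega> n < event_time \<omega> m"
      show "n \<le> m"
      proof (rule ccontr)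
        assume "\<not> n \<le> m"
        then have "elapsed \<omega> (Suc m) \<le> elapsed \<omega> n"
          using pos by (intro sum_mono2) (auto intro: less_imp_le)
        with m show False
          by (simp add: time)
      qed
    qed
    then have "fst (state_at s \<omega> (elapsed \<omega> n)) = Od"
      using n by (simp add: state_at_def)
    then have "hitting_time s Od \<omega> \<le> ennreal (elapsed \<omega> n)"
      unfolding hitting_time_def using t by (intro Inf_lower) auto
    also have "\<dots> = (\<Sum>k<n. ennreal (snd (\<omega> k)) * of_bool (\<forall>j\<le>k. fst (st \<omega> j) \<noteq> Od))"
      using pos least by (subst sum_ennreal[symmetric]) (auto intro: less_imp_le)
    also have "\<dots> \<le> (\<Sum>n. ennreal (snd (\<omega> n)) * of_bool (\<forall>k\<le>n. fst (st \<omega> k) \<noteq> Od))"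
      by (intro sum_le_suminf) auto
    finally show ?thesis .
  next
    case False
    have "(\<Sum>n. ennreal (snd (\<omega> n))) = top"
    proof (rule ccontr)
      assume "(\<Sum>n. ennreal (snd (\<omega> n))) \<noteq> top"
      then have sum: "summable (\<lambda>n. snd (\<omega> n))"
        using pos by (intro summable_suminf_not_top) (auto intro: less_imp_le)
      have "elapsed \<omega> n \<le> (\<Sum>n. snd (\<omega> n))" for n
        using sum pos by (intro sum_le_suminf) (auto intro: less_imp_le)
      moreover have "\<forall>\<^sub>F n in sequentially. elapsed \<omega> n > (\<Sum>n. snd (\<omega> n))"
        using elim(2) unfolding filterlim_at_top_dense by blast
      then obtain n where "elapsed \<omega> n > (\<Sum>n. snd (\<omega> n))"
        by (auto simp: eventually_sequentially)
      ultimately show False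
        by (meson not_le)
    qed
    then show ?thesis
      using False by simp
  qed
qed

lemma measurable_not_hit:
  assumes "{0..<n} \<subseteq> I"
  shows "(\<lambda>\<omega>. of_bool (\<forall>k\<le>n. fst (st \<omega> k) \<noteq> Od) :: ennreal) \<in> borel_measurable (PiM I (\<lambda>_. event_space))"
proof -
  have "Measurable.pred (PiM I (\<lambda>_. event_space)) (\<lambda>\<omega>. fst (st \<omega> k) \<noteq> Od)" if "k \<in> {..n}" for k
    using assms that by (intro measurable_state) auto
  then have "Measurable.pred (PiM I (\<lambda>_. event_space)) (\<lambda>\<omega>. \<forall>k\<in>{..n}. fst (st \<omega> k) \<noteq> Od)"
    by (rule pred_intros_finite(3)[OF finite_atMost])
  then have Q: "Measurable.pred (PiM I (\<lambda>_. event_space)) (\<lambda>\<omega>. \<forall>k\<le>n. fst (st \<omega> k) \<noteq> Od)"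
    by (simp only: Ball_def atMost_iff)
  show ?thesis
  proof (rule measurable_compose[OF Q, of of_bool borel])
    show "(of_bool :: bool \<Rightarrow> ennreal) \<in> borel_measurable (count_space UNIV)"
      by simp
  qed
qed

text \<open>First-step analysis: divided by the total rate, generator \<open>-1\<close> says that
  \<open>hit\<close> drops on average by the mean holding time.\<close>

lemma expected_hit_step:
  assumes x: "fst y \<in> \<Omega>" "fst y \<noteq> Od"
  shows "(\<integral>\<^sup>+z. ennreal (hit Od (fst (step y (fst z)))) + ennreal (snd z) \<partial>jump y) = ennreal (hit Od (fst y))"
proof -
  have OE: "opposite Od Ev"
    by (simp add: opposite_def)
  have b: "\<bar>hit Od (fst (step y e))\<bar> \<le> max_hit" for e
    using hit_bounds[OF OE] by simp
  note mom = jump_moments[of "\<lambda>e. hit Od (fst (step y e))" max_hit y, OF b]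
  have arith: "S / t + 1 / t = h" if "-1 = S - t * h" "t > 0" for S t h :: real
    using that by (simp add: field_simps)
  have "-1 = gen (\<lambda>y. hit Od (fst y)) y"
    using gen_fst[OF x(1), of "hit Od" "snd y"] hgen_hit_opposite[OF OE x(1)] x(2) by simp
  also have "\<dots> = (\<Sum>e\<in>events L. rt y e * hit Od (fst (step y e))) - tot y * hit Od (fst y)"
    by (simp add: compensator_def total_rate_def right_diff_distrib sum_subtractf sum_distrib_right)
  finally have "(\<integral>z. hit Od (fst (step y (fst z))) \<partial>jump y) + (\<integral>z. snd z \<partial>jump y) = hit Od (fst y)"
    unfolding mom(2,4) by (intro arith) simp_all
  moreover have "(\<integral>\<^sup>+z. ennreal (hit Od (fst (step y (fst z)))) + ennreal (snd z) \<partial>jump y) =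
      (\<integral>\<^sup>+z. ennreal (hit Od (fst (step y (fst z)))) \<partial>jump y) + (\<integral>\<^sup>+z. ennreal (snd z) \<partial>jump y)"
    using borel_measurable_integrable[OF mom(1)] borel_measurable_integrable[OF mom(3)]
    by (intro nn_integral_add measurable_compose[OF _ measurable_ennreal])
  moreover have "(\<integral>\<^sup>+z. ennreal (hit Od (fst (step y (fst z)))) \<partial>jump y) =
      ennreal (\<integral>z. hit Od (fst (step y (fst z))) \<partial>jump y)"
    by (rule nn_integral_eq_integral[OF mom(1)]) (simp add: hit_bounds[OF OE])
  moreover have ae: "AE z in jump y. snd z \<ge> 0"
    using mom(7) by eventually_elim simp
  have "(\<integral>\<^sup>+z. ennreal (snd z) \<partial>jump y) = ennreal (\<integral>z. snd z \<partial>jump y)"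
    by (rule nn_integral_eq_integral[OF mom(3) ae])
  moreover have "(\<integral>z. hit Od (fst (step y (fst z))) \<partial>jump y) \<ge> 0"
    by (rule Bochner_Integration.integral_nonneg) (simp add: hit_bounds[OF OE])
  moreover have "(\<integral>z. snd z \<partial>jump y) \<ge> 0"
    using ae by (rule integral_nonneg_AE)
  ultimately show ?thesis
    by (simp only: ennreal_plus[symmetric])
qed

text \<open>Supermartingale argument: the remaining \<open>hit\<close> on paths that have not yet
  arrived, plus the time already spent, does not increase in expectation. It starts at
  \<open>max_hit\<close>, and dropping the first summand bounds every partial sum.\<close>

lemma expected_hitting_time_le:
  assumes s: "fst s = Ev"
  shows "(\<integral>\<^sup>+\<omega>. hitting_time s Od \<omega> \<partial>law) \<le> ennreal max_hit"
proof -
  define J where "J n \<omega> = (of_bool (\<forall>k\<le>n. fst (st \<omega> k) \<noteq> Od) :: ennreal)" for n \<omega>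
  define \<tau> where "\<tau> n \<omega> = ennreal (snd (\<omega> n)) * J n \<omega>" for n and \<omega> :: path
  \<comment> \<open>Survival is required up to \<open>n - 1\<close> only. In passing to
    \<open>n + 1\<close> the factor \<open>J n\<close> appears, which is determined before the n-th
    transition and is therefore constant under the jump law.\<close>
  define a where "a n = (\<integral>\<^sup>+\<omega>. ennreal (hit Od (fst (st \<omega> n))) * (if n = 0 then 1 else J (n - 1) \<omega>) \<partial>law)" for n
  have J_meas: "J n \<in> borel_measurable (PiM I (\<lambda>_. event_space))" if "{0..<n} \<subseteq> I" for n I
    unfolding J_def by (rule measurable_not_hit[OF that])
  have \<tau>_meas: "\<tau> n \<in> borel_measurable (PiM I (\<lambda>_. event_space))" if "{0..n} \<subseteq> I" for n I
  proof -
    have n: "{0..<n} \<subseteq> I" "n \<in> I" using that by auto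
    show ?thesis
      unfolding \<tau>_def
      by (intro borel_measurable_times_ennreal J_meas n measurable_compose[OF borel_measurable_holding measurable_ennreal])
  qed
  have step: "a (Suc n) + (\<integral>\<^sup>+\<omega>. \<tau> n \<omega> \<partial>law) \<le> a n" for n
  proof -
    let ?f = "\<lambda>\<omega>. ennreal (hit Od (fst (step (st \<omega> n) (fst (\<omega> n))))) * J n \<omega>"
    have f_meas: "?f \<in> borel_measurable (PiM I (\<lambda>_. event_space))" if "{0..n} \<subseteq> I" for I
    proof -
      have "{0..<n} \<subseteq> I" using that by auto
      then show ?thesis
        by (intro borel_measurable_times_ennreal J_meas
            borel_measurable_state_label[OF that, of "\<lambda>x e. ennreal (hit Od (fst (step x e)))"])
    qed
    have st_upd: "st (fun_upd \<omega> n z) k = st \<omega> k" if "k \<le> n" for \<omega> z k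
      using that by (intro state_before_cong) auto
    then have J_upd: "J n (fun_upd \<omega> n z) = J n \<omega>" for \<omega> z
      by (simp add: J_def)
    have local: "?f (restrict \<omega> {0..<Suc n}) + \<tau> n (restrict \<omega> {0..<Suc n}) = ?f \<omega> + \<tau> n \<omega>" for \<omega>
    proof -
      have "st (restrict \<omega> {0..<Suc n}) k = st \<omega> k" if "k \<le> n" for k
        using that by (intro state_before_cong) auto
      then show ?thesis
        by (simp add: \<tau>_def J_def)
    qed
    have "?f \<in> borel_measurable law" "\<tau> n \<in> borel_measurable law"
      unfolding measurable_law_iff by (rule f_meas \<tau>_meas; simp)+
    then have "(\<integral>\<^sup>+\<omega>. ?f \<omega> + \<tau> n \<omega> \<partial>law) = (\<integral>\<^sup>+\<omega>. ?f \<omega> \<partial>law) + (\<integral>\<^sup>+\<omega>. \<tau> n \<omega> \<partial>law)"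
      by (rule nn_integral_add)
    then have "a (Suc n) + (\<integral>\<^sup>+\<omega>. \<tau> n \<omega> \<partial>law) = (\<integral>\<^sup>+\<omega>. ?f \<omega> + \<tau> n \<omega> \<partial>law)"
      by (simp add: a_def)
    also have "\<dots> = (\<integral>\<^sup>+\<omega>. (\<integral>\<^sup>+z. ?f (fun_upd \<omega> n z) + \<tau> n (fun_upd \<omega> n z) \<partial>jump (st \<omega> n)) \<partial>law)"
    proof (rule nn_integral_network_Suc)
      show "?f (restrict \<omega> {0..<Suc n}) + \<tau> n (restrict \<omega> {0..<Suc n}) = ?f \<omega> + \<tau> n \<omega>" for \<omega>
        by (rule local)
      have "?f \<in> borel_measurable (PiM {0..<Suc n} (\<lambda>_. event_space))"
        "\<tau> n \<in> borel_measurable (PiM {0..<Suc n} (\<lambda>_. event_space))"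
        by (rule f_meas \<tau>_meas; simp add: atLeastLessThanSuc_atLeastAtMost)+
      then show "(\<lambda>\<omega>. ?f \<omega> + \<tau> n \<omega>) \<in> borel_measurable (PiM {0..<Suc n} (\<lambda>_. event_space))"
        by (rule borel_measurable_add)
    qed
    also have "\<dots> \<le> (\<integral>\<^sup>+\<omega>. ennreal (hit Od (fst (st \<omega> n))) * (if n = 0 then 1 else J (n - 1) \<omega>) \<partial>law)"
    proof (rule nn_integral_mono_AE)
      show "AE \<omega> in law. (\<integral>\<^sup>+z. ?f (fun_upd \<omega> n z) + \<tau> n (fun_upd \<omega> n z) \<partial>jump (st \<omega> n)) \<le>
          ennreal (hit Od (fst (st \<omega> n))) * (if n = 0 then 1 else J (n - 1) \<omega>)"
        using AE_invariant
      proof eventually_elim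
        case (elim \<omega>)
        show ?case
        proof (cases "\<forall>k\<le>n. fst (st \<omega> k) \<noteq> Od")
          case True
          then have J: "J n \<omega> = 1" "J (n - 1) \<omega> = 1"
            by (auto simp: J_def)
          have "(\<integral>\<^sup>+z. ?f (fun_upd \<omega> n z) + \<tau> n (fun_upd \<omega> n z) \<partial>jump (st \<omega> n)) =
              ennreal (hit Od (fst (st \<omega> n)))"
            using expected_hit_step[of "st \<omega> n"] elim True unfolding \<tau>_def J_upd st_upd[OF le_refl] J by simp
          then show ?thesis
            by (simp only: J if_cancel mult_1_right order_refl)
        next
          case False
          then have "J n \<omega> = 0"
            by (auto simp: J_def)
          then show ?thesis
            unfolding \<tau>_def J_upd by simp
        qed
      qed
    qed
    finally show ?thesis
      by (simp add: a_def)
  qed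
  have sum: "a n + (\<Sum>k<n. \<integral>\<^sup>+\<omega>. \<tau> k \<omega> \<partial>law) \<le> ennreal max_hit" for n
  proof (induction n)
    case 0
    then show ?case
      using s by (simp add: a_def max_hit_def N.emeasure_space_1)
  next
    case (Suc n)
    have "a (Suc n) + (\<Sum>k<Suc n. \<integral>\<^sup>+\<omega>. \<tau> k \<omega> \<partial>law) =
        (a (Suc n) + (\<integral>\<^sup>+\<omega>. \<tau> n \<omega> \<partial>law)) + (\<Sum>k<n. \<integral>\<^sup>+\<omega>. \<tau> k \<omega> \<partial>law)"
      by (simp add: ac_simps)
    also have "\<dots> \<le> a n + (\<Sum>k<n. \<integral>\<^sup>+\<omega>. \<tau> k \<omega> \<partial>law)"
      by (intro add_right_mono step)
    finally show ?case
      using Suc by (rule order.trans)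
  qed
  have "(\<integral>\<^sup>+\<omega>. hitting_time s Od \<omega> \<partial>law) \<le> (\<integral>\<^sup>+\<omega>. (\<Sum>n. \<tau> n \<omega>) \<partial>law)"
    using AE_hitting_time_le[OF s] unfolding \<tau>_def J_def by (rule nn_integral_mono_AE)
  also have "\<dots> = (\<Sum>n. \<integral>\<^sup>+\<omega>. \<tau> n \<omega> \<partial>law)"
    using \<tau>_meas[of _ UNIV] by (intro nn_integral_suminf) (simp add: measurable_law_iff)
  also have "\<dots> \<le> ennreal max_hit"
  proof (rule suminf_le_const)
    show "(\<Sum>k<n. \<integral>\<^sup>+\<omega>. \<tau> k \<omega> \<partial>law) \<le> ennreal max_hit" for n
      using sum[of n] by (rule order.trans[rotated]) (simp add: add_increasing)
  qed auto
  finally show ?thesis .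
qed

end

subsection \<open>Delays along a path\<close>

text \<open>The elements counted on the right include the \<open>k\<close> largest ones of
  \<open>B\<close>, or all of them if there are fewer. Applied to arrivals, these are the most
  recent ones, which under service in order of arrival are those still waiting.\<close>

lemma card_top_elements:
  fixes B :: "'a :: linorder set"
  assumes "finite B"
  shows "min k (card B) \<le> card {n \<in> B. card {m \<in> B. n \<le> m} \<le> k}"
  using assms
proof (induction B rule: finite_linorder_min_induct)
  case (insert b A)
  have eq: "{m \<in> insert b A. n \<le> m} = {m \<in> A. n \<le> m}" if "n \<in> A" for n
    using insert.hyps that by auto
  have b: "b \<notin> A" "{m \<in> insert b A. b \<le> m} = insert b A"
    using insert.hyps by auto
  have sub: "{n \<in> A. card {m \<in> A. n \<le> m} \<le> k} \<subseteq> {n \<in> insert b A. card {m \<in> insert b A. n \<le> m} \<le> k}"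
    using eq by auto
  show ?case
  proof (cases "card A < k")
    case True
    then have "insert b A \<subseteq> {n \<in> insert b A. card {m \<in> insert b A. n \<le> m} \<le> k}"
    proof -
      have "card {m \<in> insert b A. n \<le> m} \<le> k" for n
      proof -
        have "card {m \<in> insert b A. n \<le> m} \<le> card (insert b A)"
          using insert.hyps by (intro card_mono) auto
        then show ?thesis using True b(1) insert.hyps by simp
      qed
      then show ?thesis by blast
    qed
    then show ?thesis
      using insert.hyps by (intro order.trans[OF min.cobounded2] card_mono) auto
  next
    case False
    then have "k \<le> card {n \<in> A. card {m \<in> A. n \<le> m} \<le> k}"
      using insert.IH by simp
    also have "\<dots> \<le> card {n \<in> insert b A. card {m \<in> insert b A. n \<le> m} \<le> k}"
      using insert.hyps sub by (intro card_mono) auto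
    finally show ?thesis by simp
  qed
qed simp

lemma le_enumerate_if_card_le:
  fixes S :: "nat set"
  assumes "infinite S" "card {m \<in> S. m < j} \<le> q"
  shows "j \<le> enumerate S q"
proof (rule ccontr)
  assume "\<not> j \<le> enumerate S q"
  then have "enumerate S k < j" if "k \<le> q" for k
    using that enumerate_mono[OF _ assms(1), of k q] by (cases "k = q") auto
  then have "enumerate S ` {..q} \<subseteq> {m \<in> S. m < j}"
    using enumerate_in_set[OF assms(1)] by auto
  then have "card (enumerate S ` {..q}) \<le> card {m \<in> S. m < j}"
    by (intro card_mono) auto
  also have "card (enumerate S ` {..q}) = Suc q"
    using inj_enumerate[OF assms(1)] by (subst card_image) (auto intro: inj_on_subset)
  finally show False
    using assms(2) by simp
qed

lemma enumerate_image_lessThan: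
  fixes S :: "nat set"
  assumes "infinite S"
  shows "enumerate S ` {..<n} = {m \<in> S. m < enumerate S n}"
proof (intro equalityI subsetI)
  fix m assume "m \<in> enumerate S ` {..<n}"
  then show "m \<in> {m \<in> S. m < enumerate S n}"
    using assms enumerate_in_set enumerate_mono by auto
next
  fix m assume m: "m \<in> {m \<in> S. m < enumerate S n}"
  then obtain k where k: "enumerate S k = m"
    using enumerate_Ex[of S m] assms by blast
  then have "k < n"
    using m enumerate_mono[OF _ assms, of n k] by (cases n k rule: linorder_cases) auto
  then show "m \<in> enumerate S ` {..<n}"
    using k by auto
qed

section \<open>Packet conservation and service in order of arrival\<close>

abbreviation arrivals_at :: "path \<Rightarrow> node \<Rightarrow> nat set" where
  "arrivals_at \<omega> i \<equiv> {n. fst (\<omega> n) = Arrival i}"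

text \<open>\<open>starts\<close> contains only the transitions that find a nonempty queue, so the
  truncated subtraction removes exactly one packet at each start and none at a dummy.\<close>

lemma queue_balance:
  assumes "n \<le> j"
  shows "snd (state_before s \<omega> j) i + card {m \<in> starts s \<omega> i. n \<le> m \<and> m < j} =
    snd (state_before s \<omega> n) i + card {m \<in> arrivals_at \<omega> i. n \<le> m \<and> m < j}"
  using assms
proof (induction j rule: dec_induct)
  case base
  have empty: "{m \<in> A. n \<le> m \<and> m < n} = {}" for A :: "nat set"
    by auto
  show ?case
    unfolding empty by simp
next
  case (step j)
  have Suc: "card {m \<in> A. n \<le> m \<and> m < Suc j} = card {m \<in> A. n \<le> m \<and> m < j} + of_bool (j \<in> A)" for A :: "nat set"
  proof -
    have "{m \<in> A. n \<le> m \<and> m < Suc j} =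
        (if j \<in> A then insert j {m \<in> A. n \<le> m \<and> m < j} else {m \<in> A. n \<le> m \<and> m < j})"
      using step.hyps by (auto simp: less_Suc_eq)
    then show ?thesis by simp
  qed
  obtain x q where xq: "state_before s \<omega> j = (x, q)" by fastforce
  have "snd (state_before s \<omega> (Suc j)) i + of_bool (j \<in> starts s \<omega> i) = q i + of_bool (fst (\<omega> j) = Arrival i)"
    by (cases "fst (\<omega> j)") (auto simp: starts_def xq)
  then show ?case
    using step.IH unfolding Suc xq by simp
qed

text \<open>After a supposed last start, the next arrival makes the queue positive and nothing can
  empty it, so the next service of \<open>i\<close> is again a genuine start.\<close>

lemma infinite_starts:
  assumes arr: "infinite (arrivals_at \<omega> i)"
    and act: "infinite {n. fst (\<omega> n) \<in> {Activation i, Completion_Continue i}}"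
  shows "infinite (starts s \<omega> i)"
proof
  assume fin: "finite (starts s \<omega> i)"
  then obtain N where N: "\<And>m. m \<in> starts s \<omega> i \<Longrightarrow> m < N"
    by (metis finite_nat_set_iff_bounded)
  obtain n where n: "n > N" "fst (\<omega> n) = Arrival i"
    using arr unfolding infinite_nat_iff_unbounded by auto
  obtain j where j: "j > n" "fst (\<omega> j) \<in> {Activation i, Completion_Continue i}"
    using act unfolding infinite_nat_iff_unbounded by auto
  have empty: "{m \<in> starts s \<omega> i. n \<le> m \<and> m < j} = {}"
    using N n by fastforce
  have "card {n} \<le> card {m \<in> arrivals_at \<omega> i. n \<le> m \<and> m < j}"
    using n j by (intro card_mono) auto
  then have "snd (state_before s \<omega> j) i > 0"
    using queue_balance[of n j s \<omega> i] j unfolding empty by simp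
  then have "j \<in> starts s \<omega> i"
    using j by (simp add: starts_def)
  with N n j show False
    by fastforce
qed

text \<open>Take one of the latest arrivals, as many as the queue holds at \<open>j\<close>. By
  conservation, the starts between it and \<open>j\<close> are at most the packets it found waiting,
  so its own turn has not come before \<open>j\<close>. The minimum is there because part of the
  queue may stem from the initial state.\<close>

lemma card_waiting_ge:
  assumes "infinite (starts s \<omega> i)"
  shows "min (snd (state_before s \<omega> j) i) (card {n \<in> arrivals_at \<omega> i. n < j}) \<le>
    card {n \<in> arrivals_at \<omega> i. n < j \<and> j \<le> start_index s \<omega> n}"
proof -
  let ?k = "snd (state_before s \<omega> j) i"
  let ?B = "{n \<in> arrivals_at \<omega> i. n < j}"
  have "{n \<in> ?B. card {m \<in> ?B. n \<le> m} \<le> ?k} \<subseteq> {n \<in> arrivals_at \<omega> i. n < j \<and> j \<le> start_index s \<omega> n}"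
  proof
    fix n assume "n \<in> {n \<in> ?B. card {m \<in> ?B. n \<le> m} \<le> ?k}"
    then have n: "fst (\<omega> n) = Arrival i" "n < j" "card {m \<in> ?B. n \<le> m} \<le> ?k"
      by auto
    let ?S = "{m \<in> starts s \<omega> i. n < m}"
    have eq: "{m \<in> ?B. n \<le> m} = {m \<in> arrivals_at \<omega> i. n \<le> m \<and> m < j}"
      by auto
    have "n \<notin> starts s \<omega> i"
      using n by (simp add: starts_def)
    then have "n \<le> m \<longleftrightarrow> n < m" if "m \<in> starts s \<omega> i" for m
      using that by (cases "m = n") auto
    then have "{m \<in> starts s \<omega> i. n \<le> m \<and> m < j} = {m \<in> ?S. m < j}"
      by blast
    then have "card {m \<in> ?S. m < j} \<le> snd (state_before s \<omega> n) i"
      using queue_balance[of n j s \<omega> i] n(2,3) unfolding eq by simp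
    moreover have "infinite ?S"
    proof -
      have "starts s \<omega> i \<subseteq> ?S \<union> {..n}"
        by auto
      then show ?thesis
        using assms finite_subset by blast
    qed
    ultimately have "j \<le> enumerate ?S (snd (state_before s \<omega> n) i)"
      by (intro le_enumerate_if_card_le)
    then show "n \<in> {n \<in> arrivals_at \<omega> i. n < j \<and> j \<le> start_index s \<omega> n}"
      using n by (simp add: start_index_def)
  qed
  then have "card {n \<in> ?B. card {m \<in> ?B. n \<le> m} \<le> ?k} \<le> card {n \<in> arrivals_at \<omega> i. n < j \<and> j \<le> start_index s \<omega> n}"
    by (intro card_mono) auto
  with card_top_elements[of ?B ?k] show ?thesis
    by simp
qed

text \<open>Only the waiting part of the delay is kept. The holding time \<open>j\<close> precedes
  transition \<open>j\<close>, so waiting covers the indices in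
  \<open>n < j \<le> start_index\<close>, and the departure comes strictly later.\<close>

lemma delay_ge:
  assumes pos: "\<And>n. snd (\<omega> n) > 0" and comp: "infinite (completions \<omega> i)"
    and starts: "infinite (starts s \<omega> i)"
    and n: "fst (\<omega> n) = Arrival i"
  shows "event_time \<omega> (departure_index s \<omega> n) - event_time \<omega> n \<ge>
    (\<Sum>j<N. snd (\<omega> j) * of_bool (n < j \<and> j \<le> start_index s \<omega> n))"
proof -
  let ?d = "departure_index s \<omega> n" and ?b = "start_index s \<omega> n"
  obtain m where "m > ?b" "m \<in> completions \<omega> i"
    using comp unfolding infinite_nat_iff_unbounded by auto
  then have "m \<in> completions \<omega> (event_node (fst (\<omega> n))) \<and> ?b < m"
    by (simp add: n)
  from LeastI[of "\<lambda>m. m \<in> completions \<omega> (event_node (fst (\<omega> n))) \<and> ?b < m", OF this]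
  have d: "?b < ?d"
    unfolding departure_index_def by (rule conjunct2)
  have "starts s \<omega> i \<subseteq> {m \<in> starts s \<omega> i. n < m} \<union> {..n}"
    by auto
  then have "infinite {m \<in> starts s \<omega> i. n < m}"
    using starts finite_subset by blast
  then have "enumerate {m \<in> starts s \<omega> i. n < m} (snd (state_before s \<omega> n) i) \<in> {m \<in> starts s \<omega> i. n < m}"
    by (rule enumerate_in_set)
  then have S: "?b \<ge> n"
    by (simp add: start_index_def n)
  have "(\<Sum>j<N. snd (\<omega> j) * of_bool (n < j \<and> j \<le> ?b)) = (\<Sum>j\<in>{..<N} \<inter> {n<..?b}. snd (\<omega> j))"
    by (intro sum.mono_neutral_cong_right) auto
  also have "\<dots> \<le> (\<Sum>j\<in>{n<..?d}. snd (\<omega> j))"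
    using d pos by (intro sum_mono2) (auto intro: less_imp_le)
  also have "\<dots> = event_time \<omega> ?d - event_time \<omega> n"
  proof -
    have "n \<le> ?d" using S d by simp
    then have "{..?d} = {..n} \<union> {n<..?d}" by auto
    then have "event_time \<omega> ?d = (\<Sum>k\<in>{..n} \<union> {n<..?d}. snd (\<omega> k))"
      by (simp only: event_time_def)
    also have "\<dots> = event_time \<omega> n + (\<Sum>k\<in>{n<..?d}. snd (\<omega> k))"
      unfolding event_time_def by (rule sum.union_disjoint) auto
    finally show ?thesis by simp
  qed
  finally show ?thesis .
qed

text \<open>One half of Little's law: waiting times up to the n-th arrival are counted once by
  packet and once by time. Packets waiting before that instant are among the first \<open>n\<close>
  arrivals, and their delays dominate the part of the wait seen so far.\<close>

lemma sum_delay_ge: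
  assumes pos: "\<And>n. snd (\<omega> n) > 0"
    and nodes: "\<And>n i. fst (\<omega> n) = Arrival i \<Longrightarrow> i \<in> nodes L"
    and inf: "infinite (arrivals \<omega>)" "\<And>i. i \<in> nodes L \<Longrightarrow> infinite (starts s \<omega> i)"
      "\<And>i. i \<in> nodes L \<Longrightarrow> infinite (completions \<omega> i)"
  shows "delay s \<omega> k \<ge> 0"
    and "(\<Sum>k<n. delay s \<omega> k) \<ge> (\<Sum>j<enumerate (arrivals \<omega>) n. snd (\<omega> j) *
      (\<Sum>i\<in>nodes L. real (card {a \<in> arrivals_at \<omega> i. a < j \<and> j \<le> start_index s \<omega> a})))"
proof -
  define D where "D a = event_time \<omega> (departure_index s \<omega> a) - event_time \<omega> a" for a
  have delay: "delay s \<omega> k = D (enumerate (arrivals \<omega>) k)" for k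
    by (simp add: delay_def D_def Let_def)
  have D: "(\<Sum>j<N. snd (\<omega> j) * of_bool (a < j \<and> j \<le> start_index s \<omega> a)) \<le> D a"
    if a: "a \<in> arrivals \<omega>" for a N
  proof -
    obtain i where i: "fst (\<omega> a) = Arrival i"
      using a unfolding arrivals_def by blast
    show ?thesis
      unfolding D_def
      by (rule delay_ge, rule pos, rule inf(3)[OF nodes[OF i]], rule inf(2)[OF nodes[OF i]], rule i)
  qed
  show "delay s \<omega> k \<ge> 0"
    using D[OF enumerate_in_set[OF inf(1), of k], of 0] by (simp add: delay)
  define M where "M = enumerate (arrivals \<omega>) n"
  define T where "T = {a \<in> arrivals \<omega>. a < M}"
  have finT: "finite T"
    by (simp add: T_def)
  have "(\<Sum>j<M. snd (\<omega> j) * (\<Sum>i\<in>nodes L. real (card {a \<in> arrivals_at \<omega> i. a < j \<and> j \<le> start_index s \<omega> a})))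
      = (\<Sum>j<M. snd (\<omega> j) * (\<Sum>a\<in>T. of_bool (a < j \<and> j \<le> start_index s \<omega> a)))"
  proof (intro sum.cong refl arg_cong2[where f = "(*)"])
    fix j assume j: "j \<in> {..<M}"
    have "T \<inter> {a. a < j \<and> j \<le> start_index s \<omega> a} =
        (\<Union>i\<in>nodes L. {a \<in> arrivals_at \<omega> i. a < j \<and> j \<le> start_index s \<omega> a})"
    proof (intro equalityI subsetI)
      fix a assume a: "a \<in> T \<inter> {a. a < j \<and> j \<le> start_index s \<omega> a}"
      then obtain i where i: "fst (\<omega> a) = Arrival i"
        unfolding T_def arrivals_def by blast
      then show "a \<in> (\<Union>i\<in>nodes L. {a \<in> arrivals_at \<omega> i. a < j \<and> j \<le> start_index s \<omega> a})"
        using a nodes[OF i] by blast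
    next
      fix a assume "a \<in> (\<Union>i\<in>nodes L. {a \<in> arrivals_at \<omega> i. a < j \<and> j \<le> start_index s \<omega> a})"
      then have "a \<in> arrivals \<omega>" "a < j" "j \<le> start_index s \<omega> a"
        unfolding arrivals_def by blast+
      then show "a \<in> T \<inter> {a. a < j \<and> j \<le> start_index s \<omega> a}"
        using j by (simp add: T_def)
    qed
    then have "card (T \<inter> {a. a < j \<and> j \<le> start_index s \<omega> a}) =
        (\<Sum>i\<in>nodes L. card {a \<in> arrivals_at \<omega> i. a < j \<and> j \<le> start_index s \<omega> a})"
      by (simp only:) (rule card_UN_disjoint, simp_all add: finite_nodes disjoint_iff)
    then show "(\<Sum>i\<in>nodes L. real (card {a \<in> arrivals_at \<omega> i. a < j \<and> j \<le> start_index s \<omega> a})) =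
        (\<Sum>a\<in>T. of_bool (a < j \<and> j \<le> start_index s \<omega> a))"
      using finT by (simp flip: of_nat_sum)
  qed
  also have "\<dots> = (\<Sum>a\<in>T. \<Sum>j<M. snd (\<omega> j) * of_bool (a < j \<and> j \<le> start_index s \<omega> a))"
    unfolding sum_distrib_left by (rule sum.swap)
  also have "\<dots> \<le> (\<Sum>a\<in>T. D a)"
    using D by (intro sum_mono) (simp add: T_def)
  also have "T = enumerate (arrivals \<omega>) ` {..<n}"
    using enumerate_image_lessThan[OF inf(1), of n] by (simp add: T_def M_def)
  also have "(\<Sum>a\<in>enumerate (arrivals \<omega>) ` {..<n}. D a) = (\<Sum>k<n. delay s \<omega> k)"
    using inj_enumerate[OF inf(1)] by (subst sum.reindex) (auto simp: delay intro: inj_on_subset)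
  finally show "(\<Sum>k<n. delay s \<omega> k) \<ge> (\<Sum>j<enumerate (arrivals \<omega>) n. snd (\<omega> j) *
      (\<Sum>i\<in>nodes L. real (card {a \<in> arrivals_at \<omega> i. a < j \<and> j \<le> start_index s \<omega> a})))"
    by (simp only: M_def)
qed

lemma eventually_card_ge:
  fixes S :: "nat set"
  assumes "infinite S"
  shows "\<forall>\<^sub>F j in sequentially. K \<le> card {a \<in> S. a < j}"
proof -
  obtain T where T: "T \<subseteq> S" "finite T" "card T = K"
    using infinite_arbitrarily_large[OF assms] by blast
  then obtain N where N: "\<And>a. a \<in> T \<Longrightarrow> a < N"
    by (metis finite_nat_set_iff_bounded)
  show ?thesis
  proof (rule eventually_sequentiallyI[of N])
    fix j assume "N \<le> j"
    then have "T \<subseteq> {a \<in> S. a < j}"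
      using T N by fastforce
    then have "card T \<le> card {a \<in> S. a < j}"
      by (intro card_mono) auto
    then show "K \<le> card {a \<in> S. a < j}"
      using T by simp
  qed
qed

text \<open>The n-th arrival occurs at about time \<open>n / \<Lambda>\<close>. Until then the
  queues have accumulated at least about \<open>card (nodes L) * c\<close> times this duration of
  waiting, and division by \<open>n\<close> gives the bound.\<close>

lemma average_delay_ge:
  assumes pos: "\<And>n. snd (\<omega> n) > 0"
    and nodes: "\<And>n i. fst (\<omega> n) = Arrival i \<Longrightarrow> i \<in> nodes L"
    and inf: "infinite (arrivals \<omega>)" "\<And>i. i \<in> nodes L \<Longrightarrow> infinite (arrivals_at \<omega> i)"
      "\<And>i. i \<in> nodes L \<Longrightarrow> infinite (starts s \<omega> i)"
      "\<And>i. i \<in> nodes L \<Longrightarrow> infinite (completions \<omega> i)"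
    and lim: "(\<lambda>m. (\<Sum>k<m. of_bool (k \<in> arrivals \<omega>)) / (\<Sum>k<m. snd (\<omega> k))) \<longlonglongrightarrow> \<Lambda>" and \<Lambda>: "\<Lambda> > 0"
    and avg: "\<And>i. i \<in> nodes L \<Longrightarrow> \<forall>\<^sub>F n in sequentially.
      (\<Sum>k<n. snd (\<omega> k) * real (min (snd (state_before s \<omega> k) i) K)) / (\<Sum>k<n. snd (\<omega> k)) \<ge> c"
  shows "average_delay s \<omega> \<ge> ennreal (real (card (nodes L)) * c / \<Lambda>)"
proof -
  define M where "M = enumerate (arrivals \<omega>)"
  define el where "el n = (\<Sum>k<n. snd (\<omega> k))" for n
  define q where "q i j = real (min (snd (state_before s \<omega> j) i) K)" for i j
  define W where "W j = (\<Sum>i\<in>nodes L. real (card {a \<in> arrivals_at \<omega> i. a < j \<and> j \<le> start_index s \<omega> a}))" for j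
  define cV where "cV = real (card (nodes L))"
  have M_top: "filterlim M at_top sequentially"
    unfolding M_def
    by (rule filterlim_at_top_mono[OF filterlim_ident]) (simp add: le_enumerate[OF inf(1)])
  have "\<forall>\<^sub>F j in sequentially. \<forall>i\<in>nodes L. K \<le> card {a \<in> arrivals_at \<omega> i. a < j}"
    using inf(2) by (intro eventually_ball_finite finite_nodes ballI eventually_card_ge)
  \<comment> \<open>From \<open>j0\<close> on every node has had \<open>K\<close> arrivals, so the
    capped queue length is accounted for by arrived packets despite an initial queue. The earlier
    period costs a fixed amount \<open>C0\<close>, which vanishes after division by
    \<open>n\<close>.\<close>
  then obtain j0 where j0: "\<And>j i. j0 \<le> j \<Longrightarrow> i \<in> nodes L \<Longrightarrow> K \<le> card {a \<in> arrivals_at \<omega> i. a < j}"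
    unfolding eventually_sequentially by blast
  have W: "(\<Sum>i\<in>nodes L. q i j) - cV * real K * of_bool (j < j0) \<le> W j" for j
  proof (cases "j < j0")
    case True
    have "(\<Sum>i\<in>nodes L. q i j) \<le> cV * real K"
      unfolding cV_def by (rule sum_bounded_above) (simp add: q_def)
    moreover have "W j \<ge> 0"
      unfolding W_def by (intro sum_nonneg) simp
    ultimately show ?thesis
      using True by simp
  next
    case False
    have "(\<Sum>i\<in>nodes L. q i j) \<le> W j"
      unfolding W_def
    proof (rule sum_mono)
      fix i assume i: "i \<in> nodes L"
      have "min (snd (state_before s \<omega> j) i) K \<le>
          min (snd (state_before s \<omega> j) i) (card {n \<in> arrivals_at \<omega> i. n < j})"
        using j0[of j i] False i by simp
      also have "\<dots> \<le> card {a \<in> arrivals_at \<omega> i. a < j \<and> j \<le> start_index s \<omega> a}"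
        by (rule card_waiting_ge[OF inf(3)[OF i]])
      finally show "q i j \<le> real (card {a \<in> arrivals_at \<omega> i. a < j \<and> j \<le> start_index s \<omega> a})"
        unfolding q_def by (rule of_nat_mono)
    qed
    then show ?thesis
      using False by simp
  qed
  define C0 where "C0 = cV * real K * el j0"
  have lower: "(\<Sum>j<m. snd (\<omega> j) * W j) \<ge> (\<Sum>i\<in>nodes L. \<Sum>j<m. snd (\<omega> j) * q i j) - C0" for m
  proof -
    have "(\<Sum>j<m. snd (\<omega> j) * of_bool (j < j0)) = (\<Sum>j\<in>{..<m} \<inter> {..<j0}. snd (\<omega> j))"
      by (intro sum.mono_neutral_cong_right) auto
    also have "\<dots> \<le> el j0"
      unfolding el_def using pos by (intro sum_mono2) (auto intro: less_imp_le)
    finally have le: "cV * real K * (\<Sum>j<m. snd (\<omega> j) * of_bool (j < j0)) \<le> C0"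
      unfolding C0_def by (intro mult_left_mono) (auto simp: cV_def)
    have "(\<Sum>j<m. snd (\<omega> j) * ((\<Sum>i\<in>nodes L. q i j) - cV * real K * of_bool (j < j0))) \<le> (\<Sum>j<m. snd (\<omega> j) * W j)"
      using pos W by (intro sum_mono mult_left_mono) (auto intro: less_imp_le)
    also have "(\<Sum>j<m. snd (\<omega> j) * ((\<Sum>i\<in>nodes L. q i j) - cV * real K * of_bool (j < j0))) =
        (\<Sum>j<m. \<Sum>i\<in>nodes L. snd (\<omega> j) * q i j) - cV * real K * (\<Sum>j<m. snd (\<omega> j) * of_bool (j < j0))"
    proof -
      have "snd (\<omega> j) * ((\<Sum>i\<in>nodes L. q i j) - cV * real K * of_bool (j < j0)) =
          (\<Sum>i\<in>nodes L. snd (\<omega> j) * q i j) - cV * real K * (snd (\<omega> j) * of_bool (j < j0))" for j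
        by (simp only: right_diff_distrib sum_distrib_left mult.left_commute)
      then show ?thesis
        by (simp only: sum_subtractf sum_distrib_left)
    qed
    also have "(\<Sum>j<m. \<Sum>i\<in>nodes L. snd (\<omega> j) * q i j) = (\<Sum>i\<in>nodes L. \<Sum>j<m. snd (\<omega> j) * q i j)"
      by (rule sum.swap)
    finally show ?thesis
      using le by linarith
  qed
  have "\<forall>\<^sub>F m in sequentially. \<forall>i\<in>nodes L. (\<Sum>k<m. snd (\<omega> k) * q i k) / el m \<ge> c"
    unfolding q_def el_def using avg by (intro eventually_ball_finite finite_nodes ballI)
  then have "\<forall>\<^sub>F m in sequentially. (\<Sum>j<m. snd (\<omega> j) * W j) \<ge> cV * (c * el m) - C0"
    using eventually_gt_at_top[of 0]
  proof eventually_elim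
    case (elim m)
    then have "el m > 0"
      unfolding el_def using pos by (intro sum_pos) auto
    then have "c * el m \<le> (\<Sum>k<m. snd (\<omega> k) * q i k)" if "i \<in> nodes L" for i
      using elim(1) that by (simp add: le_divide_eq)
    then have "cV * (c * el m) \<le> (\<Sum>i\<in>nodes L. \<Sum>j<m. snd (\<omega> j) * q i j)"
      unfolding cV_def by (rule sum_bounded_below)
    with lower[of m] show ?case by linarith
  qed
  then have "\<forall>\<^sub>F n in sequentially. (\<Sum>j<M n. snd (\<omega> j) * W j) \<ge> cV * (c * el (M n)) - C0"
    by (rule eventually_compose_filterlim[OF _ M_top])
  then have "\<forall>\<^sub>F n in sequentially. ennreal ((cV * c) * (el (M n) / real n) - C0 / real n) \<le>
      (\<Sum>k<n. ennreal (delay s \<omega> k)) / of_nat n"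
    using eventually_gt_at_top[of 0]
  proof eventually_elim
    case (elim n)
    have delay: "delay s \<omega> k \<ge> 0" "(\<Sum>j<M n. snd (\<omega> j) * W j) \<le> (\<Sum>k<n. delay s \<omega> k)" for k
      unfolding M_def W_def using pos nodes inf
      by (rule_tac [!] sum_delay_ge[where L = L]) blast+
    have "cV * (c * el (M n)) - C0 \<le> (\<Sum>k<n. delay s \<omega> k)"
      using elim(1) delay(2) by linarith
    then have "(cV * (c * el (M n)) - C0) / real n \<le> (\<Sum>k<n. delay s \<omega> k) / real n"
      by (rule divide_right_mono) simp
    then have "(cV * c) * (el (M n) / real n) - C0 / real n \<le> (\<Sum>k<n. delay s \<omega> k) / real n"
      by (simp add: diff_divide_distrib mult.assoc)
    then have "ennreal ((cV * c) * (el (M n) / real n) - C0 / real n) \<le> ennreal ((\<Sum>k<n. delay s \<omega> k) / real n)"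
      by (rule ennreal_leI)
    also have "\<dots> = ennreal (\<Sum>k<n. delay s \<omega> k) / ennreal (real n)"
      using elim delay(1) by (intro divide_ennreal[symmetric] sum_nonneg) auto
    also have "\<dots> = (\<Sum>k<n. ennreal (delay s \<omega> k)) / of_nat n"
      using delay(1) by (simp add: sum_ennreal ennreal_of_nat_eq_real_of_nat)
    finally show ?case .
  qed
  then have "liminf (\<lambda>n. ennreal ((cV * c) * (el (M n) / real n) - C0 / real n)) \<le> average_delay s \<omega>"
    unfolding average_delay_def by (rule Liminf_mono)
  moreover have "(\<lambda>n. (cV * c) * (el (M n) / real n) - C0 / real n) \<longlonglongrightarrow> cV * c * inverse \<Lambda> - 0"
  proof (intro tendsto_diff tendsto_mult tendsto_const)
    have "(\<lambda>n. (\<Sum>k<M n. of_bool (k \<in> arrivals \<omega>)) / el (M n)) \<longlonglongrightarrow> \<Lambda>"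
      using filterlim_compose[OF lim M_top] unfolding el_def .
    moreover have "(\<Sum>k<M n. of_bool (k \<in> arrivals \<omega>)) = real n" for n
    proof -
      have "(\<Sum>k<M n. of_bool (k \<in> arrivals \<omega>) :: real) = real (card ({..<M n} \<inter> arrivals \<omega>))"
        by simp
      also have "{..<M n} \<inter> arrivals \<omega> = {k \<in> arrivals \<omega>. k < M n}"
        by blast
      also have "{k \<in> arrivals \<omega>. k < M n} = M ` {..<n}"
        unfolding M_def by (rule enumerate_image_lessThan[OF inf(1), symmetric])
      also have "card (M ` {..<n}) = n"
        unfolding M_def using inj_enumerate[OF inf(1)] by (subst card_image) (auto intro: inj_on_subset)
      finally show ?thesis .
    qed
    ultimately have "(\<lambda>n. inverse (real n / el (M n))) \<longlonglongrightarrow> inverse \<Lambda>"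
      using \<Lambda> by (intro tendsto_inverse) auto
    then show "(\<lambda>n. el (M n) / real n) \<longlonglongrightarrow> inverse \<Lambda>"
      by simp
    show "(\<lambda>n. C0 / real n) \<longlonglongrightarrow> 0"
      by (rule lim_const_over_n)
  qed
  then have "(\<lambda>n. ennreal ((cV * c) * (el (M n) / real n) - C0 / real n)) \<longlonglongrightarrow> ennreal (cV * c / \<Lambda>)"
    by (intro tendsto_ennrealI) (simp add: divide_inverse)
  then have "liminf (\<lambda>n. ennreal ((cV * c) * (el (M n) / real n) - C0 / real n)) = ennreal (cV * c / \<Lambda>)"
    by (rule lim_imp_Liminf[rotated]) simp
  ultimately show ?thesis
    by (simp add: cV_def)
qed

subsection \<open>Comparison of the mean delay with the transition time\<close>

context grid_network
begin

text \<open>Finitely many events would have frequency \<open>0\<close> in time, but this frequency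
  is asymptotic to an average intensity of at least \<open>c\<close>.\<close>

lemma AE_infinite_events:
  assumes c: "c > 0" and lb: "AE \<omega> in law. \<forall>\<^sub>F n in sequentially.
      c \<le> time_avg \<omega> (compensator (\<lambda>_ e. of_bool (e \<in> S))) n"
  shows "AE \<omega> in law. infinite {n. fst (\<omega> n) \<in> S}"
proof -
  have b: "\<bar>of_bool (e \<in> S) :: real\<bar> \<le> 1" for e
    by simp
  show ?thesis
    using AE_compensated[of "\<lambda>_ e. of_bool (e \<in> S)", OF b] lb AE_elapsed_at_top
  proof eventually_elim
    case (elim \<omega>)
    let ?F = "\<lambda>n. \<Sum>k<n. of_bool (fst (\<omega> k) \<in> S) :: real"
    show ?case
    proof
      assume fin: "finite {n. fst (\<omega> n) \<in> S}"
      have le: "?F n \<le> real (card {n. fst (\<omega> n) \<in> S})" for n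
      proof -
        have "?F n = real (card ({..<n} \<inter> {k. fst (\<omega> k) \<in> S}))"
          by simp
        also have "\<dots> \<le> real (card {n. fst (\<omega> n) \<in> S})"
          using fin by (intro of_nat_mono card_mono) auto
        finally show ?thesis .
      qed
      have "(\<lambda>n. real (card {n. fst (\<omega> n) \<in> S}) / elapsed \<omega> n) \<longlonglongrightarrow> 0"
        by (rule real_tendsto_divide_at_top[OF tendsto_const elim(3)])
      then have "\<forall>\<^sub>F n in sequentially. real (card {n. fst (\<omega> n) \<in> S}) / elapsed \<omega> n < c / 2"
        using c by (intro order_tendstoD) auto
      moreover have "\<forall>\<^sub>F n in sequentially. elapsed \<omega> n > 0"
        using elim(3) unfolding filterlim_at_top_dense by blast
      moreover have "\<forall>\<^sub>F n in sequentially. ?F n / elapsed \<omega> n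
          - time_avg \<omega> (compensator (\<lambda>_ e. of_bool (e \<in> S))) n > - c / 2"
        using c by (intro order_tendstoD(1)[OF elim(1)]) simp
      ultimately have "\<forall>\<^sub>F n in sequentially. False"
        using elim(2)
      proof eventually_elim
        case (elim n)
        have "?F n / elapsed \<omega> n \<le> real (card {n. fst (\<omega> n) \<in> S}) / elapsed \<omega> n"
          using elim(2) le by (intro divide_right_mono) auto
        with elim c show False by linarith
      qed
      then show False by simp
    qed
  qed
qed

lemma compensator_arrival:
  assumes "i \<in> V"
  shows "compensator (\<lambda>_ e. of_bool (e \<in> {Arrival i})) y = lam"
proof -
  obtain x q where y: "y = (x, q)" by fastforce
  have "compensator (\<lambda>_ e. of_bool (e \<in> {Arrival i})) y = (\<Sum>j\<in>V. if j = i then lam else 0)"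
    unfolding compensator_def sum_events y by (rule sum.cong) auto
  then show ?thesis
    using assms by simp
qed

lemma compensator_arrivals:
  "compensator (\<lambda>_ e. of_bool (e \<in> range Arrival)) y = lam * real (card V)"
proof -
  obtain x q where y: "y = (x, q)" by fastforce
  have "compensator (\<lambda>_ e. of_bool (e \<in> range Arrival)) y = (\<Sum>j\<in>V. lam)"
    unfolding compensator_def sum_events y by (rule sum.cong) auto
  then show ?thesis
    by simp
qed

lemma compensator_completion:
  assumes "i \<in> V"
  shows "compensator (\<lambda>_ e. of_bool (e \<in> {Completion_Backoff i, Completion_Continue i})) y = mu * of_bool (i \<in> fst y)"
proof -
  obtain x q where y: "y = (x, q)" by fastforce
  have "compensator (\<lambda>_ e. of_bool (e \<in> {Completion_Backoff i, Completion_Continue i})) y =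
      (\<Sum>j\<in>V. if j = i then mu * of_bool (i \<in> x) else 0)"
    unfolding compensator_def sum_events y by (rule sum.cong) (auto simp: algebra_simps)
  then show ?thesis
    using assms by (simp add: y)
qed

lemma AE_infinite_arrivals:
  assumes "i \<in> V"
  shows "AE \<omega> in law. infinite (arrivals_at \<omega> i)"
proof -
  have "AE \<omega> in law. \<forall>\<^sub>F n in sequentially. lam \<le> time_avg \<omega> (compensator (\<lambda>_ e. of_bool (e \<in> {Arrival i}))) n"
    using AE_invariant
  proof eventually_elim
    case (elim \<omega>)
    show ?case
      using eventually_gt_at_top[of 0]
    proof eventually_elim
      case (elim n)
      have "time_avg \<omega> (\<lambda>_. lam) n = lam"
        using \<open>\<forall>n. fst (st \<omega> n) \<in> \<Omega> \<and> rt (st \<omega> n) (fst (\<omega> n)) > 0 \<and> snd (\<omega> n) > 0\<close> elim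
        by (intro time_avg_const) auto
      then show ?case
        by (simp only: compensator_arrival[OF assms])
    qed
  qed
  from AE_infinite_events[OF lam_pos this] show ?thesis
    by simp
qed

lemma AE_infinite_completions:
  assumes i: "i \<in> V"
  shows "AE \<omega> in law. infinite (completions \<omega> i)"
proof -
  obtain A B where AB: "opposite A B" "i \<in> A"
    using i E_O(1) unfolding opposite_def by blast
  \<comment> \<open>Node \<open>i\<close> transmits whenever the state is \<open>A\<close>, whose
    frequency is \<open>1 / inv_prob\<close>; half of this leaves room for the limit.\<close>
  have pos: "mu / (2 * inv_prob) > 0"
    using mu_pos inv_prob_ge by simp
  have "AE \<omega> in law. \<forall>\<^sub>F n in sequentially. mu / (2 * inv_prob) \<le> time_avg \<omega>
      (compensator (\<lambda>_ e. of_bool (e \<in> {Completion_Backoff i, Completion_Continue i}))) n"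
    using AE_invariant AE_time_avg_maximal[OF AB(1)]
  proof eventually_elim
    case (elim \<omega>)
    have "\<forall>\<^sub>F n in sequentially. time_avg \<omega> (\<lambda>y. of_bool (fst y = A)) n > 1 / (2 * inv_prob)"
      using elim(2) inv_prob_ge by (intro order_tendstoD(1)[OF elim(2)]) (simp add: divide_simps)
    then show ?case
    proof eventually_elim
      case (elim n)
      have "mu * time_avg \<omega> (\<lambda>y. of_bool (fst y = A)) n = time_avg \<omega> (\<lambda>y. mu * of_bool (fst y = A) - 0) n"
        by (rule trans[OF _ time_avg_linear[where \<omega> = \<omega> and n = n and c = mu
              and f = "\<lambda>y. of_bool (fst y = A)" and g = "\<lambda>_. 0", symmetric]]) simp
      also have "\<dots> \<le> time_avg \<omega> (\<lambda>y. mu * of_bool (i \<in> fst y)) n"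
        using \<open>\<forall>n. fst (st \<omega> n) \<in> \<Omega> \<and> rt (st \<omega> n) (fst (\<omega> n)) > 0 \<and> snd (\<omega> n) > 0\<close> AB(2) mu_pos
        by (intro time_avg_mono) auto
      finally have "mu * time_avg \<omega> (\<lambda>y. of_bool (fst y = A)) n \<le> time_avg \<omega> (\<lambda>y. mu * of_bool (i \<in> fst y)) n" .
      moreover have "mu * (1 / (2 * inv_prob)) \<le> mu * time_avg \<omega> (\<lambda>y. of_bool (fst y = A)) n"
        using elim mu_pos by (intro mult_left_mono) auto
      ultimately show ?case
        by (simp only: compensator_completion[OF i]) simp
    qed
  qed
  from AE_infinite_events[OF pos this] show ?thesis
    by (simp add: completions_def)
qed

text \<open>With only finitely many activations and continuations, infinitely many completions would
  be back-offs; but after a back-off a node cannot complete again unless it has been activated in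
  between.\<close>

lemma infinite_service_starts:
  assumes rate: "\<And>n. rt (st \<omega> n) (fst (\<omega> n)) > 0" and inf: "infinite (completions \<omega> i)"
  shows "infinite {n. fst (\<omega> n) \<in> {Activation i, Completion_Continue i}}"
proof
  assume fin: "finite {n. fst (\<omega> n) \<in> {Activation i, Completion_Continue i}}"
  then obtain N where N: "\<And>n. fst (\<omega> n) \<in> {Activation i, Completion_Continue i} \<Longrightarrow> n < N"
    unfolding finite_nat_set_iff_bounded by blast
  have ex: "\<exists>n>m. fst (\<omega> n) = Completion_Backoff i" if "m \<ge> N" for m
  proof -
    obtain n where "n > m" "fst (\<omega> n) \<in> {Completion_Backoff i, Completion_Continue i}"
      using inf unfolding infinite_nat_iff_unbounded completions_def by blast
    moreover have "fst (\<omega> n) \<noteq> Completion_Continue i"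
      using N[of n] \<open>n > m\<close> that by auto
    ultimately show ?thesis by auto
  qed
  obtain n where n: "n > N" "fst (\<omega> n) = Completion_Backoff i"
    using ex[of N] by auto
  obtain m where m: "m > n" "fst (\<omega> m) = Completion_Backoff i"
    using ex[of n] n by auto
  have "i \<notin> fst (st \<omega> (Suc n + k))" for k
  proof (induction k)
    case 0
    obtain x q where "st \<omega> n = (x, q)" by fastforce
    then show ?case using n by simp
  next
    case (Suc k)
    obtain x q where xq: "st \<omega> (Suc n + k) = (x, q)" by fastforce
    have "fst (\<omega> (Suc n + k)) \<noteq> Activation i"
      using N[of "Suc n + k"] n by auto
    then show ?case
      using Suc xq by (cases "fst (\<omega> (Suc n + k))") auto
  qed
  from this[of "m - Suc n"] have "i \<notin> fst (st \<omega> m)"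
    using m by simp
  moreover have "rt (st \<omega> m) (Completion_Backoff i) > 0"
    using rate[of m] m by simp
  ultimately show False
    by (cases "st \<omega> m") (simp split: if_splits)
qed

lemma AE_average_delay:
  assumes K: "K > 0" and \<delta>: "\<delta> > 0"
  shows "AE \<omega> in law. average_delay s \<omega> \<ge> ennreal
    (((lam * max_hit / inv_prob - mu * max_hit * (1 - 2 / inv_prob) - (inv_prob - 1)) /
      (1 + lam * max_hit / real K) - 1 - \<delta>) / lam)"
proof -
  define c where "c = (lam * max_hit / inv_prob - mu * max_hit * (1 - 2 / inv_prob) - (inv_prob - 1)) /
      (1 + lam * max_hit / real K) - 1 - \<delta>"
  have queue: "AE \<omega> in law. \<forall>i\<in>V. \<forall>\<^sub>F n in sequentially. time_avg \<omega> (\<lambda>y. real (min (snd y i) K)) n \<ge> c"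
    unfolding AE_finite_all[OF finite_nodes]
  proof
    fix i assume "i \<in> V"
    then obtain A B where "opposite A B" "i \<in> A"
      using E_O(1) unfolding opposite_def by blast
    from AE_time_avg_queue[OF this K \<delta>]
    show "AE \<omega> in law. \<forall>\<^sub>F n in sequentially. time_avg \<omega> (\<lambda>y. real (min (snd y i) K)) n \<ge> c"
      by (simp only: c_def)
  qed
  have arr: "AE \<omega> in law. \<forall>i\<in>V. infinite (arrivals_at \<omega> i)"
    and comp: "AE \<omega> in law. \<forall>i\<in>V. infinite (completions \<omega> i)"
    unfolding AE_finite_all[OF finite_nodes] using AE_infinite_arrivals AE_infinite_completions by blast+
  have b: "\<bar>of_bool (e \<in> range Arrival) :: real\<bar> \<le> 1" for e
    by simp
  show ?thesis
    using queue arr comp AE_invariant AE_compensated[of "\<lambda>_ e. of_bool (e \<in> range Arrival)", OF b]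
  proof eventually_elim
    case (elim \<omega>)
    have pos: "snd (\<omega> n) > 0" for n
      using elim(4) by blast
    have rate: "rt (st \<omega> n) (fst (\<omega> n)) > 0" for n
      using elim(4) by blast
    have nodes: "i \<in> V" if "fst (\<omega> n) = Arrival i" for n i
      using rate[of n] that by (cases "st \<omega> n") (simp split: if_splits)
    have "average_delay s \<omega> \<ge> ennreal (real (card V) * c / (lam * real (card V)))"
    proof (rule average_delay_ge[where K = K])
      show "infinite (arrivals_at \<omega> i)" "infinite (completions \<omega> i)" if "i \<in> V" for i
        using elim(2,3) that by blast+
      then show "infinite (starts s \<omega> i)" if "i \<in> V" for i
        using infinite_service_starts[OF rate] that by (intro infinite_starts) blast+
      obtain i where i: "i \<in> V"
        using card_V_pos by (metis card.empty equals0I less_irrefl)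
      have "arrivals_at \<omega> i \<subseteq> arrivals \<omega>"
        unfolding arrivals_def by blast
      then show "infinite (arrivals \<omega>)"
        using elim(2) i finite_subset by blast
      show "(\<lambda>m. (\<Sum>k<m. of_bool (k \<in> arrivals \<omega>)) / elapsed \<omega> m) \<longlonglongrightarrow> lam * real (card V)"
      proof (rule Lim_transform_eventually)
        show "(\<lambda>m. ((\<Sum>k<m. of_bool (fst (\<omega> k) \<in> range Arrival)) / elapsed \<omega> m
            - time_avg \<omega> (compensator (\<lambda>_ e. of_bool (e \<in> range Arrival))) m) + lam * real (card V))
            \<longlonglongrightarrow> lam * real (card V)"
          using tendsto_add[OF elim(5) tendsto_const] by simp
        show "\<forall>\<^sub>F m in sequentially. ((\<Sum>k<m. of_bool (fst (\<omega> k) \<in> range Arrival)) / elapsed \<omega> m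
            - time_avg \<omega> (compensator (\<lambda>_ e. of_bool (e \<in> range Arrival))) m) + lam * real (card V) =
            (\<Sum>k<m. of_bool (k \<in> arrivals \<omega>)) / elapsed \<omega> m"
          using eventually_gt_at_top[of 0]
        proof eventually_elim
          case (elim m)
          have "k \<in> arrivals \<omega> \<longleftrightarrow> fst (\<omega> k) \<in> range Arrival" for k
            unfolding arrivals_def by blast
          moreover have "time_avg \<omega> (\<lambda>_. lam * real (card V)) m = lam * real (card V)"
            using pos elim by (rule time_avg_const)
          ultimately show ?case
            by (simp only: compensator_arrivals)
        qed
      qed
      show "lam * real (card V) > 0"
        using lam_pos card_V_pos by simp
      show "\<forall>\<^sub>F n in sequentially. c \<le> time_avg \<omega> (\<lambda>y. real (min (snd y i) K)) n" if "i \<in> V" for i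
        using elim(1) that by blast
    qed (use pos nodes in auto)
    also have "real (card V) * c / (lam * real (card V)) = c / lam"
    proof -
      have "V \<noteq> {}"
        using card_V_pos by auto
      then show ?thesis by simp
    qed
    finally show ?case
      by (simp only: c_def)
  qed
qed

text \<open>The slack is set to \<open>1\<close>, since additive constants are negligible against
  \<open>max_hit\<close>. \<open>K\<close> stays free because the mean delay does not involve
  it.\<close>

lemma mean_delay_ge:
  assumes K: "K > 0"
  shows "mean_delay L lam mu nu p s \<ge> ennreal
    (((lam * max_hit / inv_prob - mu * max_hit * (1 - 2 / inv_prob) - (inv_prob - 1)) /
      (1 + lam * max_hit / real K) - 2) / lam)"
proof -
  let ?c = "((lam * max_hit / inv_prob - mu * max_hit * (1 - 2 / inv_prob) - (inv_prob - 1)) /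
      (1 + lam * max_hit / real K) - 1 - 1) / lam"
  have "ennreal ?c = (\<integral>\<^sup>+\<omega>. ennreal ?c \<partial>law)"
    by (simp add: N.emeasure_space_1)
  also have "\<dots> \<le> mean_delay L lam mu nu p s"
    unfolding mean_delay_def using AE_average_delay[OF K, of 1] by (intro nn_integral_mono_AE) simp
  finally show ?thesis
    by simp
qed

end

lemma grid_networkI:
  assumes "L \<ge> 4" "even L" "lam > 0" "mu > 0" "nu > 0" "0 < p" "p \<le> 1" "s \<in> states L"
  shows "grid_network L lam mu nu p s"
  using assms by unfold_locales auto

lemma expected_transition_time_le:
  assumes "L \<ge> 4" "even L" "lam > 0" "mu > 0" "nu > 0" "0 < p" "p \<le> 1"
  shows "expected_transition_time L lam mu nu p \<le> ennreal (hard_core.max_hit L (p * mu) nu)"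
proof -
  interpret even_torus L
    using assms by unfold_locales
  have "(Ev, \<lambda>_. 0) \<in> states L"
    using E_indep by (simp add: states_def)
  then interpret grid_network L lam mu nu p "(Ev, \<lambda>_. 0)"
    using assms by (intro grid_networkI)
  show ?thesis
    using expected_hitting_time_le by (simp add: expected_transition_time_def Let_def)
qed

lemma inverse_antimono_ennreal:
  fixes x y :: ennreal
  assumes "x \<le> y"
  shows "inverse y \<le> inverse x"
  using assms including ennreal.lifting by transfer (rule ereal_inverse_antimono)

text \<open>In the last hypothesis \<open>M / sigma\<close> controls \<open>inv_prob - 2\<close>,
  the fraction \<open>mu * (2 * n0) / (lam * (sigma / n0 - 1))\<close> dominates
  \<open>1 / (lam * max_hit)\<close>, and \<open>1 + \<eta>\<close> pays for the cap. All of these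
  depend on \<open>nu\<close> and \<open>p\<close> only through \<open>sigma\<close>.\<close>

lemma delay_ratio_ge:
  assumes L: "L \<ge> 4" "even L" and "lam > 0" "mu > 0" "nu > 0" "0 < p" "p \<le> 1" "s \<in> states L"
    and \<eta>: "\<eta> > 0" and c: "c > 0"
    and M: "M = real (card (indep_sets L))" and n0: "n0 = real (card (odd_nodes L))"
    and \<sigma>: "sigma mu nu p \<ge> M" "sigma mu nu p \<ge> 1" "sigma mu nu p > n0"
    and ge: "(1 / 2 - M / (4 * sigma mu nu p) - mu / lam * (M / (2 * sigma mu nu p))
        - 2 * (mu * (2 * n0) / (lam * (sigma mu nu p / n0 - 1)))) / (1 + \<eta>)
        - 2 * (mu * (2 * n0) / (lam * (sigma mu nu p / n0 - 1))) \<ge> c"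
  shows "ennreal c \<le> mean_delay L lam mu nu p s / expected_transition_time L lam mu nu p"
proof -
  interpret grid_network L lam mu nu p s
    using assms by (intro grid_networkI)
  define H where "H = max_hit"
  define r where "r = inv_prob"
  define \<sigma> where "\<sigma> = sigma mu nu p"
  define h where "h = mu * (2 * n0) / (lam * (\<sigma> / n0 - 1))"
  define \<epsilon> where "\<epsilon> = M / \<sigma>"
  have pmu: "p * mu > 0" "p * mu \<le> mu"
    using p_pos mu_pos p_le_1 by auto
  have \<sigma>_eq: "nu / (p * mu) = \<sigma>"
    by (simp add: \<sigma>_def sigma_def)
  have \<sigma>1: "\<sigma> \<ge> 1" "\<sigma> \<ge> M" "\<sigma> > n0"
    using \<sigma> by (simp_all add: \<sigma>_def)
  have n0_pos: "n0 > 0"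
  proof -
    have "card Od > 0"
      using card_V_pos card_E_O(2,3) by linarith
    then show ?thesis by (simp add: n0)
  qed
  have "card V = 2 * card Od"
    by (simp only: card_E_O(2,3))
  then have cardV: "real (card V) = 2 * n0"
    by (simp only: n0 of_nat_mult of_nat_numeral)
  have \<epsilon>: "0 \<le> \<epsilon>" "\<epsilon> \<le> 1"
    using \<sigma>1 by (auto simp: \<epsilon>_def M divide_le_eq)
  have r: "2 \<le> r" "r \<le> 2 + \<epsilon>"
  proof -
    show "2 \<le> r" using inv_prob_ge by (simp add: r_def)
    have "p * mu \<le> nu"
    proof -
      have "nu = \<sigma> * (p * mu)"
        using pmu \<sigma>_eq by (simp add: divide_eq_eq split: if_splits)
      then show ?thesis
        using mult_right_mono[OF \<sigma>1(1), of "p * mu"] pmu by simp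
    qed
    then have "inv_prob \<le> 2 + M * (p * mu / nu)"
      using inv_prob_le by (simp add: M)
    also have "p * mu / nu = 1 / \<sigma>"
      using \<sigma>_eq by auto
    finally show "r \<le> 2 + \<epsilon>"
      by (simp add: r_def \<epsilon>_def)
  qed
  have s0: "\<sigma> / n0 - 1 > 0"
    using \<sigma>1 n0_pos by simp
  have "\<sigma> / n0 - 1 \<le> p * mu * (2 * n0) * H"
  proof -
    have "nu / (p * mu * n0) = \<sigma> / n0"
      using \<sigma>_eq by auto
    then show ?thesis
      using max_hit_ge by (simp add: cardV H_def flip: n0)
  qed
  have H0: "H > 0"
  proof (rule ccontr)
    assume "\<not> H > 0"
    then have "p * mu * (2 * n0) * H \<le> 0"
      using pmu n0_pos by (intro mult_nonneg_nonpos) auto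
    with s0 \<open>\<sigma> / n0 - 1 \<le> p * mu * (2 * n0) * H\<close> show False by linarith
  qed
  \<comment> \<open>Replacing \<open>p * mu\<close> by \<open>mu\<close> makes the lower bound on
    \<open>H\<close> uniform in \<open>p\<close>.\<close>
  have "\<sigma> / n0 - 1 \<le> mu * (2 * n0) * H"
    using \<open>\<sigma> / n0 - 1 \<le> p * mu * (2 * n0) * H\<close> pmu p_le_1 n0_pos H0
    by (elim order.trans) (auto intro!: mult_right_mono)
  then have h: "1 / (lam * H) \<le> h"
    using H0 lam_pos s0 by (simp add: h_def divide_simps mult_ac)
  \<comment> \<open>Chosen after \<open>H\<close>, so that the factor due to the cap is at most
    \<open>1 + \<eta>\<close>.\<close>
  obtain K :: nat where K: "real K > lam * H / \<eta>"
    using reals_Archimedean2 by blast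
  have K0: "K > 0"
  proof -
    have "lam * H / \<eta> > 0"
      using lam_pos H0 \<eta> by simp
    then show ?thesis using K by (cases K) auto
  qed
  have D: "1 + lam * H / real K \<le> 1 + \<eta>" "1 + lam * H / real K > 0"
  proof -
    have "lam * H < real K * \<eta>"
      using K \<eta> by (simp add: pos_divide_less_eq)
    then have "lam * H / real K \<le> \<eta>"
      using K0 by (simp add: pos_divide_le_eq mult.commute)
    moreover have "lam * H / real K > 0"
      using lam_pos H0 K0 by simp
    ultimately show "1 + lam * H / real K \<le> 1 + \<eta>" "1 + lam * H / real K > 0"
      by linarith+
  qed
  define A where "A = 1 / 2 - \<epsilon> / 4 - mu / lam * (\<epsilon> / 2) - 2 * h"
  have c_le: "c \<le> A / (1 + \<eta>) - 2 * h"
    using ge by (simp add: A_def h_def \<epsilon>_def \<sigma>_def mult.commute)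
  have h0: "h \<ge> 0"
    using mu_pos n0_pos lam_pos s0 by (simp add: h_def)
  have A0: "A \<ge> 0"
  proof -
    have "A / (1 + \<eta>) > 0" using c_le c h0 by linarith
    then show ?thesis using \<eta> by (simp add: zero_less_divide_iff)
  qed
  define num where "num = lam * H / r - mu * H * (1 - 2 / r) - (r - 1)"
  have num: "lam * H * A \<le> num"
  proof -
    \<comment> \<open>Tangent line at \<open>0\<close>: the product of the left side with
      \<open>2 + \<epsilon>\<close> is \<open>1 - \<epsilon>^2 / 4\<close>.\<close>
    have "1 / 2 - \<epsilon> / 4 \<le> 1 / (2 + \<epsilon>)"
    proof -
      have "(1 / 2 - \<epsilon> / 4) * (2 + \<epsilon>) \<le> 1"
        using \<epsilon> by (simp add: algebra_simps)
      then show ?thesis using \<epsilon> by (simp add: le_divide_eq)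
    qed
    also have "\<dots> \<le> 1 / r"
      using r by (intro divide_left_mono) auto
    finally have r1: "1 / 2 - \<epsilon> / 4 \<le> 1 / r" .
    have "lam * H * (1 / 2 - \<epsilon> / 4) \<le> lam * H / r"
      using mult_left_mono[OF r1, of "lam * H"] lam_pos H0 by simp
    moreover have "mu * H * (1 - 2 / r) \<le> mu * H * (\<epsilon> / 2)"
      using r1 mu_pos H0 by (intro mult_left_mono) auto
    \<comment> \<open>Since \<open>\<epsilon> \<le> 1\<close>, the left side is at most
      \<open>2\<close>, and \<open>h * (lam * H)\<close> is at least \<open>1\<close>.\<close>
    moreover have "r - 1 \<le> 2 * h * (lam * H)"
    proof -
      have "1 \<le> h * (lam * H)"
        using h lam_pos H0 by (simp add: divide_le_eq)
      then show ?thesis using r \<epsilon> by linarith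
    qed
    moreover have "lam * H * A = lam * H * (1 / 2 - \<epsilon> / 4) - mu * H * (\<epsilon> / 2) - 2 * h * (lam * H)"
      using lam_pos by (simp add: A_def field_simps)
    ultimately show ?thesis
      unfolding num_def by linarith
  qed
  have "lam * H * c \<le> lam * H * (A / (1 + \<eta>) - 2 * h)"
    using c_le lam_pos H0 by (intro mult_left_mono) auto
  also have "\<dots> = lam * H * A / (1 + \<eta>) - 2 * (h * (lam * H))"
    by (simp add: algebra_simps)
  also have "\<dots> \<le> lam * H * A / (1 + lam * H / real K) - 2"
  proof -
    have "lam * H * A / (1 + \<eta>) \<le> lam * H * A / (1 + lam * H / real K)"
      using D A0 lam_pos H0 \<eta> by (intro divide_left_mono) auto
    moreover have "1 \<le> h * (lam * H)"
      using h lam_pos H0 by (simp add: divide_le_eq)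
    ultimately show ?thesis by linarith
  qed
  also have "\<dots> \<le> num / (1 + lam * H / real K) - 2"
    using num D by (intro diff_right_mono divide_right_mono) auto
  finally have "c * H \<le> (num / (1 + lam * H / real K) - 2) / lam"
    using lam_pos by (simp add: le_divide_eq mult_ac)
  then have "ennreal (c * H) \<le> mean_delay L lam mu nu p s"
    using mean_delay_ge[OF K0] unfolding num_def H_def r_def
    by (meson ennreal_leI order.trans)
  moreover have "expected_transition_time L lam mu nu p \<le> ennreal H"
    unfolding H_def using assms by (intro expected_transition_time_le)
  ultimately have "ennreal (c * H) / ennreal H \<le> mean_delay L lam mu nu p s / expected_transition_time L lam mu nu p"
    unfolding divide_ennreal_def by (intro mult_mono inverse_antimono_ennreal) auto
  moreover have "ennreal (c * H) / ennreal H = ennreal c"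
    using c H0 by (simp add: divide_ennreal)
  ultimately show ?thesis by simp
qed

theorem theorem3p2:
  fixes L :: nat and lam mu rho :: real and init :: "real \<Rightarrow> real \<Rightarrow> state"
  assumes "L \<ge> 4" and "even L"
    and "lam > 0" and "mu > 0"
    and "rho = 2 * lam / mu" and "rho < 1"
    and "\<And>nu p. nu > 0 \<Longrightarrow> 0 < p \<Longrightarrow> p \<le> 1 \<Longrightarrow> init nu p \<in> states L"
  shows "Liminf (sigma_to_infinity mu)
           (\<lambda>(nu, p). mean_delay L lam mu nu p (init nu p) / expected_transition_time L lam mu nu p)
         \<ge> ennreal (1 / 4 * (mu / (mu - lam)))
         \<and> 1 / 4 * (mu / (mu - lam)) = 1 / (4 - 2 * rho)"
proof
  have lam: "2 * lam < mu"
    using assms by (simp add: divide_less_eq)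
  define c where "c = 1 / 4 * (mu / (mu - lam))"
  \<comment> \<open>Chosen so that \<open>c * (1 + \<eta>)\<close> is the midpoint of
    \<open>c\<close> and \<open>1/2\<close>; dividing \<open>1/2\<close> by
    \<open>1 + \<eta>\<close> then still leaves more than \<open>c\<close>.\<close>
  define \<eta> where "\<eta> = (1 / (2 * c) - 1) / 2"
  define M where "M = real (card (indep_sets L))"
  define n0 where "n0 = real (card (odd_nodes L))"
  define b where "b \<sigma> = mu * (2 * n0) / (lam * (\<sigma> / n0 - 1))" for \<sigma> :: real
  define g where "g \<sigma> = (1 / 2 - M / (4 * \<sigma>) - mu / lam * (M / (2 * \<sigma>)) - 2 * b \<sigma>) / (1 + \<eta>) - 2 * b \<sigma>" for \<sigma>
  have c: "0 < c" "c < 1 / 2"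
    using lam assms(3,4) by (auto simp: c_def divide_simps)
  then have \<eta>: "\<eta> > 0"
    by (simp add: \<eta>_def divide_simps)
  have "c * (1 + \<eta>) = c / 2 + 1 / 4"
    using c by (simp add: \<eta>_def field_simps)
  then have c_less: "c < (1 / 2 - 0 - mu / lam * 0 - 2 * 0) / (1 + \<eta>) - 2 * 0"
    using c \<eta> pos_less_divide_eq[of "1 + \<eta>" c "1 / 2"] by simp
  have n0: "n0 > 0"
  proof -
    have "(1, 2) \<in> odd_nodes L"
      using assms(1) by (simp add: odd_nodes_def nodes_def)
    moreover have "finite (odd_nodes L)"
      using finite_nodes[of L] by (simp add: odd_nodes_def)
    ultimately show ?thesis
      unfolding n0_def by (auto simp: card_gt_0_iff)
  qed
  have const: "((\<lambda>\<sigma>. M / (k * \<sigma>)) \<longlongrightarrow> 0) at_top" if "k > 0" for k :: real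
    using that by (intro real_tendsto_divide_at_top[OF tendsto_const]
        filterlim_tendsto_pos_mult_at_top[OF tendsto_const] filterlim_ident)
  have "filterlim (\<lambda>\<sigma>. - lam + lam / n0 * \<sigma>) at_top at_top"
    using n0 assms(3) by (intro filterlim_tendsto_add_at_top[OF tendsto_const]
        filterlim_tendsto_pos_mult_at_top[OF tendsto_const] filterlim_ident) simp
  also have "(\<lambda>\<sigma>. - lam + lam / n0 * \<sigma>) = (\<lambda>\<sigma>. lam * (\<sigma> / n0 - 1))"
    by (simp add: fun_eq_iff algebra_simps)
  finally have b: "(b \<longlongrightarrow> 0) at_top"
    unfolding b_def by (rule real_tendsto_divide_at_top[OF tendsto_const])
  have "(g \<longlongrightarrow> (1 / 2 - 0 - mu / lam * 0 - 2 * 0) / (1 + \<eta>) - 2 * 0) at_top"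
    unfolding g_def using \<eta> by (intro tendsto_intros const b) auto
  then have "\<forall>\<^sub>F \<sigma> in at_top. g \<sigma> > c"
    using c_less by (rule order_tendstoD)
  then have "\<forall>\<^sub>F \<sigma> in at_top. g \<sigma> > c \<and> \<sigma> \<ge> M \<and> \<sigma> \<ge> 1 \<and> \<sigma> > n0"
    by (intro eventually_conj eventually_ge_at_top eventually_gt_at_top)
  \<comment> \<open>\<open>g\<close> is a function of \<open>sigma\<close> alone, so a single
    threshold serves all admissible pairs of \<open>nu\<close> and \<open>p\<close>.\<close>
  then obtain \<sigma>0 where \<sigma>0: "\<And>\<sigma>. \<sigma> \<ge> \<sigma>0 \<Longrightarrow> g \<sigma> > c \<and> \<sigma> \<ge> M \<and> \<sigma> \<ge> 1 \<and> \<sigma> > n0"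
    unfolding eventually_at_top_linorder by blast
  have "\<forall>\<^sub>F (nu, p) in sigma_to_infinity mu.
      ennreal c \<le> mean_delay L lam mu nu p (init nu p) / expected_transition_time L lam mu nu p"
    unfolding eventually_sigma_to_infinity
  proof (intro exI[of _ \<sigma>0] allI impI, unfold prod.case)
    fix nu p :: real assume nu: "nu > 0" "0 < p" "p \<le> 1" and \<sigma>: "sigma mu nu p \<ge> \<sigma>0"
    show "ennreal c \<le> mean_delay L lam mu nu p (init nu p) / expected_transition_time L lam mu nu p"
      using \<sigma>0[OF \<sigma>] assms(7)[OF nu]
      by (intro delay_ratio_ge[OF assms(1-4) nu _ \<eta> c(1) M_def n0_def]) (auto simp: g_def b_def)
  qed
  then show "Liminf (sigma_to_infinity mu)
      (\<lambda>(nu, p). mean_delay L lam mu nu p (init nu p) / expected_transition_time L lam mu nu p)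
      \<ge> ennreal (1 / 4 * (mu / (mu - lam)))"
    unfolding c_def by (intro Liminf_bounded) (simp add: case_prod_unfold)
  show "1 / 4 * (mu / (mu - lam)) = 1 / (4 - 2 * rho)"
    using assms lam by (simp add: field_simps)
qed

end
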